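(* Let $D$ be a central, essential, indecomposable hyperplane arrangement in $\mathbb{C}^n$, $n\ge3$, and let $U=\mathbb{P}^{n-1}\setminus\mathbb{P}(D)$. Let $x_1,\dots,x_{b_1}$ be the coordinates on $H^1(U)$ and $\phi_1$ the $b_2\times b_1$ matrix of linear forms described in the context. Let $1\le i\le b_1$. Then every maximal (that is, $\beta_1\times\beta_1$) minor $m$ of the $b_2\times\beta_1$ matrix obtained from $\phi_1$ by removing the $i$-th column is divisible by $x_i$ in $\mathbb{C}[x_1,\dots,x_{b_1}]$, and $R^1(U)$ is the common zero locus in $H^1(U)$ of the polynomials $x_i^{-1}m$, where $m$ ranges over these maximal minors.
   Context: A hyperplane arrangement $D$ in $\mathbb{C}^n$ is a finite set of hyperplanes. Central: all hyperplanes contain the origin. Essential: the intersection of all hyperplanes is $\{0\}$. Indecomposable: there is no choice of linear coordinates for which the product of the linear forms defining the hyperplanes is a product of two non-constant polynomials in disjoint sets of variables. $\mathbb{P}(D)\subset\mathbb{P}^{n-1}$ is the projectivization of the union of the hyperplanes. $H^i(U)=H^i(U,\mathbb{C})$, $b_i=\dim_{\mathbb{C}}H^i(U)$, $\beta_1=b_1-b_0=b_1-1$. $R^1(U)=\{v\in H^1(U)\mid H^1(H^\bullet(U),v\cup\cdot)\ne0\}$, where $(H^\bullet(U),v\cup\cdot)$ is the complex given by cup product with $v$. Fix a basis $e_1,\dots,e_{b_1}$ of $H^1(U)$ with dual basis $x_1,\dots,x_{b_1}$ of $H^1(U)^\vee$, put $S=\mathbb{C}[x_1,\dots,x_{b_1}]$,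 and fix a basis of $H^2(U)$. $\phi_1$ is the $b_2\times b_1$ matrix of linear forms representing the $S$-linear map $S\otimes H^1(U)\to S\otimes H^2(U)$, $1\otimes w\mapsto\sum_kx_k\otimes(e_k\cup w)$; its $l$-th column corresponds to $e_l$. *)

theory Defs
  imports
    "HOL-Analysis.Analysis"
    "HOL-Homology.Homology"
    "HOL-Library.Poly_Mapping"
    "Jordan_Normal_Form.DL_Submatrix"
    "Jordan_Normal_Form.VS_Connect"
begin

no_notation Matrix.vec_index (infixl "$" 100)

section \<open>Polynomials over the complex numbers\<close>

text \<open>
  \<open>'v cpoly\<close> is the polynomial ring over the complex numbers with one variable for each element
  of \<open>'v\<close>; a monomial is its exponent function, and multiplication is convolution.
\<close>

type_synonym 'v cpoly = "('v \<Rightarrow>\<^sub>0 nat) \<Rightarrow>\<^sub>0 complex"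

definition poly_const :: "complex \<Rightarrow> 'v cpoly" where
  "poly_const c = Poly_Mapping.single 0 c"

definition poly_var :: "'v \<Rightarrow> 'v cpoly" where
  "poly_var k = Poly_Mapping.single (Poly_Mapping.single k 1) 1"

definition poly_vars :: "'v cpoly \<Rightarrow> 'v set" where
  "poly_vars p = (\<Union>m\<in>Poly_Mapping.keys p. Poly_Mapping.keys m)"

definition poly_ring_in :: "'v set \<Rightarrow> 'v cpoly set" where
  "poly_ring_in V = {p. poly_vars p \<subseteq> V}"

definition poly_eval :: "('v \<Rightarrow> complex) \<Rightarrow> 'v cpoly \<Rightarrow> complex" where
  "poly_eval a p = (\<Sum>m\<in>Poly_Mapping.keys p.
     Poly_Mapping.lookup p m * (\<Prod>k\<in>Poly_Mapping.keys m. a k ^ Poly_Mapping.lookup m k))"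

section \<open>Hyperplane arrangements\<close>

definition affine_form_zeros :: "complex ^ 'n \<Rightarrow> complex \<Rightarrow> (complex ^ 'n) set" where
  "affine_form_zeros a b = {x. (\<Sum>k\<in>UNIV. a $ k * x $ k) = b}"

definition hyperplane_arrangement :: "(complex ^ 'n) set set \<Rightarrow> bool" where
  "hyperplane_arrangement D \<longleftrightarrow>
     finite D \<and> (\<forall>H\<in>D. \<exists>a b. a \<noteq> 0 \<and> H = affine_form_zeros a b)"

definition central_arrangement :: "(complex ^ 'n) set set \<Rightarrow> bool" where
  "central_arrangement D \<longleftrightarrow> (\<forall>H\<in>D. 0 \<in> H)"

definition essential_arrangement :: "(complex ^ 'n) set set \<Rightarrow> bool" where
  "essential_arrangement D \<longleftrightarrow> \<Inter>D = {0}"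

definition linear_form :: "complex ^ 'n \<Rightarrow> 'n cpoly" where
  "linear_form a = (\<Sum>k\<in>UNIV. poly_const (a $ k) * poly_var k)"

text \<open>
  \<open>\<alpha> H\<close> is the coefficient vector of a linear form defining the hyperplane \<open>H\<close>.  A choice of linear
  coordinates \<open>y\<close> is an invertible matrix \<open>B\<close> with \<open>x = B y\<close>; in these coordinates the form has
  coefficient vector \<open>\<alpha> H v* B\<close>.
\<close>

definition decomposable_arrangement :: "(complex ^ 'n) set set \<Rightarrow> bool" where
  "decomposable_arrangement D \<longleftrightarrow>
     (\<exists>\<alpha> (B :: complex ^ 'n ^ 'n) P Q.
        (\<forall>H\<in>D. \<alpha> H \<noteq> 0 \<and> H = affine_form_zeros (\<alpha> H) 0) \<and>
        invertible B \<and>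
        (\<Prod>H\<in>D. linear_form (\<alpha> H v* B)) = P * Q \<and>
        P \<notin> range poly_const \<and> Q \<notin> range poly_const \<and>
        poly_vars P \<inter> poly_vars Q = {})"

definition indecomposable_arrangement :: "(complex ^ 'n) set set \<Rightarrow> bool" where
  "indecomposable_arrangement D \<longleftrightarrow> \<not> decomposable_arrangement D"

section \<open>The projective complement\<close>

text \<open>
  The points of projective space are the lines \<open>vec.span {v}\<close> with \<open>v \<noteq> 0\<close>, and the topology is the
  quotient topology from the punctured vector space.
\<close>

definition proj_space :: "(complex ^ 'n) set topology" where
  "proj_space = topology (\<lambda>W. W \<subseteq> (\<lambda>v. vec.span {v}) ` (- {0}) \<and>
     openin (top_of_set (- {0})) {v \<in> - {0}. vec.span {v} \<in> W})"

definition proj_union :: "(complex ^ 'n) set set \<Rightarrow> (complex ^ 'n) set set" where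
  "proj_union D = (\<lambda>v. vec.span {v}) ` (\<Union>D - {0})"

definition proj_complement :: "(complex ^ 'n) set set \<Rightarrow> (complex ^ 'n) set topology" where
  "proj_complement D = subtopology proj_space (topspace proj_space - proj_union D)"

lemma istopology_proj_space:
  "istopology (\<lambda>W. W \<subseteq> (\<lambda>v::complex^'n. vec.span {v}) ` (- {0}) \<and>
     openin (top_of_set (- {0})) {v \<in> - {0}. vec.span {v} \<in> W})"
  (is "istopology (\<lambda>W. ?sub W \<and> openin ?T (?pre W))")
proof -
  have pre_Int: "?pre (S \<inter> T) = ?pre S \<inter> ?pre T" for S T by blast
  have pre_Union: "?pre (\<Union>K) = \<Union>(?pre ` K)" for K by blast
  show ?thesis
    unfolding istopology_def
  proof (intro conjI allI impI)
    fix S T assume "?sub S \<and> openin ?T (?pre S)" "?sub T \<and> openin ?T (?pre T)"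
    then show "?sub (S \<inter> T)" "openin ?T (?pre (S \<inter> T))"
      unfolding pre_Int by (blast, blast intro: openin_Int)
  next
    fix K assume *: "\<forall>S\<in>K. ?sub S \<and> openin ?T (?pre S)"
    then show "?sub (\<Union>K)" by blast
    show "openin ?T (?pre (\<Union>K))"
      unfolding pre_Union using * by (intro openin_Union) blast
  qed
qed

lemma quotient_map_proj_space:
  "quotient_map (top_of_set (- {0})) proj_space (\<lambda>v::complex^'n. vec.span {v})"
proof -
  let ?P = "(\<lambda>v::complex^'n. vec.span {v}) ` (- {0})"
  have op: "openin proj_space W \<longleftrightarrow> W \<subseteq> ?P \<and>
     openin (top_of_set (- {0})) {v \<in> - {0}. vec.span {v} \<in> W}" for W
    unfolding proj_space_def topology_inverse'[OF istopology_proj_space] by (rule refl)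
  have pre: "{v \<in> - {0}. vec.span {v} \<in> ?P} = - {0}" by blast
  have "openin proj_space ?P"
    unfolding op pre using openin_subtopology_self by blast
  moreover have "topspace proj_space \<subseteq> ?P"
    using openin_topspace[of "proj_space :: (complex^'n) set topology"] unfolding op by blast
  ultimately have ts: "topspace proj_space = ?P"
    by (meson openin_subset subset_antisym)
  show ?thesis
    unfolding quotient_map_def using ts op by (simp add: topspace_subtopology)
qed

section \<open>Quotient vector spaces\<close>

definition quotient_module :: "('a, 'b, 'c) module_scheme \<Rightarrow> 'b set \<Rightarrow> ('a, 'b set) module" where
  "quotient_module M N =
     \<lparr> carrier = a_rcosets\<^bsub>M\<^esub> N, mult = undefined, one = undefined, zero = N, add = set_add M,
       smult = (\<lambda>c A. \<Union>a\<in>A. N +>\<^bsub>M\<^esub> (c \<odot>\<^bsub>M\<^esub> a)) \<rparr>"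

text \<open>Cohomology at the middle term of a complex \<open>L \<rightarrow> M \<rightarrow> N\<close> with differentials \<open>f\<close> and \<open>g\<close>.\<close>

definition middle_cohomology ::
  "('a, 'l, 'c1) module_scheme \<Rightarrow> ('a, 'm, 'c2) module_scheme \<Rightarrow> ('a, 'n, 'c3) module_scheme \<Rightarrow>
     ('l \<Rightarrow> 'm) \<Rightarrow> ('m \<Rightarrow> 'n) \<Rightarrow> ('a, 'm set) module" where
  "middle_cohomology L M N f g =
     quotient_module (M\<lparr>carrier := {x \<in> carrier M. g x = \<zero>\<^bsub>N\<^esub>}\<rparr>) (f ` carrier L)"

lemma additive_subgroup_submodule:
  assumes "submodule R N M"
  shows "additive_subgroup N M"
proof -
  interpret submodule R N M by fact
  interpret module R M by (rule module)
  show ?thesis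
  proof (intro additive_subgroupI group.subgroupI[OF a_group], simp_all)
    show "N \<subseteq> carrier M" by (rule subset)
    show "N \<noteq> {}" using submodule.zero_closed[OF assms] by blast
    fix a assume a: "a \<in> N"
    then have "a \<in> carrier M" using subset by blast
    then have "inv\<^bsub>add_monoid M\<^esub> a = (\<ominus>\<^bsub>R\<^esub> \<one>\<^bsub>R\<^esub>) \<odot>\<^bsub>M\<^esub> a"
      by (simp add: smult_l_minus a_inv_def[symmetric])
    then show "inv\<^bsub>add_monoid M\<^esub> a \<in> N"
      using a by (simp add: smult_closed)
  qed
qed

lemma module_quotient_module:
  assumes "submodule R N M"
  shows "module R (quotient_module M N)"
proof -
  interpret submodule R N M by fact
  interpret module R M by (rule module)
  interpret N: abelian_subgroup N M
    by (rule abelian_subgroupI3[OF additive_subgroup_submodule[OF assms] abelian_group_axioms])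
  let ?Q = "quotient_module M N"
  have car: "A \<in> carrier ?Q \<longleftrightarrow> (\<exists>x\<in>carrier M. A = N +>\<^bsub>M\<^esub> x)" for A
    by (auto simp: quotient_module_def A_RCOSETS_def')
  have zero: "\<zero>\<^bsub>?Q\<^esub> = N +>\<^bsub>M\<^esub> \<zero>\<^bsub>M\<^esub>"
    using subset by (simp add: quotient_module_def)
  have add: "(N +>\<^bsub>M\<^esub> x) \<oplus>\<^bsub>?Q\<^esub> (N +>\<^bsub>M\<^esub> y) = N +>\<^bsub>M\<^esub> (x \<oplus>\<^bsub>M\<^esub> y)"
    if "x \<in> carrier M" "y \<in> carrier M" for x y
    using N.a_rcos_sum[OF that] by (simp add: quotient_module_def)
  have smult: "c \<odot>\<^bsub>?Q\<^esub> (N +>\<^bsub>M\<^esub> x) = N +>\<^bsub>M\<^esub> (c \<odot>\<^bsub>M\<^esub> x)"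
    if c: "c \<in> carrier R" and x: "x \<in> carrier M" for c x
  proof -
    have "N +>\<^bsub>M\<^esub> (c \<odot>\<^bsub>M\<^esub> a) = N +>\<^bsub>M\<^esub> (c \<odot>\<^bsub>M\<^esub> x)" if "a \<in> N +>\<^bsub>M\<^esub> x" for a
    proof -
      obtain h where h: "h \<in> N" "a = h \<oplus>\<^bsub>M\<^esub> x" using \<open>a \<in> N +>\<^bsub>M\<^esub> x\<close> by (auto simp: a_r_coset_def')
      then have "c \<odot>\<^bsub>M\<^esub> a = c \<odot>\<^bsub>M\<^esub> h \<oplus>\<^bsub>M\<^esub> c \<odot>\<^bsub>M\<^esub> x"
        using c x subset by (simp add: smult_r_distr subsetD)
      then have "c \<odot>\<^bsub>M\<^esub> a \<in> N +>\<^bsub>M\<^esub> (c \<odot>\<^bsub>M\<^esub> x)"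
        using h c by (auto simp: a_r_coset_def')
      from a_repr_independence[OF this module.smult_closed[OF module_axioms c x] N.a_subgroup]
      show ?thesis by (rule sym)
    qed
    moreover have "N +>\<^bsub>M\<^esub> x \<noteq> {}" using N.a_rcos_self[OF x] by blast
    ultimately have "(\<Union>a\<in>N +>\<^bsub>M\<^esub> x. N +>\<^bsub>M\<^esub> (c \<odot>\<^bsub>M\<^esub> a)) = N +>\<^bsub>M\<^esub> (c \<odot>\<^bsub>M\<^esub> x)"
      by (rule SUP_eq_const[rotated])
    then show ?thesis by (simp only: quotient_module_def module.simps)
  qed
  show ?thesis
  proof (rule module_criteria)
    show "cring R" using module_axioms by (rule module.axioms(1))
    show "\<forall>v\<in>carrier ?Q. \<exists>w\<in>carrier ?Q. v \<oplus>\<^bsub>?Q\<^esub> w = \<zero>\<^bsub>?Q\<^esub>"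
    proof
      fix v assume "v \<in> carrier ?Q"
      then obtain x where x: "x \<in> carrier M" "v = N +>\<^bsub>M\<^esub> x" using car by blast
      then have "v \<oplus>\<^bsub>?Q\<^esub> (N +>\<^bsub>M\<^esub> (\<ominus>\<^bsub>M\<^esub> x)) = \<zero>\<^bsub>?Q\<^esub>"
        by (simp add: add zero M.r_neg)
      then show "\<exists>w\<in>carrier ?Q. v \<oplus>\<^bsub>?Q\<^esub> w = \<zero>\<^bsub>?Q\<^esub>" using x car by blast
    qed
    show "\<zero>\<^bsub>?Q\<^esub> \<in> carrier ?Q" unfolding car zero by blast
    show "\<forall>v w. v \<in> carrier ?Q \<and> w \<in> carrier ?Q \<longrightarrow> v \<oplus>\<^bsub>?Q\<^esub> w \<in> carrier ?Q"
      by (auto simp: car add intro: M.a_closed)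
    show "\<forall>c v. c \<in> carrier R \<and> v \<in> carrier ?Q \<longrightarrow> c \<odot>\<^bsub>?Q\<^esub> v \<in> carrier ?Q"
      by (auto simp: car smult intro: module.smult_closed[OF module_axioms])
    show "\<forall>v w. v \<in> carrier ?Q \<and> w \<in> carrier ?Q \<longrightarrow> v \<oplus>\<^bsub>?Q\<^esub> w = w \<oplus>\<^bsub>?Q\<^esub> v"
      by (auto simp: car add M.a_comm)
    show "\<forall>v w x. v \<in> carrier ?Q \<and> w \<in> carrier ?Q \<and> x \<in> carrier ?Q \<longrightarrow>
        v \<oplus>\<^bsub>?Q\<^esub> w \<oplus>\<^bsub>?Q\<^esub> x = v \<oplus>\<^bsub>?Q\<^esub> (w \<oplus>\<^bsub>?Q\<^esub> x)"
      by (auto simp: car add M.a_assoc)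
    show "\<forall>v\<in>carrier ?Q. v \<oplus>\<^bsub>?Q\<^esub> \<zero>\<^bsub>?Q\<^esub> = v"
      by (auto simp: car zero add)
    show "\<forall>a b v. a \<in> carrier R \<and> b \<in> carrier R \<and> v \<in> carrier ?Q \<longrightarrow>
        (a \<otimes>\<^bsub>R\<^esub> b) \<odot>\<^bsub>?Q\<^esub> v = a \<odot>\<^bsub>?Q\<^esub> (b \<odot>\<^bsub>?Q\<^esub> v)"
      by (auto simp: car smult smult_assoc1 module.smult_closed[OF module_axioms])
    show "\<forall>v\<in>carrier ?Q. \<one>\<^bsub>R\<^esub> \<odot>\<^bsub>?Q\<^esub> v = v"
      by (auto simp: car smult)
    show "\<forall>a b v. a \<in> carrier R \<and> b \<in> carrier R \<and> v \<in> carrier ?Q \<longrightarrow>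
        (a \<oplus>\<^bsub>R\<^esub> b) \<odot>\<^bsub>?Q\<^esub> v = a \<odot>\<^bsub>?Q\<^esub> v \<oplus>\<^bsub>?Q\<^esub> b \<odot>\<^bsub>?Q\<^esub> v"
      by (auto simp: car smult add smult_l_distr module.smult_closed[OF module_axioms])
    show "\<forall>a v w. a \<in> carrier R \<and> v \<in> carrier ?Q \<and> w \<in> carrier ?Q \<longrightarrow>
        a \<odot>\<^bsub>?Q\<^esub> (v \<oplus>\<^bsub>?Q\<^esub> w) = a \<odot>\<^bsub>?Q\<^esub> v \<oplus>\<^bsub>?Q\<^esub> a \<odot>\<^bsub>?Q\<^esub> w"
      by (auto simp: car smult add smult_r_distr module.smult_closed[OF module_axioms])
  qed
qed

lemma module_middle_cohomology:
  assumes f: "f \<in> module_hom R L M" and g: "g \<in> module_hom R M N"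
    and L: "module R L" and M: "module R M" and N: "module R N"
    and gf: "\<And>x. x \<in> carrier L \<Longrightarrow> g (f x) = \<zero>\<^bsub>N\<^esub>"
  shows "module R (middle_cohomology L M N f g)"
proof -
  interpret f: mod_hom R L M f using L M f by (intro mod_hom.intro mod_hom_axioms.intro)
  interpret g: mod_hom R M N g using M N g by (intro mod_hom.intro mod_hom_axioms.intro)
  have ker: "{x \<in> carrier M. g x = \<zero>\<^bsub>N\<^esub>} = g.ker" by (simp add: g.ker_def)
  have k: "submodule R g.ker M" by (rule g.ker_is_submodule)
  have "module R (M\<lparr>carrier := g.ker\<rparr>)" by (rule module.submodule_is_module[OF M k])
  moreover have "submodule R f.im M" by (rule f.im_is_submodule)
  moreover have "f.im \<subseteq> g.ker" using gf by (auto simp: f.im_def g.ker_def)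
  ultimately have "submodule R (f ` carrier L) (M\<lparr>carrier := g.ker\<rparr>)"
    by (simp add: submodule_def f.im_def)
  then show ?thesis
    unfolding middle_cohomology_def ker by (rule module_quotient_module)
qed

section \<open>Singular cohomology with complex coefficients\<close>

text \<open>
  A cochain is a function on singular simplices, extended by zero to all other functions.  As for
  \<^const>\<open>chain_boundary\<close>, \<open>coboundary p\<close> relates degrees \<open>p - 1\<close> and \<open>p\<close>, and is zero for
  \<open>p = 0\<close>, where \<open>p - 1\<close> truncates.
\<close>

type_synonym 'x cochain = "((nat \<Rightarrow> real) \<Rightarrow> 'x) \<Rightarrow> complex"

definition cochain_module :: "nat \<Rightarrow> 'x topology \<Rightarrow> (complex, 'x cochain) module" where
  "cochain_module p X =
     \<lparr> carrier = {f. \<forall>\<sigma>. \<not> singular_simplex p X \<sigma> \<longrightarrow> f \<sigma> = 0},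
       mult = undefined, one = undefined,
       zero = (\<lambda>\<sigma>. 0), add = (\<lambda>f g \<sigma>. f \<sigma> + g \<sigma>), smult = (\<lambda>c f \<sigma>. c * f \<sigma>) \<rparr>"

definition coboundary :: "nat \<Rightarrow> 'x topology \<Rightarrow> 'x cochain \<Rightarrow> 'x cochain" where
  "coboundary p X f = (\<lambda>\<sigma>. if p = 0 \<or> \<not> singular_simplex p X \<sigma> then 0
     else (\<Sum>k\<le>p. (- 1) ^ k * f (singular_face p k \<sigma>)))"

definition singular_cohomology :: "nat \<Rightarrow> 'x topology \<Rightarrow> (complex, 'x cochain set) module" where
  "singular_cohomology p X =
     middle_cohomology (cochain_module (p - 1) X) (cochain_module p X) (cochain_module (p + 1) X)
       (coboundary p X) (coboundary (p + 1) X)"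

text \<open>
  The library defines bases and dimensions only for records that satisfy the locale \<^locale>\<open>vectorspace\<close>,
  so the cohomology records are shown to do so.
\<close>

lemma module_cochain_module: "module class_ring (cochain_module p X)"
proof (rule module_criteria)
  show "\<forall>v\<in>carrier (cochain_module p X). \<exists>w\<in>carrier (cochain_module p X).
      v \<oplus>\<^bsub>cochain_module p X\<^esub> w = \<zero>\<^bsub>cochain_module p X\<^esub>"
  proof
    fix v assume "v \<in> carrier (cochain_module p X)"
    then show "\<exists>w\<in>carrier (cochain_module p X).
        v \<oplus>\<^bsub>cochain_module p X\<^esub> w = \<zero>\<^bsub>cochain_module p X\<^esub>"
      by (intro bexI[of _ "\<lambda>\<sigma>. - v \<sigma>"]) (auto simp: cochain_module_def)
  qed
qed (auto simp: cochain_module_def class_cring.cring_axioms algebra_simps)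

lemma coboundary_hom:
  "coboundary p X \<in> module_hom class_ring (cochain_module q Y) (cochain_module p X)"
proof -
  have "coboundary p X (\<lambda>\<sigma>. f \<sigma> + g \<sigma>) = (\<lambda>\<sigma>. coboundary p X f \<sigma> + coboundary p X g \<sigma>)" for f g
    by (rule ext) (simp add: coboundary_def sum.distrib distrib_left)
  moreover have "coboundary p X (\<lambda>\<sigma>. c * f \<sigma>) = (\<lambda>\<sigma>. c * coboundary p X f \<sigma>)" for c f
    by (rule ext) (simp add: coboundary_def sum_distrib_left mult.left_commute)
  moreover have "coboundary p X f \<in> carrier (cochain_module p X)" for f
    by (simp add: coboundary_def cochain_module_def)
  ultimately show ?thesis
    by (simp add: module_hom_def cochain_module_def)
qed

definition cochain_eval :: "'x cochain \<Rightarrow> 'x chain \<Rightarrow> complex" where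
  "cochain_eval f c = (\<Sum>\<sigma>\<in>Poly_Mapping.keys c. of_int (Poly_Mapping.lookup c \<sigma>) * f \<sigma>)"

lemma cochain_eval_superset:
  assumes "finite S" "Poly_Mapping.keys c \<subseteq> S"
  shows "cochain_eval f c = (\<Sum>\<sigma>\<in>S. of_int (Poly_Mapping.lookup c \<sigma>) * f \<sigma>)"
  unfolding cochain_eval_def using assms
  by (intro sum.mono_neutral_left) (auto simp: in_keys_iff)

lemma cochain_eval_add: "cochain_eval f (a + b) = cochain_eval f a + cochain_eval f b"
proof -
  let ?S = "Poly_Mapping.keys a \<union> Poly_Mapping.keys b"
  have fin: "finite ?S" by simp
  show ?thesis
    unfolding cochain_eval_superset[OF fin Poly_Mapping.keys_add]
      cochain_eval_superset[OF fin Un_upper1] cochain_eval_superset[OF fin Un_upper2]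
    by (simp add: lookup_add sum.distrib distrib_right)
qed

lemma cochain_eval_cmul: "cochain_eval f (frag_cmul k c) = of_int k * cochain_eval f c"
  using cochain_eval_superset[OF finite_keys keys_cmul, of f k c]
  by (simp add: cochain_eval_def sum_distrib_left mult.assoc)

lemma cochain_eval_zero: "cochain_eval f 0 = 0"
  by (simp add: cochain_eval_def)

lemma cochain_eval_sum: "cochain_eval f (sum g I) = (\<Sum>i\<in>I. cochain_eval f (g i))"
  by (induction I rule: infinite_finite_induct) (simp_all add: cochain_eval_zero cochain_eval_add)

lemma cochain_eval_frag_of: "cochain_eval f (frag_of \<sigma>) = f \<sigma>"
  by (simp add: cochain_eval_def)

lemma cochain_eval_coboundary:
  assumes "singular_chain p X c"
  shows "cochain_eval (coboundary p X f) c = cochain_eval f (chain_boundary p c)"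
proof (cases "p = 0")
  case True
  then show ?thesis by (simp add: cochain_eval_def coboundary_def chain_boundary_def)
next
  case False
  have "\<sigma> \<in> Poly_Mapping.keys c \<Longrightarrow> singular_simplex p X \<sigma>" for \<sigma>
    using assms by (auto simp: singular_chain_def)
  then show ?thesis
    using False
    unfolding cochain_eval_def[of "coboundary p X f"]
    by (simp add: chain_boundary_def frag_extend_def cochain_eval_sum cochain_eval_cmul
        cochain_eval_frag_of coboundary_def)
qed

lemma coboundary_coboundary: "coboundary (Suc p) X (coboundary p X f) = (\<lambda>\<sigma>. 0)"
proof
  fix \<sigma>
  show "coboundary (Suc p) X (coboundary p X f) \<sigma> = 0"
  proof (cases "singular_simplex (Suc p) X \<sigma>")
    case True
    then have c: "singular_chain (Suc p) X (frag_of \<sigma>)" by (simp add: singular_chain_of)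
    have "coboundary (Suc p) X (coboundary p X f) \<sigma> =
        cochain_eval (coboundary p X f) (chain_boundary (Suc p) (frag_of \<sigma>))"
      using cochain_eval_coboundary[OF c] by (simp add: cochain_eval_frag_of)
    also have "\<dots> = cochain_eval f (chain_boundary p (chain_boundary (Suc p) (frag_of \<sigma>)))"
      using singular_chain_boundary_alt[OF c] by (rule cochain_eval_coboundary)
    also have "\<dots> = 0"
      using chain_boundary_boundary[OF c] by (simp add: cochain_eval_zero)
    finally show ?thesis .
  qed (simp add: coboundary_def)
qed

lemma vectorspace_singular_cohomology: "vectorspace class_ring (singular_cohomology p X)"
proof (intro vectorspace.intro class_field)
  show "module class_ring (singular_cohomology p X)"
    unfolding singular_cohomology_def
    by (intro module_middle_cohomology module_cochain_module coboundary_hom)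
      (simp add: coboundary_coboundary, simp add: cochain_module_def)
qed

definition betti :: "nat \<Rightarrow> 'x topology \<Rightarrow> nat" where
  "betti p X = vectorspace.dim class_ring (singular_cohomology p X)"

text \<open>
  Points of \<^const>\<open>standard_simplex\<close> are zero beyond the last vertex, so the face on the first
  \<open>p + 1\<close> vertices is the inclusion \<open>standard_simplex p \<subseteq> standard_simplex (p + q)\<close>.
\<close>

definition front_face :: "nat \<Rightarrow> ((nat \<Rightarrow> real) \<Rightarrow> 'x) \<Rightarrow> (nat \<Rightarrow> real) \<Rightarrow> 'x" where
  "front_face p \<sigma> = restrict \<sigma> (standard_simplex p)"

definition back_face :: "nat \<Rightarrow> nat \<Rightarrow> ((nat \<Rightarrow> real) \<Rightarrow> 'x) \<Rightarrow> (nat \<Rightarrow> real) \<Rightarrow> 'x" where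
  "back_face p q \<sigma> = restrict (\<lambda>x. \<sigma> (\<lambda>i. if i < p then 0 else x (i - p))) (standard_simplex q)"

definition cochain_cup ::
  "nat \<Rightarrow> nat \<Rightarrow> 'x topology \<Rightarrow> 'x cochain \<Rightarrow> 'x cochain \<Rightarrow> 'x cochain" where
  "cochain_cup p q X f g = (\<lambda>\<sigma>. if singular_simplex (p + q) X \<sigma>
     then f (front_face p \<sigma>) * g (back_face p q \<sigma>) else 0)"

text \<open>
  The cosets in the following union all coincide when \<open>A\<close> and \<open>B\<close> are cohomology classes of degrees
  \<open>p\<close> and \<open>q\<close>.
\<close>

definition cup ::
  "nat \<Rightarrow> nat \<Rightarrow> 'x topology \<Rightarrow> 'x cochain set \<Rightarrow> 'x cochain set \<Rightarrow> 'x cochain set" where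
  "cup p q X A B = (\<Union>f\<in>A. \<Union>g\<in>B.
     \<zero>\<^bsub>singular_cohomology (p + q) X\<^esub> +>\<^bsub>cochain_module (p + q) X\<^esub> cochain_cup p q X f g)"

definition resonance1 :: "'x topology \<Rightarrow> 'x cochain set set" where
  "resonance1 X = {v \<in> carrier (singular_cohomology 1 X).
     let H = middle_cohomology
               (singular_cohomology 0 X) (singular_cohomology 1 X) (singular_cohomology 2 X)
               (cup 1 0 X v) (cup 1 1 X v)
     in carrier H \<noteq> {\<zero>\<^bsub>H\<^esub>}}"

section \<open>Bases, coordinates, and the matrix of linear forms\<close>

definition ordered_basis :: "(complex, 'b) module \<Rightarrow> 'b list \<Rightarrow> bool" where
  "ordered_basis V es \<longleftrightarrow> distinct es \<and> vectorspace.basis class_ring V (set es)"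

definition coordinates :: "(complex, 'b) module \<Rightarrow> 'b list \<Rightarrow> 'b \<Rightarrow> nat \<Rightarrow> complex" where
  "coordinates V es v = (THE c. (\<forall>k\<ge>length es. c k = 0) \<and>
     v = (\<Oplus>\<^bsub>V\<^esub>k\<in>{..<length es}. c k \<odot>\<^bsub>V\<^esub> es ! k))"

definition phi1 :: "'x topology \<Rightarrow> 'x cochain set list \<Rightarrow> 'x cochain set list \<Rightarrow> nat cpoly mat" where
  "phi1 X es fs = Matrix.mat (length fs) (length es) (\<lambda>(j, l).
     \<Sum>k<length es.
       poly_const (coordinates (singular_cohomology 2 X) fs (cup 1 1 X (es ! k) (es ! l)) j)
       * poly_var k)"

definition remove_col :: "nat \<Rightarrow> 'a mat \<Rightarrow> 'a mat" where
  "remove_col i A = submatrix A UNIV (- {i})"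

definition minors :: "nat \<Rightarrow> 'a::comm_ring_1 mat \<Rightarrow> 'a set" where
  "minors r A = {Determinant.det (submatrix A I J) | I J.
     I \<subseteq> {..<dim_row A} \<and> J \<subseteq> {..<dim_col A} \<and> card I = r \<and> card J = r}"

end

theory Submission
  imports Defs
begin

text \<open>
  Since classes of degree one anticommute, the columns \<open>c\<^sub>l\<close> of \<open>\<phi>\<^sub>1\<close> satisfy \<open>\<Sum>\<^sub>l x\<^sub>l c\<^sub>l = 0\<close>.
  If \<open>m\<^sub>i\<close> is the minor on a fixed set of rows in which column \<open>i\<close> is omitted, Cramer's rule gives
  \<open>x\<^sub>j m\<^sub>i = \<plusminus> x\<^sub>i m\<^sub>j\<close>; hence \<open>x\<^sub>i\<close> divides \<open>m\<^sub>i\<close>, and the quotient \<open>q\<close> satisfies \<open>m\<^sub>j = \<plusminus> x\<^sub>j q\<close> for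
  every \<open>j\<close>.  At a point \<open>v\<close> with \<open>v\<^sub>j \<noteq> 0\<close> all these \<open>q\<close> therefore vanish iff \<open>\<phi>\<^sub>1(v)\<close> has rank less than
  \<open>b\<^sub>1 - 1\<close>.  As the complement is path connected, the image of \<open>H\<^sup>0\<close> under \<open>v \<union> _\<close> is the line spanned
  by \<open>v\<close>, so this is the condition \<open>v \<in> R\<^sup>1\<close>.  The origin always lies in \<open>R\<^sup>1\<close>, and \<open>q\<close> vanishes there
  because it is homogeneous of degree \<open>b\<^sub>1 - 2 > 0\<close>: an essential indecomposable arrangement has more
  than \<open>n \<ge> 3\<close> hyperplanes, and the logarithmic classes of the quotients of the defining forms are
  independent, as is seen on small loops around the hyperplanes, so that \<open>b\<^sub>1 \<ge> 3\<close>.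
\<close>

section \<open>Polynomials and their evaluation\<close>

text \<open>The minors themselves do not cut out the resonance locus, since they vanish on all of
  \<open>x_i = 0\<close>; and at a point with \<open>x_i = 0\<close> the minor without column i says
  nothing about its quotient \<open>q\<close>. The exchange identity is what moves the test to a
  column whose coordinate is nonzero. The division works monomial by monomial: each monomial of
  \<open>x_j m_i\<close> contains x_i, and x_j does not supply it. The proof splits into linear
  algebra, carried out for any path connected space with \<open>b_1 >= 3\<close>, and geometry,
  which supplies these two properties. Degree matters at the origin only: for \<open>b_1 = 2\<close>
  the quotients are constants, and a nonzero one would exclude the origin. Cohomology classes are
  cosets of singular cochains, so the identities for cup products are shown with explicit
  primitives. Singular simplices are merely continuous, so instead of integrating dz/z one takes the
  change of a continuous logarithm along an edge; loops around the hyperplanes serve as a dual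
  family and bound \<open>b_1\<close> from below.\<close>

lemma poly_mapping_eq_sum_single:
  "p = (\<Sum>m\<in>Poly_Mapping.keys p. Poly_Mapping.single m (Poly_Mapping.lookup p m))"
proof (rule poly_mapping_eqI)
  fix k
  have "Poly_Mapping.lookup p k = (\<Sum>m\<in>Poly_Mapping.keys p. if m = k then Poly_Mapping.lookup p m else 0)"
    by (simp add: sum.delta in_keys_iff)
  also have "\<dots> = Poly_Mapping.lookup (\<Sum>m\<in>Poly_Mapping.keys p. Poly_Mapping.single m (Poly_Mapping.lookup p m)) k"
    unfolding lookup_sum by (intro sum.cong) (auto simp: lookup_single when_def)
  finally show "Poly_Mapping.lookup p k = \<dots>" .
qed

definition monom_eval :: "('v \<Rightarrow> complex) \<Rightarrow> ('v \<Rightarrow>\<^sub>0 nat) \<Rightarrow> complex" where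
  "monom_eval a m = (\<Prod>k\<in>Poly_Mapping.keys m. a k ^ Poly_Mapping.lookup m k)"

lemma monom_eval_superset:
  assumes "finite T" "Poly_Mapping.keys m \<subseteq> T"
  shows "monom_eval a m = (\<Prod>k\<in>T. a k ^ Poly_Mapping.lookup m k)"
  unfolding monom_eval_def using assms
  by (intro prod.mono_neutral_left) (auto simp: in_keys_iff)

lemma monom_eval_add: "monom_eval a (m + m') = monom_eval a m * monom_eval a m'"
proof -
  let ?T = "Poly_Mapping.keys m \<union> Poly_Mapping.keys m'"
  have fin: "finite ?T" by simp
  show ?thesis
    unfolding monom_eval_superset[OF fin Poly_Mapping.keys_add]
      monom_eval_superset[OF fin Un_upper1] monom_eval_superset[OF fin Un_upper2]
    by (simp add: lookup_add power_add prod.distrib)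
qed

text \<open>Coefficients off the support are zero, so polynomials with different supports can be
  evaluated over one common index set.\<close>

lemma poly_eval_superset:
  assumes "finite T" "Poly_Mapping.keys p \<subseteq> T"
  shows "poly_eval a p = (\<Sum>m\<in>T. Poly_Mapping.lookup p m * monom_eval a m)"
  unfolding poly_eval_def monom_eval_def[symmetric] using assms
  by (intro sum.mono_neutral_left) (auto simp: in_keys_iff)

lemma poly_eval_0: "poly_eval a 0 = 0"
  by (simp add: poly_eval_def)

lemma poly_eval_single: "poly_eval a (Poly_Mapping.single m c) = c * monom_eval a m"
  by (simp add: poly_eval_def monom_eval_def)

lemma poly_eval_add: "poly_eval a (p + q) = poly_eval a p + poly_eval a q"
proof -
  let ?T = "Poly_Mapping.keys p \<union> Poly_Mapping.keys q"
  have fin: "finite ?T" by simp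
  show ?thesis
    unfolding poly_eval_superset[OF fin Poly_Mapping.keys_add]
      poly_eval_superset[OF fin Un_upper1] poly_eval_superset[OF fin Un_upper2]
    by (simp add: lookup_add sum.distrib distrib_right)
qed

lemma poly_eval_sum: "poly_eval a (sum f I) = (\<Sum>i\<in>I. poly_eval a (f i))"
  by (induction I rule: infinite_finite_induct) (simp_all add: poly_eval_0 poly_eval_add)

lemma poly_eval_mult: "poly_eval a (p * q) = poly_eval a p * poly_eval a q"
proof -
  have "p * q = (\<Sum>m\<in>Poly_Mapping.keys p. \<Sum>m'\<in>Poly_Mapping.keys q.
      Poly_Mapping.single (m + m') (Poly_Mapping.lookup p m * Poly_Mapping.lookup q m'))"
    by (subst poly_mapping_eq_sum_single[of p], subst poly_mapping_eq_sum_single[of q])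
      (simp add: sum_product mult_single)
  then have "poly_eval a (p * q) = (\<Sum>m\<in>Poly_Mapping.keys p. \<Sum>m'\<in>Poly_Mapping.keys q.
      (Poly_Mapping.lookup p m * monom_eval a m) * (Poly_Mapping.lookup q m' * monom_eval a m'))"
    by (simp add: poly_eval_sum poly_eval_single monom_eval_add ac_simps)
  then show ?thesis
    by (simp add: sum_product poly_eval_superset[OF finite_keys order_refl])
qed

lemma monom_eval_0: "monom_eval a 0 = 1"
  by (simp add: monom_eval_def)

lemma monom_eval_single: "monom_eval a (Poly_Mapping.single k n) = a k ^ n"
  by (simp add: monom_eval_def)

lemma poly_eval_const: "poly_eval a (poly_const c) = c"
  by (simp add: poly_const_def poly_eval_single monom_eval_0)

lemma poly_eval_var: "poly_eval a (poly_var k) = a k"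
  by (simp add: poly_var_def poly_eval_single monom_eval_single)

text \<open>Packaged as a homomorphism so that evaluation can later be moved inside
  determinants.\<close>

lemma comm_ring_hom_poly_eval: "comm_ring_hom (poly_eval a)"
  by unfold_locales
    (simp_all add: poly_eval_0 poly_eval_add poly_eval_mult poly_eval_single monom_eval_0
      flip: single_one)

lemma continuous_poly_eval:
  assumes "\<And>k. continuous_on S (\<lambda>t. f t k)"
  shows "continuous_on S (\<lambda>t. poly_eval (f t) p)"
  unfolding poly_eval_def by (intro continuous_intros assms)

text \<open>Shifting exponents by \<open>e\<close> is injective, so no coefficients cancel.
  Divisibility by a variable and the support of a cofactor both rest on this.\<close>

lemma lookup_single_mult:
  fixes p :: "('v \<Rightarrow>\<^sub>0 nat) \<Rightarrow>\<^sub>0 'a::comm_semiring_1"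
  shows "Poly_Mapping.lookup (Poly_Mapping.single e 1 * p) (e + m) = Poly_Mapping.lookup p m"
proof -
  have "Poly_Mapping.single e 1 * p =
      (\<Sum>k\<in>Poly_Mapping.keys p. Poly_Mapping.single (e + k) (Poly_Mapping.lookup p k))"
    by (subst poly_mapping_eq_sum_single[of p]) (simp add: sum_distrib_left mult_single)
  then have "Poly_Mapping.lookup (Poly_Mapping.single e 1 * p) (e + m) =
      (\<Sum>k\<in>Poly_Mapping.keys p. if k = m then Poly_Mapping.lookup p k else 0)"
    unfolding lookup_sum by (auto simp: lookup_single when_def lookup_sum intro!: sum.cong)
  then show ?thesis by (simp add: sum.delta in_keys_iff)
qed

lemma poly_var_neq_0: "poly_var k \<noteq> 0"
  unfolding poly_var_def by (metis keys_single keys_zero insert_not_empty zero_neq_one)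

text \<open>Every monomial of \<open>poly_var j * p\<close> occurs in \<open>poly_var i * r\<close>
  and so contains the variable \<open>i\<close>. Since \<open>j\<close> is another variable, the
  monomial of \<open>p\<close> itself contains it.\<close>

lemma poly_var_dvd_cofactor:
  assumes "i \<noteq> j" "poly_var j * p = poly_var i * r"
  shows "poly_var i dvd p"
proof -
  let ?e = "\<lambda>k. Poly_Mapping.single k (1::nat)"
  have pos: "0 < Poly_Mapping.lookup m i" if "m \<in> Poly_Mapping.keys p" for m
  proof -
    have "?e j + m \<in> Poly_Mapping.keys (poly_var j * p)"
      using that unfolding poly_var_def in_keys_iff lookup_single_mult .
    then obtain m' where "?e j + m = ?e i + m'"
      using keys_mult[of "poly_var i" r] unfolding assms(2) by (auto simp: poly_var_def)
    then have "Poly_Mapping.lookup (?e j + m) i = Poly_Mapping.lookup (?e i + m') i" by simp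
    then show ?thesis using assms(1) by (simp add: lookup_add lookup_single when_def)
  qed
  \<comment> \<open>The subtraction of exponents truncates at zero; \<open>pos\<close> makes it
    exact here.\<close>
  have "Poly_Mapping.single m c = poly_var i * Poly_Mapping.single (m - ?e i) c"
    if "m \<in> Poly_Mapping.keys p" for m c
  proof -
    have "?e i + (m - ?e i) = m"
      using pos[OF that] by (intro poly_mapping_eqI) (auto simp: lookup_add lookup_minus lookup_single when_def)
    then show ?thesis by (simp add: poly_var_def mult_single)
  qed
  then have "p = (\<Sum>m\<in>Poly_Mapping.keys p. poly_var i * Poly_Mapping.single (m - ?e i) (Poly_Mapping.lookup p m))"
    by (subst (1) poly_mapping_eq_sum_single[of p]) (intro sum.cong refl)
  then show ?thesis
    unfolding sum_distrib_left[symmetric] by (rule dvdI)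
qed

section \<open>Polynomials in a prescribed set of variables\<close>

lemma poly_ring_in_sum:
  assumes "\<And>i. i \<in> I \<Longrightarrow> f i \<in> poly_ring_in V"
  shows "sum f I \<in> poly_ring_in V"
  using keys_sum[of f I] assms unfolding poly_ring_in_def poly_vars_def by fastforce

lemma poly_ring_in_mult:
  assumes "p \<in> poly_ring_in V" "q \<in> poly_ring_in V"
  shows "p * q \<in> poly_ring_in V"
  unfolding poly_ring_in_def poly_vars_def
proof clarsimp
  fix m k assume "m \<in> Poly_Mapping.keys (p * q)" and k: "k \<in> Poly_Mapping.keys m"
  then obtain m1 m2 where m: "m1 \<in> Poly_Mapping.keys p" "m2 \<in> Poly_Mapping.keys q" "m = m1 + m2"
    using keys_mult[of p q] by blast
  then have "k \<in> Poly_Mapping.keys m1 \<union> Poly_Mapping.keys m2"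
    using k Poly_Mapping.keys_add[of m1 m2] by blast
  then show "k \<in> V" using m assms unfolding poly_ring_in_def poly_vars_def by blast
qed

lemma poly_ring_in_const: "poly_const c \<in> poly_ring_in V"
  by (simp add: poly_ring_in_def poly_vars_def poly_const_def)

lemma poly_ring_in_var: "k \<in> V \<Longrightarrow> poly_var k \<in> poly_ring_in V"
  by (simp add: poly_ring_in_def poly_vars_def poly_var_def)

lemma poly_ring_in_1: "1 \<in> poly_ring_in V"
  using poly_ring_in_const[of 1 V] by (simp add: poly_const_def)

lemma poly_ring_in_uminus: "p \<in> poly_ring_in V \<Longrightarrow> - p \<in> poly_ring_in V"
  by (simp add: poly_ring_in_def poly_vars_def)

lemma poly_ring_in_prod:
  assumes "\<And>i. i \<in> I \<Longrightarrow> f i \<in> poly_ring_in V"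
  shows "prod f I \<in> poly_ring_in V"
  using assms by (induction I rule: infinite_finite_induct)
    (auto intro: poly_ring_in_1 poly_ring_in_mult)

lemma poly_ring_in_det:
  assumes A: "A \<in> carrier_mat n n"
    and "\<And>p q. p < n \<Longrightarrow> q < n \<Longrightarrow> A $$ (p, q) \<in> poly_ring_in V"
  shows "Determinant.det A \<in> poly_ring_in V"
  unfolding det_def'[OF A]
proof (intro poly_ring_in_sum poly_ring_in_mult poly_ring_in_prod)
  fix \<sigma> k assume "\<sigma> \<in> {\<sigma>. \<sigma> permutes {0..<n}}" "k \<in> {0..<n}"
  then show "A $$ (k, \<sigma> k) \<in> poly_ring_in V"
    using permutes_in_image[of \<sigma> "{0..<n}" k] by (intro assms) auto
next
  fix \<sigma>
  show "signof \<sigma> \<in> poly_ring_in V"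
    by (simp add: sign_def poly_ring_in_1 poly_ring_in_uminus)
qed

text \<open>Multiplication by a variable only shifts monomials, so each variable of \<open>q\<close>
  survives in the product. Divisibility yields a cofactor with arbitrary variables; this puts it
  back into the ring on the given ones.\<close>

lemma poly_ring_in_var_cofactor:
  assumes "poly_var i * q \<in> poly_ring_in V"
  shows "q \<in> poly_ring_in V"
  unfolding poly_ring_in_def poly_vars_def
proof clarsimp
  fix m k assume m: "m \<in> Poly_Mapping.keys q" and k: "k \<in> Poly_Mapping.keys m"
  let ?m = "Poly_Mapping.single i 1 + m"
  have "?m \<in> Poly_Mapping.keys (poly_var i * q)"
    using m unfolding poly_var_def in_keys_iff lookup_single_mult .
  moreover have "k \<in> Poly_Mapping.keys ?m"
    using k by (simp add: in_keys_iff lookup_add)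
  ultimately show "k \<in> V"
    using assms unfolding poly_ring_in_def poly_vars_def by blast
qed

section \<open>Maximal minors and kernels\<close>

lemma det_eq_0_iff_kernel:
  fixes M :: "nat \<Rightarrow> nat \<Rightarrow> 'a::field"
  shows "Determinant.det (Matrix.mat n n (\<lambda>(p, k). M p k)) = 0 \<longleftrightarrow>
    (\<exists>c. (\<exists>k<n. c k \<noteq> 0) \<and> (\<forall>p<n. (\<Sum>k<n. M p k * c k) = 0))"
proof -
  let ?A = "Matrix.mat n n (\<lambda>(p, k). M p k)"
  have A: "?A \<in> carrier_mat n n" by simp
  have mult: "?A *\<^sub>v v = 0\<^sub>v n \<longleftrightarrow> (\<forall>p<n. (\<Sum>k<n. M p k * vec_index v k) = 0)"
    if "v \<in> carrier_vec n" for v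
    using that by (auto simp: vec_eq_iff scalar_prod_def lessThan_atLeast0)
  show ?thesis
    unfolding det_0_iff_vec_prod_zero_field[OF A]
  proof
    assume "\<exists>v. v \<in> carrier_vec n \<and> v \<noteq> 0\<^sub>v n \<and> ?A *\<^sub>v v = 0\<^sub>v n"
    then obtain v where "v \<in> carrier_vec n" "v \<noteq> 0\<^sub>v n" "?A *\<^sub>v v = 0\<^sub>v n" by blast
    then show "\<exists>c. (\<exists>k<n. c k \<noteq> 0) \<and> (\<forall>p<n. (\<Sum>k<n. M p k * c k) = 0)"
      using mult[of v] by (intro exI[of _ "vec_index v"]) (auto simp: vec_eq_iff)
  next
    assume "\<exists>c. (\<exists>k<n. c k \<noteq> 0) \<and> (\<forall>p<n. (\<Sum>k<n. M p k * c k) = 0)"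
    then obtain c where "\<exists>k<n. c k \<noteq> 0" "\<forall>p<n. (\<Sum>k<n. M p k * c k) = 0" by blast
    then show "\<exists>v. v \<in> carrier_vec n \<and> v \<noteq> 0\<^sub>v n \<and> ?A *\<^sub>v v = 0\<^sub>v n"
      using mult[of "Matrix.vec n c"] by (intro exI[of _ "Matrix.vec n c"]) (auto simp: vec_eq_iff)
  qed
qed

text \<open>Zero equations pad the system to a square one. A zero row kills every term of the
  Leibniz expansion, so the determinant vanishes and a kernel vector exists.\<close>

lemma underdetermined_system:
  fixes M :: "'r \<Rightarrow> 'c \<Rightarrow> 'a::field"
  assumes "finite R" "finite C" "card R < card C"
  obtains c where "\<exists>k\<in>C. c k \<noteq> 0" "\<And>p. p \<in> R \<Longrightarrow> (\<Sum>k\<in>C. M p k * c k) = 0"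
proof -
  let ?n = "card C" and ?m = "card R"
  obtain g where g: "bij_betw g {..<?n} C"
    using ex_bij_betw_nat_finite[OF assms(2)] by (auto simp: lessThan_atLeast0)
  obtain h where h: "bij_betw h {..<?m} R"
    using ex_bij_betw_nat_finite[OF assms(1)] by (auto simp: lessThan_atLeast0)
  define N where "N = (\<lambda>p k. if p < ?m then M (h p) (g k) else 0)"
  let ?A = "Matrix.mat ?n ?n (\<lambda>(p, k). N p k)"
  \<comment> \<open>Row \<open>?m\<close> is a padding row; it exists because there are fewer
    equations than unknowns.\<close>
  have "(\<Prod>p = 0..<?n. ?A $$ (p, \<sigma> p)) = 0" if "\<sigma> permutes {0..<?n}" for \<sigma>
    using assms(3) permutes_in_image[OF that, of ?m]
    by (intro prod_zero bexI[of _ ?m]) (auto simp: N_def)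
  then have "Determinant.det ?A = 0"
    by (subst det_def'[of _ ?n]) (auto intro!: sum.neutral)
  then obtain c where c: "\<exists>k<?n. c k \<noteq> 0" "\<forall>p<?n. (\<Sum>k<?n. N p k * c k) = 0"
    unfolding det_eq_0_iff_kernel by blast
  let ?c = "\<lambda>x. c (the_inv_into {..<?n} g x)"
  have inv: "?c (g k) = c k" if "k < ?n" for k
    using g that by (simp add: the_inv_into_f_f bij_betw_def)
  show thesis
  proof
    obtain k where "k < ?n" "c k \<noteq> 0" using c(1) by blast
    then show "\<exists>x\<in>C. ?c x \<noteq> 0"
      using inv[of k] bij_betwE[OF g] by (intro bexI[of _ "g k"]) auto
    fix r assume "r \<in> R"
    then obtain p where p: "p < ?m" "r = h p" using h by (auto simp: bij_betw_def)
    have "(\<Sum>x\<in>C. M r x * ?c x) = (\<Sum>k<?n. M r (g k) * ?c (g k))"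
      by (rule sum.reindex_bij_betw[OF g, symmetric])
    also have "\<dots> = (\<Sum>k<?n. N p k * c k)" by (intro sum.cong) (auto simp: N_def p inv)
    also have "\<dots> = 0" using c(2) p(1) assms(3) by simp
    finally show "(\<Sum>x\<in>C. M r x * ?c x) = 0" .
  qed
qed

text \<open>A minimal set of equations with only the trivial solution is square: each equation is the only
  one violated by some vector, and these vectors are linearly independent.\<close>

lemma square_subsystem:
  fixes M :: "'r \<Rightarrow> 'c \<Rightarrow> 'a::field"
  assumes "finite R" "finite C"
    and triv: "\<And>c. (\<forall>p\<in>R. (\<Sum>k\<in>C. M p k * c k) = 0) \<Longrightarrow> \<forall>k\<in>C. c k = 0"
  obtains I where "I \<subseteq> R" "card I = card C"
    "\<And>c. (\<forall>p\<in>I. (\<Sum>k\<in>C. M p k * c k) = 0) \<Longrightarrow> \<forall>k\<in>C. c k = 0"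
proof -
  define T where "T J \<longleftrightarrow>
    (\<forall>c. (\<forall>p\<in>J. (\<Sum>k\<in>C. M p k * c k) = 0) \<longrightarrow> (\<forall>k\<in>C. c k = 0))" for J
  have "T R" unfolding T_def
  proof (intro allI impI)
    fix c assume "\<forall>p\<in>R. (\<Sum>k\<in>C. M p k * c k) = 0"
    then show "\<forall>k\<in>C. c k = 0" by (rule triv)
  qed
  then have "R \<subseteq> R \<and> T R" by simp
  from ex_has_least_nat[of "\<lambda>J. J \<subseteq> R \<and> T J" R card, OF this]
  obtain I where I1: "I \<subseteq> R" and TI: "T I"
    and min: "\<And>J. J \<subseteq> R \<Longrightarrow> T J \<Longrightarrow> card I \<le> card J" by blast
  have I2: "\<forall>k\<in>C. c k = 0" if "\<forall>p\<in>I. (\<Sum>k\<in>C. M p k * c k) = 0" for c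
    using TI[unfolded T_def] that by (elim allE impE)
  have fin: "finite I" using I1 assms(1) finite_subset by blast
  have "\<not> card I < card C"
  proof
    assume "card I < card C"
    then obtain c where "\<exists>k\<in>C. c k \<noteq> 0" "\<And>p. p \<in> I \<Longrightarrow> (\<Sum>k\<in>C. M p k * c k) = 0"
      using underdetermined_system[OF fin assms(2), of M] by blast
    then show False using I2[of c] by blast
  qed
  moreover have "\<not> card C < card I"
  proof
    assume less: "card C < card I"
    \<comment> \<open>By minimality the equations other than \<open>r\<close> have a nonzero
      solution, and it must violate \<open>r\<close> because all of \<open>I\<close> has only the
      trivial one.\<close>
    have "\<exists>c. (\<forall>p\<in>I - {r}. (\<Sum>k\<in>C. M p k * c k) = 0) \<and> (\<Sum>k\<in>C. M r k * c k) \<noteq> 0"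
      if r: "r \<in> I" for r
    proof -
      have "\<not> T (I - {r})" using min[of "I - {r}"] card_Diff1_less[OF fin r] I1 by fastforce
      then obtain c where c: "\<forall>p\<in>I - {r}. (\<Sum>k\<in>C. M p k * c k) = 0" "\<not> (\<forall>k\<in>C. c k = 0)"
        unfolding T_def not_all not_imp by (elim exE conjE)
      have "(\<Sum>k\<in>C. M r k * c k) \<noteq> 0"
      proof
        assume "(\<Sum>k\<in>C. M r k * c k) = 0"
        with c(1) have "\<forall>p\<in>I. (\<Sum>k\<in>C. M p k * c k) = 0" by blast
        then show False using I2 c(2) by blast
      qed
      with c(1) show ?thesis by blast
    qed
    then have "\<forall>r\<in>I. \<exists>c. (\<forall>p\<in>I - {r}. (\<Sum>k\<in>C. M p k * c k) = 0) \<and> (\<Sum>k\<in>C. M r k * c k) \<noteq> 0"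
      by blast
    from bchoice[OF this] obtain w where w: "\<forall>r\<in>I. (\<forall>p\<in>I - {r}. (\<Sum>k\<in>C. M p k * w r k) = 0) \<and>
        (\<Sum>k\<in>C. M r k * w r k) \<noteq> 0" by (elim exE)
    have w1: "(\<Sum>k\<in>C. M p k * w r k) = 0" if "r \<in> I" "p \<in> I - {r}" for r p
      by (rule bspec[OF conjunct1[OF bspec[OF w that(1)]] that(2)])
    have w2: "(\<Sum>k\<in>C. M r k * w r k) \<noteq> 0" if "r \<in> I" for r
      by (rule conjunct2[OF bspec[OF w that]])
    \<comment> \<open>There are more vectors \<open>w r\<close> than coordinates, so they satisfy a
      nontrivial linear relation with coefficients \<open>d\<close>; applying equation
      \<open>r\<close> to it leaves \<open>d r\<close> times a nonzero number.\<close>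
    obtain d where d: "\<exists>r\<in>I. d r \<noteq> 0" "\<And>k. k \<in> C \<Longrightarrow> (\<Sum>r\<in>I. w r k * d r) = 0"
      using underdetermined_system[OF assms(2) fin less, of "\<lambda>k r. w r k"] by blast
    obtain r where r: "r \<in> I" "d r \<noteq> 0" using d by blast
    have "0 = (\<Sum>k\<in>C. M r k * (\<Sum>s\<in>I. w s k * d s))" using d(2) by simp
    also have "\<dots> = (\<Sum>s\<in>I. d s * (\<Sum>k\<in>C. M r k * w s k))"
      by (simp add: sum_distrib_left mult_ac) (rule sum.swap)
    also have "\<dots> = (\<Sum>s\<in>I. if s = r then d r * (\<Sum>k\<in>C. M r k * w r k) else 0)"
      using w1 r(1) by (intro sum.cong) auto
    also have "\<dots> \<noteq> 0" using fin r w2 by simp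
    finally show False by simp
  qed
  ultimately have "card I = card C" by simp
  then show thesis using that[OF I1 _ I2] by simp
qed

lemma bij_betw_pick:
  assumes "finite I"
  shows "bij_betw (pick I) {..<card I} I"
proof -
  have "inj_on (pick I) {..<card I}"
  proof (rule linorder_inj_onI)
    fix x y assume "x < y" "x \<in> {..<card I}" "y \<in> {..<card I}"
    then show "pick I x \<noteq> pick I y" using pick_mono_le[of y I x] by simp
  qed auto
  moreover have "pick I ` {..<card I} \<subseteq> I" using pick_in_set_le by blast
  ultimately show ?thesis
    by (simp add: bij_betw_def card_image card_subset_eq assms)
qed

text \<open>If the kernel is trivial, \<open>square_subsystem\<close> selects rows whose minor is
  nonzero. With fewer than \<open>r\<close> rows no minor exists and the left side is vacuous; the
  right side then holds because the system is underdetermined.\<close>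

lemma maximal_minors_eq_0_iff:
  fixes M :: "nat \<Rightarrow> nat \<Rightarrow> 'a::field"
  shows "(\<forall>I\<subseteq>{..<m}. card I = r \<longrightarrow>
      Determinant.det (Matrix.mat r r (\<lambda>(p, k). M (pick I p) k)) = 0) \<longleftrightarrow>
    (\<exists>c. (\<exists>k<r. c k \<noteq> 0) \<and> (\<forall>j<m. (\<Sum>k<r. M j k * c k) = 0))" (is "?L \<longleftrightarrow> ?R")
proof
  assume L: ?L
  show ?R
  proof (rule ccontr, rule square_subsystem[of "{..<m}" "{..<r}" M])
    assume "\<not> ?R"
    then show "\<forall>k\<in>{..<r}. c k = 0" if "\<forall>p\<in>{..<m}. (\<Sum>k<r. M p k * c k) = 0" for c
      using that by auto
  next
    fix I assume I: "I \<subseteq> {..<m}" "card I = card {..<r}"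
      "\<And>c. (\<forall>p\<in>I. (\<Sum>k<r. M p k * c k) = 0) \<Longrightarrow> \<forall>k\<in>{..<r}. c k = 0"
    have "Determinant.det (Matrix.mat r r (\<lambda>(p, k). M (pick I p) k)) = 0"
      using L I(1,2) by simp
    then obtain c where c: "\<exists>k<r. c k \<noteq> 0" "\<forall>p<r. (\<Sum>k<r. M (pick I p) k * c k) = 0"
      unfolding det_eq_0_iff_kernel[of r "\<lambda>p. M (pick I p)"] by blast
    have img: "pick I ` {..<r} = I"
      using bij_betw_pick[of I] I(2) finite_subset[OF I(1)] by (simp add: bij_betw_def)
    have "\<forall>p\<in>I. (\<Sum>k<r. M p k * c k) = 0"
    proof
      fix p assume "p \<in> I"
      then obtain q where "q < r" "p = pick I q" using img by (metis imageE lessThan_iff)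
      then show "(\<Sum>k<r. M p k * c k) = 0" using c(2) by simp
    qed
    from I(3)[OF this] c(1) show False by auto
  qed simp_all
next
  assume ?R
  then obtain c where c: "\<exists>k<r. c k \<noteq> 0" "\<forall>j<m. (\<Sum>k<r. M j k * c k) = 0" by blast
  show ?L
  proof (intro allI impI)
    fix I assume I: "I \<subseteq> {..<m}" "card I = r"
    have "pick I p < m" if "p < r" for p
      using pick_in_set_le[of p I] that I by auto
    then show "Determinant.det (Matrix.mat r r (\<lambda>(p, k). M (pick I p) k)) = 0"
      using c unfolding det_eq_0_iff_kernel[of r "\<lambda>p. M (pick I p)"] by blast
  qed
qed

text \<open>Laplace expansion along column \<open>k\<close>: the cofactors do not see that
  column.\<close>

lemma det_replace_col_smult:
  fixes A :: "'a::comm_ring_1 mat"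
  assumes A: "A \<in> carrier_mat n n" and v: "v \<in> carrier_vec n" and k: "k < n"
  shows "Determinant.det (replace_col A (c \<cdot>\<^sub>v v) k) = c * Determinant.det (replace_col A v k)"
proof -
  have C: "replace_col A u k \<in> carrier_mat n n" for u
    using A by (simp add: replace_col_def)
  have del: "mat_delete (replace_col A (c \<cdot>\<^sub>v v) k) p k = mat_delete (replace_col A v k) p k" for p
    using A k by (intro eq_matI) (auto simp: replace_col_def mat_delete_def)
  show ?thesis
    unfolding laplace_expansion_column[OF C k] sum_distrib_left cofactor_def del
    using A v k by (intro sum.cong) (auto simp: replace_col_def)
qed

text \<open>Only \<open>b - 1\<close> columns remain, so a maximal minor must take all of them and
  is determined by its rows. The nested submatrices are undone to reach entries of the original
  matrix.\<close>

lemma minors_remove_col: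
  assumes i: "i < b"
  shows "minors (b - 1) (remove_col i (Matrix.mat m b f)) =
    {Determinant.det (Matrix.mat (b - 1) (b - 1) (\<lambda>(p, k). f (pick I p, pick ({..<b} - {i}) k))) | I.
      I \<subseteq> {..<m} \<and> card I = b - 1}"
proof -
  let ?A = "Matrix.mat m b f" and ?r = "b - 1"
  have C: "{j. j < b \<and> j \<in> - {i}} = {..<b} - {i}" by auto
  have cC: "card {j. j < b \<and> j \<in> - {i}} = ?r" using i unfolding C by simp
  have dims: "dim_row (remove_col i ?A) = m" "dim_col (remove_col i ?A) = ?r"
    using cC unfolding remove_col_def dim_submatrix by simp_all
  \<comment> \<open>\<open>remove_col\<close> selects from an infinite complement; below
    \<open>b - 1\<close> this enumeration agrees with that of the finite set of remaining
    columns.\<close>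
  have pick_C: "pick (- {i}) k = pick ({..<b} - {i}) k" if "k < ?r" for k
    using pick_reduce_set[of k b "- {i}"] that i unfolding C by simp
  have pick_J: "pick {..<?r} k = k" if "k < ?r" for k
    using pick_reduce_set[of k ?r UNIV] that by (simp add: pick_UNIV lessThan_def)
  have sub: "submatrix (remove_col i ?A) I {..<?r} =
      Matrix.mat ?r ?r (\<lambda>(p, k). f (pick I p, pick ({..<b} - {i}) k))"
    if I: "I \<subseteq> {..<m}" "card I = ?r" for I
  proof -
    have cI: "{p. p < m \<and> p \<in> I} = I" using I by auto
    have cJ: "{j. j < ?r \<and> j \<in> {..<?r}} = {..<?r}" by auto
    have pI: "pick I p < m" if "p < ?r" for p using pick_in_set_le[of p I] that I by auto
    have "remove_col i ?A $$ (pick I p, pick {..<?r} k) = f (pick I p, pick ({..<b} - {i}) k)"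
      if "p < ?r" "k < ?r" for p k
    proof -
      have "remove_col i ?A $$ (pick I p, pick {..<?r} k) = ?A $$ (pick I p, pick ({..<b} - {i}) k)"
        unfolding remove_col_def pick_J[OF that(2)]
        using submatrix_index[of "pick I p" ?A UNIV k "- {i}"] pI[OF that(1)] that(2) cC
        by (simp add: pick_UNIV pick_C)
      moreover have "pick ({..<b} - {i}) k < b"
        using pick_in_set_le[of k "{..<b} - {i}"] that i by simp
      ultimately show ?thesis using pI[OF that(1)] by simp
    qed
    then show ?thesis
      unfolding submatrix_def[of "remove_col i ?A"] dims cI cJ card_lessThan I(2)
      by (intro eq_matI) simp_all
  qed
  have J: "J = {..<?r}" if "J \<subseteq> {..<?r}" "card J = ?r" for J
    using that card_subset_eq[of "{..<?r}" J] by simp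
  show ?thesis
  proof (intro subset_antisym subsetI)
    fix x assume "x \<in> minors ?r (remove_col i ?A)"
    then obtain I J' where "x = Determinant.det (submatrix (remove_col i ?A) I J')"
      "I \<subseteq> {..<m}" "J' \<subseteq> {..<?r}" "card I = ?r" "card J' = ?r"
      unfolding minors_def dims by blast
    then show "x \<in> {Determinant.det (Matrix.mat ?r ?r (\<lambda>(p, k). f (pick I p, pick ({..<b} - {i}) k))) | I.
        I \<subseteq> {..<m} \<and> card I = ?r}"
      using J[of J'] sub[of I] by auto
  next
    fix x assume "x \<in> {Determinant.det (Matrix.mat ?r ?r (\<lambda>(p, k). f (pick I p, pick ({..<b} - {i}) k))) | I.
        I \<subseteq> {..<m} \<and> card I = ?r}"
    then obtain I where "x = Determinant.det (submatrix (remove_col i ?A) I {..<?r})"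
      "I \<subseteq> {..<m}" "card I = ?r"
      using sub by auto
    then show "x \<in> minors ?r (remove_col i ?A)"
      unfolding minors_def dims mem_Collect_eq
      by (intro exI[of _ I] exI[of _ "{..<?r}"]) simp
  qed
qed

section \<open>Matrices of linear forms annihilated by the variables\<close>

lemma (in comm_ring_hom) hom_det_mat:
  "hom (Determinant.det (Matrix.mat n n (\<lambda>(p, k). f p k))) =
    Determinant.det (Matrix.mat n n (\<lambda>(p, k). hom (f p k)))"
proof -
  have "map_mat hom (Matrix.mat n n (\<lambda>(p, k). f p k)) = Matrix.mat n n (\<lambda>(p, k). hom (f p k))"
    by (intro eq_matI) auto
  then show ?thesis by (metis hom_det)
qed

text \<open>Retains of \<open>phi1\<close> what the argument about minors uses: the variables,
  linearity, and the relation between the columns, which reflects that classes of degree one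
  anticommute. Linearity is recorded on values because it is applied under evaluation.\<close>

locale koszul_matrix =
  fixes A :: "nat \<Rightarrow> nat \<Rightarrow> nat cpoly" and m b :: nat
  assumes entries: "\<And>j l. j < m \<Longrightarrow> l < b \<Longrightarrow> A j l \<in> poly_ring_in {..<b}"
    and homogeneous: "\<And>j l a t. j < m \<Longrightarrow> l < b \<Longrightarrow>
      poly_eval (\<lambda>k. t * a k) (A j l) = t * poly_eval a (A j l)"
    and relation: "\<And>j. j < m \<Longrightarrow> (\<Sum>l<b. poly_var l * A j l) = 0"
begin

text \<open>The columns are given by an arbitrary map \<open>s\<close>, so one column can be
  replaced in place by another. No reordering occurs, and the sign in the exchange identity is
  always -1.\<close>

definition cols_minor :: "nat set \<Rightarrow> (nat \<Rightarrow> nat) \<Rightarrow> nat cpoly" where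
  "cols_minor I s = Determinant.det (Matrix.mat (b - 1) (b - 1) (\<lambda>(p, k). A (pick I p) (s k)))"

abbreviation others :: "nat \<Rightarrow> nat \<Rightarrow> nat" where
  "others i \<equiv> pick ({..<b} - {i})"

lemma bij_betw_others: "i < b \<Longrightarrow> bij_betw (others i) {..<b - 1} ({..<b} - {i})"
  using bij_betw_pick[of "{..<b} - {i}"] by simp

lemma others_mem: "i < b \<Longrightarrow> k < b - 1 \<Longrightarrow> others i k < b \<and> others i k \<noteq> i"
  using bij_betwE[OF bij_betw_others, of i] by simp

lemma pick_row: "I \<subseteq> {..<m} \<Longrightarrow> card I = b - 1 \<Longrightarrow> p < b - 1 \<Longrightarrow> pick I p < m"
  using pick_in_set_le[of p I] by auto

text \<open>Cramer's rule for the relation between the columns.\<close>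

lemma cols_minor_exchange:
  assumes i: "i < b" and I: "I \<subseteq> {..<m}" "card I = b - 1" and k: "k < b - 1"
  shows "poly_var (others i k) * cols_minor I (others i) =
    - poly_var i * cols_minor I ((others i)(k := i))"
proof -
  let ?r = "b - 1"
  define N where "N = Matrix.mat ?r ?r (\<lambda>(p, k). A (pick I p) (others i k))"
  define x where "x = Matrix.vec ?r (\<lambda>k. poly_var (others i k) :: nat cpoly)"
  define v where "v = Matrix.vec ?r (\<lambda>p. A (pick I p) i)"
  have N: "N \<in> carrier_mat ?r ?r" by (simp add: N_def)
  \<comment> \<open>The relation with its \<open>i\<close>-th term on the other side is a square
    linear system satisfied by the remaining variables.\<close>
  have "N *\<^sub>v x = (- poly_var i) \<cdot>\<^sub>v v"
  proof (rule eq_vecI)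
    fix p assume "p < dim_vec ((- poly_var i) \<cdot>\<^sub>v v)"
    then have p: "p < ?r" by (simp add: v_def)
    have "vec_index (N *\<^sub>v x) p = (\<Sum>k<?r. A (pick I p) (others i k) * poly_var (others i k))"
      using p by (simp add: N_def x_def scalar_prod_def lessThan_atLeast0)
    also have "\<dots> = (\<Sum>l\<in>{..<b} - {i}. A (pick I p) l * poly_var l)"
      by (rule sum.reindex_bij_betw[OF bij_betw_others[OF i]])
    also have "\<dots> = - poly_var i * A (pick I p) i"
      using relation[OF pick_row[OF I p]] i
      by (simp add: sum.remove[of "{..<b}" i] mult.commute eq_neg_iff_add_eq_0 add.commute)
    finally show "vec_index (N *\<^sub>v x) p = vec_index ((- poly_var i) \<cdot>\<^sub>v v) p"
      using p by (simp add: v_def)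
  qed (simp add: N_def v_def)
  then have "poly_var (others i k) * Determinant.det N =
      Determinant.det (replace_col N ((- poly_var i) \<cdot>\<^sub>v v) k)"
    using cramer_lemma_mat[OF N _ k, of x] k by (simp add: x_def)
  also have "\<dots> = - poly_var i * Determinant.det (replace_col N v k)"
    by (rule det_replace_col_smult[OF N _ k]) (simp add: v_def)
  also have "replace_col N v k = Matrix.mat ?r ?r (\<lambda>(p, l). A (pick I p) (((others i)(k := i)) l))"
    by (intro eq_matI) (simp_all add: replace_col_def N_def v_def)
  finally show ?thesis by (simp only: N_def cols_minor_def)
qed

lemma cols_minor_in_ring:
  assumes "i < b" "I \<subseteq> {..<m}" "card I = b - 1"
  shows "cols_minor I (others i) \<in> poly_ring_in {..<b}"
  unfolding cols_minor_def
proof (rule poly_ring_in_det)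
  fix p q assume "p < b - 1" "q < b - 1"
  then show "Matrix.mat (b - 1) (b - 1) (\<lambda>(p, k). A (pick I p) (others i k)) $$ (p, q) \<in> poly_ring_in {..<b}"
    using pick_row[OF assms(2,3)] others_mem[OF assms(1)] by (simp add: entries)
qed simp

lemma poly_var_dvd_cols_minor:
  assumes b: "2 \<le> b" and i: "i < b" and I: "I \<subseteq> {..<m}" "card I = b - 1"
  obtains q where "q \<in> poly_ring_in {..<b}" "cols_minor I (others i) = poly_var i * q"
proof -
  \<comment> \<open>A second column is required: for \<open>b = 1\<close> the empty minor is 1,
    which is not divisible by \<open>poly_var i\<close>.\<close>
  obtain k where k: "k < b - 1" using b by (intro that[of 0]) simp
  have "i \<noteq> others i k" using others_mem[OF i k] by simp
  moreover have "poly_var (others i k) * cols_minor I (others i) =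
      poly_var i * (- cols_minor I ((others i)(k := i)))"
    using cols_minor_exchange[OF i I k] by simp
  ultimately have "poly_var i dvd cols_minor I (others i)"
    by (rule poly_var_dvd_cofactor)
  then obtain q where q: "cols_minor I (others i) = poly_var i * q" by (rule dvdE)
  moreover have "q \<in> poly_ring_in {..<b}"
    using poly_ring_in_var_cofactor[of i q "{..<b}"] cols_minor_in_ring[OF i I] unfolding q .
  ultimately show thesis using that by blast
qed

text \<open>Cancelling \<open>poly_var i\<close> in the exchange identity shows that the quotient
  found by omitting column \<open>i\<close> is, up to sign, also the quotient for every other
  omitted column.\<close>

lemma cofactor_exchange:
  assumes i: "i < b" and I: "I \<subseteq> {..<m}" "card I = b - 1" and k: "k < b - 1"
    and q: "cols_minor I (others i) = poly_var i * q"
  shows "poly_var (others i k) * q = - cols_minor I ((others i)(k := i))"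
proof -
  have "poly_var i * (poly_var (others i k) * q) = poly_var i * (- cols_minor I ((others i)(k := i)))"
    using cols_minor_exchange[OF i I k] unfolding q by (simp add: mult_ac)
  then show ?thesis using poly_var_neq_0[of i] by (simp add: mult_cancel_left del: mult_minus_right)
qed

lemma poly_eval_cols_minor:
  "poly_eval a (cols_minor I s) =
    Determinant.det (Matrix.mat (b - 1) (b - 1) (\<lambda>(p, k). poly_eval a (A (pick I p) (s k))))"
proof -
  interpret comm_ring_hom "poly_eval a" by (rule comm_ring_hom_poly_eval)
  show ?thesis unfolding cols_minor_def by (rule hom_det_mat)
qed

text \<open>The relation puts the point \<open>a\<close> itself into the kernel. Since
  \<open>a j\<close> is nonzero, subtracting a multiple of \<open>a\<close> makes the
  \<open>j\<close>-th entry of any kernel vector zero, so the kernel without column \<open>j\<close>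
  is the full kernel modulo the line of \<open>a\<close>.\<close>

lemma kernel_all_columns:
  assumes a: "a j \<noteq> 0" and j: "j < b" and s: "bij_betw s {..<b - 1} ({..<b} - {j})"
  shows "(\<exists>c. (\<exists>k<b - 1. c k \<noteq> 0) \<and> (\<forall>p<m. (\<Sum>k<b - 1. poly_eval a (A p (s k)) * c k) = 0)) \<longleftrightarrow>
    (\<exists>w. (\<forall>p<m. (\<Sum>l<b. poly_eval a (A p l) * w l) = 0) \<and> \<not> (\<exists>t. \<forall>l<b. w l = t * a l))"
    (is "?L \<longleftrightarrow> ?R")
proof -
  interpret ev: comm_ring_hom "poly_eval a" by (rule comm_ring_hom_poly_eval)
  have drop: "(\<Sum>l<b. poly_eval a (A p l) * w l) = (\<Sum>k<b - 1. poly_eval a (A p (s k)) * w (s k))"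
    if "w j = 0" for w p
    unfolding sum.reindex_bij_betw[OF s, of "\<lambda>l. poly_eval a (A p l) * w l"]
    using that j by (simp add: sum.remove[of "{..<b}" j])
  have self: "(\<Sum>l<b. poly_eval a (A p l) * a l) = 0" if "p < m" for p
    using arg_cong[OF relation[OF that], of "poly_eval a"]
    by (simp add: ev.hom_sum ev.hom_mult poly_eval_var poly_eval_0 mult.commute)
  show ?thesis
  proof
    assume ?L
    then obtain c k where c: "k < b - 1" "c k \<noteq> 0"
      "\<forall>p<m. (\<Sum>k<b - 1. poly_eval a (A p (s k)) * c k) = 0" by blast
    define w where "w l = (if l = j then 0 else c (the_inv_into {..<b - 1} s l))" for l
    have ws: "w (s k) = c k" if "k < b - 1" for k
      using that s bij_betwE[OF s] by (auto simp: w_def bij_betw_def the_inv_into_f_f)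
    have wj: "w j = 0" by (simp add: w_def)
    show ?R
    proof (intro exI conjI notI)
      show "\<forall>p<m. (\<Sum>l<b. poly_eval a (A p l) * w l) = 0"
        unfolding drop[of w, OF wj] using c(3) ws by simp
      assume "\<exists>t. \<forall>l<b. w l = t * a l"
      then obtain t where t: "\<forall>l<b. w l = t * a l" by blast
      then have "t * a j = 0" using wj j by simp
      then have "t = 0" using a by simp
      moreover have "s k < b" using bij_betwE[OF s] c(1) by blast
      ultimately show False using t ws[OF c(1)] c(2) by simp
    qed
  next
    assume ?R
    then obtain w where w: "\<And>p. p < m \<Longrightarrow> (\<Sum>l<b. poly_eval a (A p l) * w l) = 0"
      and nt: "\<not> (\<exists>t. \<forall>l<b. w l = t * a l)" by blast
    define u where "u l = w l - w j / a j * a l" for l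
    have uj: "u j = 0" using a by (simp add: u_def)
    have "(\<Sum>k<b - 1. poly_eval a (A p (s k)) * u (s k)) = 0" if p: "p < m" for p
    proof -
      have "(\<Sum>l<b. poly_eval a (A p l) * u l) =
          (\<Sum>l<b. poly_eval a (A p l) * w l) - w j / a j * (\<Sum>l<b. poly_eval a (A p l) * a l)"
        by (simp add: u_def right_diff_distrib sum_subtractf sum_distrib_left mult_ac)
      then show ?thesis using w[OF p] self[OF p] drop[of u p, OF uj] by simp
    qed
    moreover have "\<exists>k<b - 1. u (s k) \<noteq> 0"
    proof (rule ccontr)
      assume "\<not> (\<exists>k<b - 1. u (s k) \<noteq> 0)"
      then have us: "u (s k) = 0" if "k < b - 1" for k using that by simp
      have "u l = 0" if "l < b" for l
      proof (cases "l = j")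
        case False
        then have "l \<in> s ` {..<b - 1}" using that bij_betw_imp_surj_on[OF s] by simp
        then show ?thesis using us by (elim imageE) simp
      qed (simp add: uj)
      then have "\<forall>l<b. w l = w j / a j * a l" by (simp add: u_def)
      then show False using nt by blast
    qed
    ultimately show ?L by (intro exI[of _ "\<lambda>k. u (s k)"]) simp
  qed
qed

text \<open>The coordinate \<open>a i\<close> may vanish, so the test is moved to column
  \<open>j\<close>: by the exchange identity, the value of the minor omitting \<open>j\<close> is
  that of \<open>q\<close> times a nonzero number.\<close>

lemma cofactors_vanish_iff:
  assumes b: "2 \<le> b" and i: "i < b" and j: "j < b" and a: "a j \<noteq> 0"
    and q: "\<And>I. I \<subseteq> {..<m} \<Longrightarrow> card I = b - 1 \<Longrightarrow> cols_minor I (others i) = poly_var i * q I"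
  shows "(\<forall>I\<subseteq>{..<m}. card I = b - 1 \<longrightarrow> poly_eval a (q I) = 0) \<longleftrightarrow>
    (\<exists>w. (\<forall>p<m. (\<Sum>l<b. poly_eval a (A p l) * w l) = 0) \<and> \<not> (\<exists>t. \<forall>l<b. w l = t * a l))"
proof -
  interpret ev: comm_ring_hom "poly_eval a" by (rule comm_ring_hom_poly_eval)
  obtain s where s: "bij_betw s {..<b - 1} ({..<b} - {j})"
    and minor: "\<And>I. I \<subseteq> {..<m} \<Longrightarrow> card I = b - 1 \<Longrightarrow>
      poly_eval a (q I) = 0 \<longleftrightarrow> poly_eval a (cols_minor I s) = 0"
  proof (cases "j = i")
    case True
    show thesis
      by (rule that[of "others i"])
        (use True bij_betw_others[OF i] a in \<open>simp_all add: q ev.hom_mult poly_eval_var\<close>)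
  next
    case False
    let ?o = "others i"
    obtain k where k: "k < b - 1" "?o k = j"
      using bij_betw_imp_surj_on[OF bij_betw_others[OF i]] j False by (metis DiffI imageE lessThan_iff singletonD)
    show thesis
    proof (rule that[of "?o(k := i)"])
      have inj: "inj_on ?o {..<b - 1}" and img: "?o ` {..<b - 1} = {..<b} - {i}"
        using bij_betw_others[OF i] by (auto simp: bij_betw_def)
      have "inj_on (?o(k := i)) {..<b - 1}"
        using inj img by (intro inj_on_fun_updI) auto
      moreover have "?o(k := i) ` {..<b - 1} = {..<b} - {j}"
      proof -
        have "?o ` ({..<b - 1} - {k}) = {..<b} - {i} - {j}"
          using inj_on_image_set_diff[OF inj, of "{..<b - 1}" "{k}"] k img by auto
        then have "(?o(k := i)) ` {..<b - 1} = insert i ({..<b} - {i} - {j})"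
          using k(1) unfolding fun_upd_image by simp
        then show ?thesis using i False by auto
      qed
      ultimately show "bij_betw (?o(k := i)) {..<b - 1} ({..<b} - {j})"
        by (simp add: bij_betw_def)
      fix I assume I: "I \<subseteq> {..<m}" "card I = b - 1"
      have "a j * poly_eval a (q I) = - poly_eval a (cols_minor I (?o(k := i)))"
        using arg_cong[OF cofactor_exchange[OF i I k(1) q[OF I]], of "poly_eval a"] k(2)
        by (simp add: ev.hom_mult ev.hom_uminus poly_eval_var)
      then show "poly_eval a (q I) = 0 \<longleftrightarrow> poly_eval a (cols_minor I (?o(k := i))) = 0"
        using a by (metis mult_eq_0_iff neg_equal_0_iff_equal)
    qed
  qed
  have "(\<forall>I\<subseteq>{..<m}. card I = b - 1 \<longrightarrow> poly_eval a (q I) = 0) \<longleftrightarrow>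
      (\<forall>I\<subseteq>{..<m}. card I = b - 1 \<longrightarrow> poly_eval a (cols_minor I s) = 0)"
    using minor by blast
  also have "\<dots> \<longleftrightarrow> (\<exists>c. (\<exists>k<b - 1. c k \<noteq> 0) \<and>
      (\<forall>p<m. (\<Sum>k<b - 1. poly_eval a (A p (s k)) * c k) = 0))"
    unfolding poly_eval_cols_minor 
    by (rule maximal_minors_eq_0_iff[of m "b - 1" "\<lambda>p k. poly_eval a (A p (s k))"])
  also have "\<dots> \<longleftrightarrow> (\<exists>w. (\<forall>p<m. (\<Sum>l<b. poly_eval a (A p l) * w l) = 0) \<and>
      \<not> (\<exists>t. \<forall>l<b. w l = t * a l))"
    using a j s by (rule kernel_all_columns)
  finally show ?thesis .
qed

text \<open>The cofactor is homogeneous of degree \<open>b - 2\<close>, so it vanishes at the origin once \<open>b \<ge> 3\<close>.\<close>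

lemma cofactor_origin:
  assumes b: "3 \<le> b" and i: "i < b" and I: "I \<subseteq> {..<m}" "card I = b - 1"
    and q: "cols_minor I (others i) = poly_var i * q"
  shows "poly_eval (\<lambda>_. 0) q = 0"
proof -
  \<comment> \<open>On the ray through the \<open>i\<close>-th unit vector \<open>poly_var i\<close>
    takes the value \<open>t\<close>, so for nonzero \<open>t\<close> the value of \<open>q\<close>
    is found by division. The value at 0 then follows by continuity.\<close>
  define e :: "nat \<Rightarrow> complex" where "e k = (if k = i then 1 else 0)" for k
  define g where "g t = poly_eval (\<lambda>k. t * e k) q" for t
  define d where "d = poly_eval e (cols_minor I (others i))"
  have scaled: "poly_eval (\<lambda>k. t * e k) (cols_minor I (others i)) = t ^ (b - 1) * d" for t
  proof -
    have "Matrix.mat (b - 1) (b - 1) (\<lambda>(p, k). poly_eval (\<lambda>k. t * e k) (A (pick I p) (others i k))) =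
        t \<cdot>\<^sub>m Matrix.mat (b - 1) (b - 1) (\<lambda>(p, k). poly_eval e (A (pick I p) (others i k)))"
      using pick_row[OF I] others_mem[OF i]
      by (intro eq_matI) (auto simp: homogeneous)
    then show ?thesis unfolding d_def poly_eval_cols_minor by simp
  qed
  have "g t = t ^ (b - 2) * d" if "t \<noteq> 0" for t
  proof -
    have "t * g t = poly_eval (\<lambda>k. t * e k) (poly_var i * q)"
      by (simp add: poly_eval_mult poly_eval_var g_def e_def)
    also have "\<dots> = t ^ Suc (b - 2) * d"
      using scaled[of t] b unfolding q by (simp add: Suc_diff_Suc numeral_2_eq_2)
    finally have "t * g t = t * (t ^ (b - 2) * d)" by simp
    then show ?thesis using that by simp
  qed
  then have "\<forall>\<^sub>F t in at 0. t ^ (b - 2) * d = g t"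
    by (auto simp: eventually_at_filter)
  moreover have "((\<lambda>t. t ^ (b - 2) * d) \<longlongrightarrow> 0 ^ (b - 2) * d) (at 0)"
    by (intro tendsto_intros)
  \<comment> \<open>\<open>b \<ge> 3\<close> makes the exponent \<open>b - 2\<close> positive, so
    the limit is 0.\<close>
  ultimately have lim0: "(g \<longlongrightarrow> 0) (at 0)"
    using b by (simp add: power_0_left Lim_transform_eventually)
  have lim: "(g \<longlongrightarrow> g 0) (at 0)"
  proof -
    have "continuous_on UNIV g"
      unfolding g_def by (intro continuous_poly_eval continuous_intros)
    then show ?thesis by (simp add: continuous_on_def)
  qed
  have "g 0 = 0" by (rule LIM_unique[OF lim lim0])
  then show ?thesis by (simp add: g_def)
qed

end

section \<open>Coordinates in a vector space\<close>

locale based_space = vectorspace "class_ring :: complex ring" V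
  for V :: "(complex, 'b) module" and es :: "'b list" +
  assumes ordered_basis: "ordered_basis V es"
begin

definition comb :: "(nat \<Rightarrow> complex) \<Rightarrow> 'b" where
  "comb c = (\<Oplus>\<^bsub>V\<^esub>k\<in>{..<length es}. c k \<odot>\<^bsub>V\<^esub> es ! k)"

lemma nth_closed: "k < length es \<Longrightarrow> es ! k \<in> carrier V"
  using ordered_basis nth_mem[of k es] unfolding ordered_basis_def basis_def by blast

lemma smult_nth_closed: "(\<lambda>k. c k \<odot>\<^bsub>V\<^esub> es ! k) \<in> {..<length es} \<rightarrow> carrier V"
  by (auto intro: nth_closed)

lemma comb_closed: "comb c \<in> carrier V"
  unfolding comb_def by (rule M.finsum_closed[OF smult_nth_closed])

lemma dim_eq_length: "dim = length es"
  using dim_basis[of "set es"] ordered_basis by (simp add: ordered_basis_def distinct_card)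

lemma linear_finsum:
  fixes F :: "'b \<Rightarrow> complex"
  assumes add: "\<And>x y. x \<in> carrier V \<Longrightarrow> y \<in> carrier V \<Longrightarrow> F (x \<oplus>\<^bsub>V\<^esub> y) = F x + F y"
    and smult: "\<And>c x. x \<in> carrier V \<Longrightarrow> F (c \<odot>\<^bsub>V\<^esub> x) = c * F x"
    and "finite K" "\<And>k. k \<in> K \<Longrightarrow> x k \<in> carrier V"
  shows "F (\<Oplus>\<^bsub>V\<^esub>k\<in>K. c k \<odot>\<^bsub>V\<^esub> x k) = (\<Sum>k\<in>K. c k * F (x k))"
  using assms(3,4)
proof (induction K rule: finite_induct)
  case empty
  show ?case using smult[of "\<zero>\<^bsub>V\<^esub>" 0] by simp
next
  case (insert k K)
  have "(\<lambda>k. c k \<odot>\<^bsub>V\<^esub> x k) \<in> K \<rightarrow> carrier V" using insert.prems by auto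
  moreover have "c k \<odot>\<^bsub>V\<^esub> x k \<in> carrier V" using insert.prems by auto
  ultimately show ?case
    using insert M.finsum_closed by (simp add: add smult)
qed

lemma linear_comb:
  fixes F :: "'b \<Rightarrow> complex"
  assumes "\<And>x y. x \<in> carrier V \<Longrightarrow> y \<in> carrier V \<Longrightarrow> F (x \<oplus>\<^bsub>V\<^esub> y) = F x + F y"
    and "\<And>c x. x \<in> carrier V \<Longrightarrow> F (c \<odot>\<^bsub>V\<^esub> x) = c * F x"
  shows "F (comb c) = (\<Sum>k<length es. c k * F (es ! k))"
  unfolding comb_def by (rule linear_finsum[OF assms]) (auto intro: nth_closed)

lemma lincomb_eq_comb: "lincomb a (set es) = comb (\<lambda>k. a (es ! k))"
proof -
  have inj: "inj_on ((!) es) {..<length es}"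
    using ordered_basis by (simp add: ordered_basis_def inj_on_nth)
  have img: "set es = (!) es ` {..<length es}" by (auto simp: set_conv_nth)
  show ?thesis
    unfolding lincomb_def comb_def img
    by (rule M.finsum_reindex[OF _ inj]) (auto intro: nth_closed)
qed

lemma comb_cong: "(\<And>k. k < length es \<Longrightarrow> c k = d k) \<Longrightarrow> comb c = comb d"
  unfolding comb_def by (intro M.finsum_cong') (auto intro: nth_closed)

text \<open>This justifies the definite description in \<open>coordinates\<close>. The basis
  criterion concerns functions restricted to the set of basis vectors; distinctness of the list
  moves it to indices, and the value zero beyond the list makes the function unique.\<close>

lemma comb_ex1:
  assumes "v \<in> carrier V"
  shows "\<exists>!c. (\<forall>k\<ge>length es. c k = 0) \<and> v = comb c"
proof -
  let ?S = "set es \<rightarrow>\<^sub>E (UNIV :: complex set)"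
  have ex1: "\<exists>!a. a \<in> ?S \<and> lincomb a (set es) = v"
    using basis_criterion[of "set es"] ordered_basis assms
    by (simp add: ordered_basis_def basis_def)
  show ?thesis
  proof (rule ex_ex1I)
    obtain a where "lincomb a (set es) = v" using ex1 by blast
    then have "v = comb (\<lambda>k. if k < length es then a (es ! k) else 0)"
      unfolding lincomb_eq_comb by (auto intro: comb_cong)
    then show "\<exists>c. (\<forall>k\<ge>length es. c k = 0) \<and> v = comb c"
      by (intro exI conjI) auto
  next
    fix c d
    assume c: "(\<forall>k\<ge>length es. c k = 0) \<and> v = comb c"
      and d: "(\<forall>k\<ge>length es. d k = 0) \<and> v = comb d"
    have inj: "inj_on ((!) es) {..<length es}"
      using ordered_basis by (simp add: ordered_basis_def inj_on_nth)
    define f where "f c = restrict (\<lambda>e. c (the_inv_into {..<length es} ((!) es) e)) (set es)"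
      for c :: "nat \<Rightarrow> complex"
    have f: "f c (es ! k) = c k" if "k < length es" for c k
      using that the_inv_into_f_f[OF inj] by (simp add: f_def)
    have "f c \<in> ?S" for c by (simp add: f_def)
    moreover have "lincomb (f c) (set es) = comb c" for c
      unfolding lincomb_eq_comb by (rule comb_cong) (rule f)
    ultimately have "f c = f d" using ex1 c d by metis
    then have "c k = d k" if "k < length es" for k using f[OF that] by metis
    then show "c = d" using c d by (intro ext) (metis not_le)
  qed
qed

abbreviation coords :: "'b \<Rightarrow> nat \<Rightarrow> complex" where
  "coords \<equiv> coordinates V es"

lemma coords_props:
  assumes "v \<in> carrier V"
  shows "\<And>k. length es \<le> k \<Longrightarrow> coords v k = 0" and "comb (coords v) = v"
  using theI'[OF comb_ex1[OF assms]] unfolding coordinates_def comb_def by auto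

lemma coords_eqI:
  assumes "\<And>k. length es \<le> k \<Longrightarrow> c k = 0" "v = comb c"
  shows "coords v = c"
  using the1_equality[OF comb_ex1[OF comb_closed[of c]], of c] assms
  unfolding coordinates_def comb_def by auto

lemma comb_add: "comb c \<oplus>\<^bsub>V\<^esub> comb d = comb (\<lambda>k. c k + d k)"
proof -
  have "comb (\<lambda>k. c k + d k) = (\<Oplus>\<^bsub>V\<^esub>k\<in>{..<length es}. c k \<odot>\<^bsub>V\<^esub> es ! k \<oplus>\<^bsub>V\<^esub> d k \<odot>\<^bsub>V\<^esub> es ! k)"
    unfolding comb_def
    by (intro M.finsum_cong') (use nth_closed smult_l_distr in auto)
  also have "\<dots> = comb c \<oplus>\<^bsub>V\<^esub> comb d"
    unfolding comb_def by (rule M.finsum_addf[OF smult_nth_closed smult_nth_closed])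
  finally show ?thesis by (rule sym)
qed

lemma comb_smult: "t \<odot>\<^bsub>V\<^esub> comb c = comb (\<lambda>k. t * c k)"
proof -
  have "t \<odot>\<^bsub>V\<^esub> comb c = (\<Oplus>\<^bsub>V\<^esub>k\<in>{..<length es}. t \<odot>\<^bsub>V\<^esub> (c k \<odot>\<^bsub>V\<^esub> es ! k))"
    unfolding comb_def by (rule finsum_smult[OF _ smult_nth_closed]) simp
  also have "\<dots> = comb (\<lambda>k. t * c k)"
    unfolding comb_def by (intro M.finsum_cong') (use nth_closed smult_assoc1 in auto)
  finally show ?thesis .
qed

lemma coords_add:
  assumes "v \<in> carrier V" "w \<in> carrier V"
  shows "coords (v \<oplus>\<^bsub>V\<^esub> w) k = coords v k + coords w k"
proof -
  have "coords (v \<oplus>\<^bsub>V\<^esub> w) = (\<lambda>k. coords v k + coords w k)"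
    using assms by (intro coords_eqI) (simp_all add: coords_props comb_add[symmetric])
  then show ?thesis by simp
qed

lemma coords_smult:
  assumes "v \<in> carrier V"
  shows "coords (t \<odot>\<^bsub>V\<^esub> v) k = t * coords v k"
proof -
  have "coords (t \<odot>\<^bsub>V\<^esub> v) = (\<lambda>k. t * coords v k)"
    using assms by (intro coords_eqI) (simp_all add: coords_props comb_smult[symmetric])
  then show ?thesis by simp
qed

lemma coords_eq_iff:
  assumes "v \<in> carrier V" "w \<in> carrier V"
  shows "v = w \<longleftrightarrow> (\<forall>k<length es. coords v k = coords w k)"
  using comb_cong[of "coords v" "coords w"] coords_props(2)[OF assms(1)] coords_props(2)[OF assms(2)] by auto

lemma coords_zero: "coords \<zero>\<^bsub>V\<^esub> k = 0"
  using coords_smult[of "\<zero>\<^bsub>V\<^esub>" 0 k] by simp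

end

section \<open>Cohomology classes and cup products of degree one\<close>

definition cocycles :: "nat \<Rightarrow> 'x topology \<Rightarrow> 'x cochain set" where
  "cocycles p X = {f \<in> carrier (cochain_module p X). coboundary (p + 1) X f = (\<lambda>\<sigma>. 0)}"

definition coboundaries :: "nat \<Rightarrow> 'x topology \<Rightarrow> 'x cochain set" where
  "coboundaries p X = coboundary p X ` carrier (cochain_module (p - 1) X)"

text \<open>A coset written pointwise. The carrier and operations of the cohomology records are
  reduced to these representatives, so later identities are checked on cochains.\<close>

definition cohomology_class :: "nat \<Rightarrow> 'x topology \<Rightarrow> 'x cochain \<Rightarrow> 'x cochain set" where
  "cohomology_class p X f = (\<lambda>n \<sigma>. n \<sigma> + f \<sigma>) ` coboundaries p X"

lemma carrier_cochain: "f \<in> carrier (cochain_module p X) \<longleftrightarrow> (\<forall>\<sigma>. \<not> singular_simplex p X \<sigma> \<longrightarrow> f \<sigma> = 0)"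
  by (simp add: cochain_module_def)

lemma coboundary_add: "coboundary p X (\<lambda>\<sigma>. f \<sigma> + g \<sigma>) = (\<lambda>\<sigma>. coboundary p X f \<sigma> + coboundary p X g \<sigma>)"
  by (rule ext) (simp add: coboundary_def sum.distrib distrib_left)

lemma coboundary_smult: "coboundary p X (\<lambda>\<sigma>. c * f \<sigma>) = (\<lambda>\<sigma>. c * coboundary p X f \<sigma>)"
  by (rule ext) (simp add: coboundary_def sum_distrib_left mult.left_commute)

lemma cocycles_add: "f \<in> cocycles p X \<Longrightarrow> g \<in> cocycles p X \<Longrightarrow> (\<lambda>\<sigma>. f \<sigma> + g \<sigma>) \<in> cocycles p X"
  by (simp add: cocycles_def carrier_cochain coboundary_add)

lemma cocycles_smult: "f \<in> cocycles p X \<Longrightarrow> (\<lambda>\<sigma>. c * f \<sigma>) \<in> cocycles p X"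
  by (simp add: cocycles_def carrier_cochain coboundary_smult)

lemma coboundaries_add:
  assumes "m \<in> coboundaries p X" "n \<in> coboundaries p X"
  shows "(\<lambda>\<sigma>. m \<sigma> + n \<sigma>) \<in> coboundaries p X"
proof -
  obtain f g where "m = coboundary p X f" "n = coboundary p X g"
    "f \<in> carrier (cochain_module (p - 1) X)" "g \<in> carrier (cochain_module (p - 1) X)"
    using assms unfolding coboundaries_def by blast
  then show ?thesis unfolding coboundaries_def
    by (intro image_eqI[of _ _ "\<lambda>\<sigma>. f \<sigma> + g \<sigma>"]) (simp_all add: coboundary_add carrier_cochain)
qed

lemma coboundaries_smult:
  assumes "n \<in> coboundaries p X"
  shows "(\<lambda>\<sigma>. c * n \<sigma>) \<in> coboundaries p X"
proof -
  obtain f where "n = coboundary p X f" "f \<in> carrier (cochain_module (p - 1) X)"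
    using assms unfolding coboundaries_def by blast
  then show ?thesis unfolding coboundaries_def
    by (intro image_eqI[of _ _ "\<lambda>\<sigma>. c * f \<sigma>"]) (simp_all add: coboundary_smult carrier_cochain)
qed

lemma coboundaries_zero: "(\<lambda>\<sigma>. 0) \<in> coboundaries p X"
proof -
  have "coboundary p X (\<lambda>\<sigma>. 0) = (\<lambda>\<sigma>. 0)" by (rule ext) (simp add: coboundary_def)
  then show ?thesis unfolding coboundaries_def
    by (intro image_eqI[of _ _ "\<lambda>\<sigma>. 0"]) (simp_all add: carrier_cochain)
qed

lemma coboundaries_subset: "coboundaries p X \<subseteq> cocycles p X"
  by (auto simp: coboundaries_def cocycles_def carrier_cochain coboundary_coboundary)
    (simp add: coboundary_def)

lemma cohomology_class_mem: "f \<in> cohomology_class p X f"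
  unfolding cohomology_class_def
  by (rule image_eqI[OF _ coboundaries_zero]) simp

lemma cohomology_class_altdef:
  "g \<in> cohomology_class p X f \<longleftrightarrow> (\<lambda>\<sigma>. g \<sigma> - f \<sigma>) \<in> coboundaries p X"
proof
  assume "g \<in> cohomology_class p X f"
  then show "(\<lambda>\<sigma>. g \<sigma> - f \<sigma>) \<in> coboundaries p X"
    by (auto simp: cohomology_class_def)
next
  assume "(\<lambda>\<sigma>. g \<sigma> - f \<sigma>) \<in> coboundaries p X"
  then show "g \<in> cohomology_class p X f"
    unfolding cohomology_class_def by (rule image_eqI[rotated]) simp
qed

lemma cohomology_class_eq_iff:
  "cohomology_class p X g = cohomology_class p X f \<longleftrightarrow> (\<lambda>\<sigma>. g \<sigma> - f \<sigma>) \<in> coboundaries p X"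
proof
  assume "cohomology_class p X g = cohomology_class p X f"
  then show "(\<lambda>\<sigma>. g \<sigma> - f \<sigma>) \<in> coboundaries p X"
    using cohomology_class_mem[of g p X] by (simp add: cohomology_class_altdef)
next
  assume gf: "(\<lambda>\<sigma>. g \<sigma> - f \<sigma>) \<in> coboundaries p X"
  then have fg: "(\<lambda>\<sigma>. f \<sigma> - g \<sigma>) \<in> coboundaries p X"
    using coboundaries_smult[of _ p X "-1"] by fastforce
  have "(\<lambda>\<sigma>. h \<sigma> - f \<sigma>) \<in> coboundaries p X" if "(\<lambda>\<sigma>. h \<sigma> - g \<sigma>) \<in> coboundaries p X" for h
    using coboundaries_add[OF that gf] by simp
  moreover have "(\<lambda>\<sigma>. h \<sigma> - g \<sigma>) \<in> coboundaries p X" if "(\<lambda>\<sigma>. h \<sigma> - f \<sigma>) \<in> coboundaries p X" for h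
    using coboundaries_add[OF that fg] by simp
  ultimately show "cohomology_class p X g = cohomology_class p X f"
    by (auto simp: cohomology_class_altdef)
qed

lemma singular_cohomology_coset:
  "coboundaries p X +>\<^bsub>cochain_module p X\<^esub> f = cohomology_class p X f"
  by (auto simp: a_r_coset_def' cochain_module_def cohomology_class_def)

lemma zero_singular_cohomology:
  "\<zero>\<^bsub>singular_cohomology p X\<^esub> = coboundaries p X"
  by (simp add: singular_cohomology_def middle_cohomology_def quotient_module_def coboundaries_def)

lemma zero_singular_cohomology': "\<zero>\<^bsub>singular_cohomology p X\<^esub> = cohomology_class p X (\<lambda>\<sigma>. 0)"
  by (auto simp: zero_singular_cohomology cohomology_class_altdef)

lemma carrier_singular_cohomology:
  "carrier (singular_cohomology p X) = cohomology_class p X ` cocycles p X"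
proof -
  have "carrier (singular_cohomology p X) =
      {coboundaries p X +>\<^bsub>cochain_module p X\<^esub> f | f. f \<in> cocycles p X}"
    by (auto simp: singular_cohomology_def middle_cohomology_def quotient_module_def A_RCOSETS_def'
        a_r_coset_def' cocycles_def coboundaries_def cochain_module_def)
  then show ?thesis by (auto simp: singular_cohomology_coset)
qed

lemma add_singular_cohomology:
  "cohomology_class p X f \<oplus>\<^bsub>singular_cohomology p X\<^esub> cohomology_class p X g =
    cohomology_class p X (\<lambda>\<sigma>. f \<sigma> + g \<sigma>)" (is "?L = ?R")
proof -
  have L: "?L = {(\<lambda>\<sigma>. h \<sigma> + k \<sigma>) | h k. h \<in> cohomology_class p X f \<and> k \<in> cohomology_class p X g}"
    by (auto simp: singular_cohomology_def middle_cohomology_def quotient_module_def set_add_def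
        set_mult_def cochain_module_def)
  show ?thesis
  proof (intro subset_antisym subsetI)
    fix x assume "x \<in> ?L"
    then obtain h k where x: "x = (\<lambda>\<sigma>. h \<sigma> + k \<sigma>)"
      and "(\<lambda>\<sigma>. h \<sigma> - f \<sigma>) \<in> coboundaries p X" "(\<lambda>\<sigma>. k \<sigma> - g \<sigma>) \<in> coboundaries p X"
      unfolding L cohomology_class_altdef by blast
    then show "x \<in> ?R"
      using coboundaries_add[of "\<lambda>\<sigma>. h \<sigma> - f \<sigma>" p X "\<lambda>\<sigma>. k \<sigma> - g \<sigma>"]
      by (simp add: cohomology_class_altdef algebra_simps)
  next
    fix x assume "x \<in> ?R"
    then have "(\<lambda>\<sigma>. x \<sigma> - g \<sigma>) \<in> cohomology_class p X f"
      by (simp add: cohomology_class_altdef algebra_simps)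
    moreover have "x = (\<lambda>\<sigma>. (x \<sigma> - g \<sigma>) + g \<sigma>)" by simp
    ultimately show "x \<in> ?L"
      unfolding L mem_Collect_eq using cohomology_class_mem[of g p X]
      by (intro exI[of _ "\<lambda>\<sigma>. x \<sigma> - g \<sigma>"] exI[of _ g]) simp
  qed
qed

lemma smult_singular_cohomology:
  "c \<odot>\<^bsub>singular_cohomology p X\<^esub> cohomology_class p X f = cohomology_class p X (\<lambda>\<sigma>. c * f \<sigma>)"
proof -
  have "c \<odot>\<^bsub>singular_cohomology p X\<^esub> cohomology_class p X f =
      (\<Union>h\<in>cohomology_class p X f. cohomology_class p X (\<lambda>\<sigma>. c * h \<sigma>))"
    by (simp add: singular_cohomology_def middle_cohomology_def quotient_module_def a_r_coset_def'
        coboundaries_def cochain_module_def cohomology_class_def) blast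
  also have "\<dots> = cohomology_class p X (\<lambda>\<sigma>. c * f \<sigma>)"
  proof (rule SUP_eq_const)
    show "cohomology_class p X f \<noteq> {}" using cohomology_class_mem by blast
    fix h assume "h \<in> cohomology_class p X f"
    then have "(\<lambda>\<sigma>. c * (h \<sigma> - f \<sigma>)) \<in> coboundaries p X"
      unfolding cohomology_class_altdef by (rule coboundaries_smult)
    then show "cohomology_class p X (\<lambda>\<sigma>. c * h \<sigma>) = cohomology_class p X (\<lambda>\<sigma>. c * f \<sigma>)"
      by (simp add: cohomology_class_eq_iff right_diff_distrib)
  qed
  finally show ?thesis .
qed

section \<open>Faces of small simplices and cup products of one-cocycles\<close>

definition vertex :: "nat \<Rightarrow> nat \<Rightarrow> real" where
  "vertex k = (\<lambda>j. if j = k then 1 else 0)"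

definition point_simplex :: "'x \<Rightarrow> (nat \<Rightarrow> real) \<Rightarrow> 'x" where
  "point_simplex x = restrict (\<lambda>_. x) (standard_simplex 0)"

lemma vertex_mem: "vertex k \<in> standard_simplex p \<longleftrightarrow> k \<le> p"
  by (simp add: vertex_def)

lemma standard_simplex_0_vertex: "standard_simplex 0 = {vertex 0}"
  by (simp add: standard_simplex_0 vertex_def)

lemma simplical_face_vertex: "simplical_face k (vertex j) = vertex (if j < k then j else Suc j)"
  by (rule ext) (auto simp: simplical_face_def vertex_def)

lemma singular_face_vertex:
  assumes "j \<le> p" "k \<le> Suc p"
  shows "singular_face (Suc p) k \<sigma> (vertex j) = \<sigma> (vertex (if j < k then j else Suc j))"
  using assms by (simp add: singular_face_def vertex_mem simplical_face_vertex)

lemma singular_face_1: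
  "singular_face (Suc 0) k \<sigma> = point_simplex (\<sigma> (vertex (if 0 < k then 0 else Suc 0)))"
  by (rule ext)
    (auto simp: singular_face_def point_simplex_def standard_simplex_0_vertex simplical_face_vertex)

text \<open>Deleting two vertices in either order leaves the same face; the larger index drops by
  one once the smaller vertex is gone.\<close>

lemma singular_face_comm:
  assumes "i \<le> j" "j \<le> Suc p"
  shows "singular_face (Suc p) i (singular_face (Suc (Suc p)) (Suc j) \<sigma>) =
    singular_face (Suc p) j (singular_face (Suc (Suc p)) i \<sigma>)"
proof
  fix t
  show "singular_face (Suc p) i (singular_face (Suc (Suc p)) (Suc j) \<sigma>) t =
    singular_face (Suc p) j (singular_face (Suc (Suc p)) i \<sigma>) t"
  proof (cases "t \<in> standard_simplex p")
    case True
    have "simplical_face (Suc j) (simplical_face i t) = simplical_face i (simplical_face j t)"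
      using assms unfolding simplical_face_def by (intro ext) auto
    moreover have "simplical_face i t \<in> standard_simplex (Suc p)"
      "simplical_face j t \<in> standard_simplex (Suc p)"
      using simplical_face_in_standard_simplex[of "Suc p" _ t] True assms by auto
    ultimately show ?thesis using True by (simp add: singular_face_def)
  qed (simp add: singular_face_def)
qed

lemma singular_simplex_face:
  "singular_simplex (Suc p) X \<sigma> \<Longrightarrow> k \<le> Suc p \<Longrightarrow> singular_simplex p X (singular_face (Suc p) k \<sigma>)"
  using singular_simplex_singular_face[of "Suc p" X \<sigma> k] by simp

lemma coboundary_1:
  assumes "singular_simplex 1 X \<sigma>"
  shows "coboundary 1 X h \<sigma> = h (point_simplex (\<sigma> (vertex 1))) - h (point_simplex (\<sigma> (vertex 0)))"
  using assms by (simp add: coboundary_def singular_face_1)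

lemma coboundary_2:
  assumes "singular_simplex 2 X \<sigma>"
  shows "coboundary 2 X f \<sigma> = f (singular_face 2 0 \<sigma>) - f (singular_face 2 1 \<sigma>) + f (singular_face 2 2 \<sigma>)"
  using assms by (simp add: coboundary_def numeral_2_eq_2)

lemma cocycle_1:
  assumes "f \<in> cocycles 1 X" "singular_simplex 2 X \<sigma>"
  shows "f (singular_face 2 1 \<sigma>) = f (singular_face 2 0 \<sigma>) + f (singular_face 2 2 \<sigma>)"
proof -
  have "coboundary 2 X f \<sigma> = 0" using assms(1) by (simp add: cocycles_def numeral_2_eq_2)
  then show ?thesis using coboundary_2[OF assms(2), of f] by (simp add: algebra_simps)
qed

lemma front_face_eq_face: "front_face 1 \<sigma> = singular_face 2 2 \<sigma>"
proof
  fix x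
  have "simplical_face 2 x = x" if "x \<in> standard_simplex 1"
    using that by (auto simp: simplical_face_def standard_simplex_def)
  then show "front_face 1 \<sigma> x = singular_face 2 2 \<sigma> x"
    by (auto simp: front_face_def singular_face_def)
qed

lemma back_face_eq_face: "back_face 1 1 \<sigma> = singular_face 2 0 \<sigma>"
  by (rule ext) (auto simp: back_face_def singular_face_def simplical_face_def intro!: arg_cong[of _ _ \<sigma>])

lemma cochain_cup_1_1:
  assumes "singular_simplex 2 X \<sigma>"
  shows "cochain_cup 1 1 X f g \<sigma> = f (singular_face 2 2 \<sigma>) * g (singular_face 2 0 \<sigma>)"
  using assms by (simp add: cochain_cup_def front_face_eq_face[simplified] back_face_eq_face[simplified] numeral_2_eq_2)

lemma cochain_cup_1_1_non: "\<not> singular_simplex 2 X \<sigma> \<Longrightarrow> cochain_cup 1 1 X f g \<sigma> = 0"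
  by (simp add: cochain_cup_def numeral_2_eq_2)

lemma cochain_cup_cocycle:
  assumes f: "f \<in> cocycles 1 X" and g: "g \<in> cocycles 1 X"
  shows "cochain_cup 1 1 X f g \<in> cocycles 2 X"
proof -
  have "coboundary 3 X (cochain_cup 1 1 X f g) \<sigma> = 0" for \<sigma>
  proof (cases "singular_simplex 3 X \<sigma>")
    case True
    define d where "d i j = singular_face 2 i (singular_face 3 j \<sigma>)" for i j
    have s: "singular_simplex 2 X (singular_face 3 k \<sigma>)" if "k \<le> 3" for k
      using singular_simplex_face[of 2 X \<sigma> k] True that by (simp add: numeral_3_eq_3)
    have comm: "d i (Suc j) = d j i" if "i \<le> j" "j \<le> 2" for i j
      using singular_face_comm[of i j 1 \<sigma>] that by (simp add: d_def numeral_2_eq_2 numeral_3_eq_3)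
    have c: "d 0 1 = d 0 0" "d 0 2 = d 1 0" "d 0 3 = d 2 0" "d 1 2 = d 1 1" "d 1 3 = d 2 1" "d 2 3 = d 2 2"
      using comm[of 0 0] comm[of 0 1] comm[of 0 2] comm[of 1 1] comm[of 1 2] comm[of 2 2]
      by (simp_all add: numeral_2_eq_2 numeral_3_eq_3)
    have "coboundary 3 X (cochain_cup 1 1 X f g) \<sigma> =
        (\<Sum>k\<le>3. (- 1) ^ k * (f (d 2 k) * g (d 0 k)))"
      using True s by (simp add: coboundary_def cochain_cup_1_1 d_def del: One_nat_def)
    \<comment> \<open>The simplicial identities match the twelve double faces in pairs; the cocycle
      conditions for \<open>f\<close> on face 3 and for \<open>g\<close> on face 0 then cancel the
      four products.\<close>
    also have "\<dots> = f (d 2 0) * g (d 0 0) - f (d 2 1) * g (d 0 0) + f (d 2 2) * g (d 1 0) - f (d 2 2) * g (d 2 0)"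
      using c by (simp add: lessThan_Suc_atMost[symmetric] eval_nat_numeral)
    also have "\<dots> = 0"
      using cocycle_1[OF f s[of 3]] cocycle_1[OF g s[of 0]] c
      by (simp add: algebra_simps del: One_nat_def flip: d_def)
    finally show ?thesis .
  qed (simp add: coboundary_def)
  then show ?thesis
    by (auto simp: cocycles_def carrier_cochain cochain_cup_1_1_non simp del: One_nat_def)
qed

text \<open>A primitive may be given by any formula on edges: cutting it off outside the singular
  simplices yields a cochain and changes no value on the faces of a singular 2-simplex.\<close>

lemma coboundaries_2I:
  assumes "\<And>\<sigma>. \<not> singular_simplex 2 X \<sigma> \<Longrightarrow> m \<sigma> = 0"
    and "\<And>\<sigma>. singular_simplex 2 X \<sigma> \<Longrightarrow>
      m \<sigma> = k (singular_face 2 0 \<sigma>) - k (singular_face 2 1 \<sigma>) + k (singular_face 2 2 \<sigma>)"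
  shows "m \<in> coboundaries 2 X"
proof -
  define k' where "k' \<sigma> = (if singular_simplex 1 X \<sigma> then k \<sigma> else 0)" for \<sigma>
  have "m = coboundary 2 X k'"
  proof
    fix \<sigma>
    show "m \<sigma> = coboundary 2 X k' \<sigma>"
    proof (cases "singular_simplex 2 X \<sigma>")
      case True
      then have "k' (singular_face 2 j \<sigma>) = k (singular_face 2 j \<sigma>)" if "j \<le> 2" for j
        using singular_simplex_face[of 1 X \<sigma> j] that by (simp add: k'_def numeral_2_eq_2)
      then show ?thesis using assms(2)[OF True] coboundary_2[OF True] by simp
    qed (simp add: assms(1) coboundary_def)
  qed
  then show ?thesis by (auto simp: coboundaries_def carrier_cochain k'_def)
qed

lemma edge_vertices:
  "singular_face 2 0 \<sigma> (vertex 0) = \<sigma> (vertex 1)" "singular_face 2 0 \<sigma> (vertex 1) = \<sigma> (vertex 2)"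
  "singular_face 2 1 \<sigma> (vertex 0) = \<sigma> (vertex 0)" "singular_face 2 1 \<sigma> (vertex 1) = \<sigma> (vertex 2)"
  "singular_face 2 2 \<sigma> (vertex 0) = \<sigma> (vertex 0)" "singular_face 2 2 \<sigma> (vertex 1) = \<sigma> (vertex 1)"
  using singular_face_vertex[of _ 1 _ \<sigma>] by (simp_all add: numeral_2_eq_2)

lemma singular_simplex_face_2:
  "singular_simplex 2 X \<sigma> \<Longrightarrow> k \<le> 2 \<Longrightarrow> singular_simplex 1 X (singular_face 2 k \<sigma>)"
  using singular_simplex_face[of 1 X \<sigma> k] by (simp add: numeral_2_eq_2)

text \<open>The primitive is the cup product of \<open>h\<close> with \<open>g\<close>, that is
  \<open>h\<close> at the initial vertex times \<open>g\<close>; its coboundary has only this term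
  since \<open>g\<close> is a cocycle.\<close>

lemma coboundary_cup_cocycle:
  assumes "h \<in> carrier (cochain_module 0 X)" "g \<in> cocycles 1 X"
  shows "cochain_cup 1 1 X (coboundary 1 X h) g \<in> coboundaries 2 X"
proof (rule coboundaries_2I[where k = "\<lambda>\<sigma>. h (point_simplex (\<sigma> (vertex 0))) * g \<sigma>"])
  fix \<sigma> assume s: "singular_simplex 2 X \<sigma>"
  show "cochain_cup 1 1 X (coboundary 1 X h) g \<sigma> =
      h (point_simplex (singular_face 2 0 \<sigma> (vertex 0))) * g (singular_face 2 0 \<sigma>) -
      h (point_simplex (singular_face 2 1 \<sigma> (vertex 0))) * g (singular_face 2 1 \<sigma>) +
      h (point_simplex (singular_face 2 2 \<sigma> (vertex 0))) * g (singular_face 2 2 \<sigma>)"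
    using cocycle_1[OF assms(2) s]
    by (simp add: coboundary_1[OF singular_simplex_face_2[OF s]] cochain_cup_1_1[OF s] edge_vertices algebra_simps del: One_nat_def)
qed (simp add: cochain_cup_1_1_non del: One_nat_def)

text \<open>The mirror case: \<open>h\<close> is now evaluated at the final vertex, and the sign is
  that of the Leibniz rule past a cochain of degree one.\<close>

lemma cocycle_cup_coboundary:
  assumes "f \<in> cocycles 1 X" "h \<in> carrier (cochain_module 0 X)"
  shows "cochain_cup 1 1 X f (coboundary 1 X h) \<in> coboundaries 2 X"
proof (rule coboundaries_2I[where k = "\<lambda>\<sigma>. - (f \<sigma> * h (point_simplex (\<sigma> (vertex 1))))"])
  fix \<sigma> assume s: "singular_simplex 2 X \<sigma>"
  show "cochain_cup 1 1 X f (coboundary 1 X h) \<sigma> =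
      - (f (singular_face 2 0 \<sigma>) * h (point_simplex (singular_face 2 0 \<sigma> (vertex 1)))) -
      - (f (singular_face 2 1 \<sigma>) * h (point_simplex (singular_face 2 1 \<sigma> (vertex 1)))) +
      - (f (singular_face 2 2 \<sigma>) * h (point_simplex (singular_face 2 2 \<sigma> (vertex 1))))"
    using cocycle_1[OF assms(1) s]
    by (simp add: coboundary_1[OF singular_simplex_face_2[OF s]] cochain_cup_1_1[OF s] edge_vertices algebra_simps del: One_nat_def)
qed (simp add: cochain_cup_1_1_non del: One_nat_def)

text \<open>The pointwise product of two 1-cocycles is Steenrod's cup-1 product, up to sign.\<close>

lemma cochain_cup_anticommute:
  assumes "f \<in> cocycles 1 X" "g \<in> cocycles 1 X"
  shows "(\<lambda>\<sigma>. cochain_cup 1 1 X f g \<sigma> + cochain_cup 1 1 X g f \<sigma>) \<in> coboundaries 2 X"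
proof (rule coboundaries_2I[where k = "\<lambda>\<sigma>. - (f \<sigma> * g \<sigma>)"])
  fix \<sigma> assume s: "singular_simplex 2 X \<sigma>"
  show "cochain_cup 1 1 X f g \<sigma> + cochain_cup 1 1 X g f \<sigma> =
      - (f (singular_face 2 0 \<sigma>) * g (singular_face 2 0 \<sigma>)) -
      - (f (singular_face 2 1 \<sigma>) * g (singular_face 2 1 \<sigma>)) +
      - (f (singular_face 2 2 \<sigma>) * g (singular_face 2 2 \<sigma>))"
    using cocycle_1[OF assms(1) s] cocycle_1[OF assms(2) s]
    by (simp add: cochain_cup_1_1[OF s] algebra_simps del: One_nat_def)
qed (simp add: cochain_cup_1_1_non del: One_nat_def)

lemma cochain_cup_add_left:
  "cochain_cup p q X (\<lambda>\<sigma>. f \<sigma> + f' \<sigma>) g = (\<lambda>\<sigma>. cochain_cup p q X f g \<sigma> + cochain_cup p q X f' g \<sigma>)"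
  by (rule ext) (simp add: cochain_cup_def algebra_simps)

lemma cochain_cup_add_right:
  "cochain_cup p q X f (\<lambda>\<sigma>. g \<sigma> + g' \<sigma>) = (\<lambda>\<sigma>. cochain_cup p q X f g \<sigma> + cochain_cup p q X f g' \<sigma>)"
  by (rule ext) (simp add: cochain_cup_def algebra_simps)

lemma cochain_cup_smult_left:
  "cochain_cup p q X (\<lambda>\<sigma>. c * f \<sigma>) g = (\<lambda>\<sigma>. c * cochain_cup p q X f g \<sigma>)"
  by (rule ext) (simp add: cochain_cup_def)

lemma cochain_cup_smult_right:
  "cochain_cup p q X f (\<lambda>\<sigma>. c * g \<sigma>) = (\<lambda>\<sigma>. c * cochain_cup p q X f g \<sigma>)"
  by (rule ext) (simp add: cochain_cup_def)

lemma cup_class_1_1: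
  assumes f: "f \<in> cocycles 1 X" and g: "g \<in> cocycles 1 X"
  shows "cup 1 1 X (cohomology_class 1 X f) (cohomology_class 1 X g) =
    cohomology_class 2 X (cochain_cup 1 1 X f g)"
proof -
  have same: "cohomology_class 2 X (cochain_cup 1 1 X f' g') = cohomology_class 2 X (cochain_cup 1 1 X f g)"
    if f': "f' \<in> cohomology_class 1 X f" and g': "g' \<in> cohomology_class 1 X g" for f' g'
  proof -
    obtain h where h: "h \<in> carrier (cochain_module 0 X)" "f' = (\<lambda>\<sigma>. coboundary 1 X h \<sigma> + f \<sigma>)"
      using f' by (auto simp: cohomology_class_def coboundaries_def)
    obtain k where k: "k \<in> carrier (cochain_module 0 X)" "g' = (\<lambda>\<sigma>. coboundary 1 X k \<sigma> + g \<sigma>)"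
      using g' by (auto simp: cohomology_class_def coboundaries_def)
    have "coboundary 1 X k \<in> cocycles 1 X"
      using coboundaries_subset[of 1 X] k(1) by (auto simp: coboundaries_def)
    then have g'Z: "g' \<in> cocycles 1 X" unfolding k(2) using g by (rule cocycles_add)
    \<comment> \<open>Changing one factor at a time makes each correction a cup product of a
      coboundary with a cocycle, \<open>g'\<close> in the first and \<open>f\<close> in the
      second.\<close>
    have "cochain_cup 1 1 X f' g' = (\<lambda>\<sigma>. cochain_cup 1 1 X (coboundary 1 X h) g' \<sigma> +
        (cochain_cup 1 1 X f (coboundary 1 X k) \<sigma> + cochain_cup 1 1 X f g \<sigma>))"
      unfolding h(2) cochain_cup_add_left by (simp add: k(2) cochain_cup_add_right)
    then have "(\<lambda>\<sigma>. cochain_cup 1 1 X f' g' \<sigma> - cochain_cup 1 1 X f g \<sigma>) =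
        (\<lambda>\<sigma>. cochain_cup 1 1 X (coboundary 1 X h) g' \<sigma> + cochain_cup 1 1 X f (coboundary 1 X k) \<sigma>)"
      by (simp add: fun_eq_iff)
    then show ?thesis
      unfolding cohomology_class_eq_iff
      by (simp only: coboundaries_add[OF coboundary_cup_cocycle[OF h(1) g'Z] cocycle_cup_coboundary[OF f k(1)]])
  qed
  have "cup 1 1 X (cohomology_class 1 X f) (cohomology_class 1 X g) =
      (\<Union>f'\<in>cohomology_class 1 X f. \<Union>g'\<in>cohomology_class 1 X g.
        cohomology_class 2 X (cochain_cup 1 1 X f' g'))"
    unfolding cup_def one_add_one zero_singular_cohomology singular_cohomology_coset ..
  also have "\<dots> = cohomology_class 2 X (cochain_cup 1 1 X f g)"
    using cohomology_class_mem[of f 1 X] cohomology_class_mem[of g 1 X]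
    by (intro SUP_eq_const same) (auto simp del: One_nat_def)
  finally show ?thesis .
qed

section \<open>The first resonance variety\<close>

lemma singular_simplex_of_path:
  assumes "continuous_map (top_of_set {0..1}) X \<gamma>"
  shows "singular_simplex 1 X (restrict (\<lambda>x. \<gamma> (x 1)) (standard_simplex 1))"
proof -
  let ?\<Delta> = "subtopology (powertop_real UNIV) (standard_simplex 1)"
  have "continuous_map ?\<Delta> euclideanreal (\<lambda>x. x 1)"
    by (intro continuous_map_from_subtopology continuous_map_product_projection) simp
  then have "continuous_map ?\<Delta> (top_of_set {0..1}) (\<lambda>x. x 1)"
    by (auto simp: continuous_map_in_subtopology standard_simplex_def)
  from continuous_map_compose[OF this assms] show ?thesis
    by (simp add: singular_simplex_def comp_def)
qed

lemma singular_simplex_vertex: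
  assumes "singular_simplex p X \<sigma>" "k \<le> p"
  shows "\<sigma> (vertex k) \<in> topspace X"
proof -
  have "continuous_map (subtopology (powertop_real UNIV) (standard_simplex p)) X \<sigma>"
    using assms(1) by (simp add: singular_simplex_def)
  from continuous_map_image_subset_topspace[OF this]
  have "\<sigma> ` standard_simplex p \<subseteq> topspace X" by simp
  then show ?thesis using vertex_mem[of k p] assms(2) by blast
qed

lemma singular_simplex_point: "singular_simplex 0 X (point_simplex x) \<longleftrightarrow> x \<in> topspace X"
proof
  assume "singular_simplex 0 X (point_simplex x)"
  then show "x \<in> topspace X"
    using singular_simplex_vertex[of 0 X _ 0] by (fastforce simp: point_simplex_def vertex_mem)
next
  assume "x \<in> topspace X"
  then show "singular_simplex 0 X (point_simplex x)"
    by (simp add: singular_simplex_def point_simplex_def)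
qed

lemma singular_simplex_0_eq_point:
  assumes "singular_simplex 0 X \<sigma>"
  shows "\<sigma> = point_simplex (\<sigma> (vertex 0))"
proof
  fix x show "\<sigma> x = point_simplex (\<sigma> (vertex 0)) x"
    using assms by (cases "x \<in> standard_simplex 0")
      (auto simp: point_simplex_def standard_simplex_0_vertex singular_simplex_def extensional_def)
qed

text \<open>A path is a singular edge, on which the vanishing coboundary compares the values at the
  two ends.\<close>

lemma cocycle_0_constant:
  assumes X: "path_connected_space X" and g: "g \<in> cocycles 0 X"
  shows "\<exists>c. \<forall>\<sigma>. singular_simplex 0 X \<sigma> \<longrightarrow> g \<sigma> = c"
proof -
  have eq: "g (point_simplex x) = g (point_simplex y)" if xy: "x \<in> topspace X" "y \<in> topspace X" for x y
  proof -
    obtain \<gamma> where \<gamma>: "pathin X \<gamma>" "\<gamma> 0 = x" "\<gamma> 1 = y"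
      using X xy unfolding path_connected_space_def by blast
    define \<sigma> where "\<sigma> = restrict (\<lambda>t. \<gamma> (t 1)) (standard_simplex 1)"
    have \<sigma>: "singular_simplex 1 X \<sigma>"
      using singular_simplex_of_path[of X \<gamma>] \<gamma>(1) by (simp add: pathin_def \<sigma>_def)
    have "vertex 0 1 = 0" "vertex 1 1 = 1" by (simp_all add: vertex_def)
    then have "\<sigma> (vertex 0) = x" "\<sigma> (vertex 1) = y"
      using \<gamma>(2,3) by (simp_all add: \<sigma>_def vertex_mem del: One_nat_def)
    moreover have "coboundary 1 X g \<sigma> = 0" using g by (simp add: cocycles_def)
    ultimately show ?thesis using coboundary_1[OF \<sigma>, of g] by simp
  qed
  show ?thesis
  proof (cases "topspace X = {}")
    case True
    then show ?thesis using singular_simplex_vertex[of 0 X _ 0] by auto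
  next
    case False
    then obtain x where x: "x \<in> topspace X" by blast
    have "g \<sigma> = g (point_simplex x)" if s: "singular_simplex 0 X \<sigma>" for \<sigma>
      using eq[OF singular_simplex_vertex[OF s order_refl] x] singular_simplex_0_eq_point[OF s] by simp
    then show ?thesis by blast
  qed
qed

lemma constant_cocycle_0:
  "(\<lambda>\<sigma>. if singular_simplex 0 X \<sigma> then c else 0) \<in> cocycles 0 X" (is "?g \<in> _")
proof -
  have "coboundary 1 X ?g \<sigma> = 0" for \<sigma>
  proof (cases "singular_simplex 1 X \<sigma>")
    case True
    then show ?thesis
      using coboundary_1[OF True, of ?g] singular_simplex_vertex[OF True]
      by (simp add: singular_simplex_point)
  qed (simp add: coboundary_def)
  then show ?thesis by (auto simp: cocycles_def carrier_cochain)
qed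

lemma cochain_cup_1_0:
  assumes f: "f \<in> carrier (cochain_module 1 X)"
    and g: "\<And>\<sigma>. singular_simplex 0 X \<sigma> \<Longrightarrow> g \<sigma> = c"
  shows "cochain_cup 1 0 X f g = (\<lambda>\<sigma>. c * f \<sigma>)"
proof
  fix \<sigma>
  show "cochain_cup 1 0 X f g \<sigma> = c * f \<sigma>"
  proof (cases "singular_simplex 1 X \<sigma>")
    case True
    then have "front_face 1 \<sigma> = \<sigma>"
      by (simp add: front_face_def singular_simplex_def extensional_restrict)
    moreover have "back_face 1 0 \<sigma> = point_simplex (\<sigma> (vertex 1))"
    proof
      fix x
      have "(\<lambda>i. if i < 1 then 0 else vertex 0 (i - 1)) = vertex 1"
        by (rule ext) (auto simp: vertex_def)
      then show "back_face 1 0 \<sigma> x = point_simplex (\<sigma> (vertex 1)) x"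
        by (auto simp: back_face_def point_simplex_def standard_simplex_0_vertex simp del: One_nat_def)
    qed
    moreover have "singular_simplex 0 X (point_simplex (\<sigma> (vertex 1)))"
      unfolding singular_simplex_point by (rule singular_simplex_vertex[OF True]) simp
    ultimately show ?thesis using True g by (simp add: cochain_cup_def)
  next
    case False
    then show ?thesis using f by (simp add: cochain_cup_def carrier_cochain)
  qed
qed

text \<open>The degree \<open>p - 1\<close> truncates, but the coboundary into degree zero vanishes
  by definition; hence classes of degree zero are single cochains.\<close>

lemma coboundaries_0: "coboundaries 0 X = {\<lambda>\<sigma>. 0}"
proof -
  have "coboundary 0 X f = (\<lambda>\<sigma>. 0)" for f by (rule ext) (simp add: coboundary_def)
  moreover have "carrier (cochain_module 0 X) \<noteq> {}" by (auto simp: carrier_cochain)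
  ultimately show ?thesis unfolding coboundaries_def by auto
qed

lemma cup_class_1_0:
  assumes f: "f \<in> cocycles 1 X" and g: "\<And>\<sigma>. singular_simplex 0 X \<sigma> \<Longrightarrow> g \<sigma> = c"
  shows "cup 1 0 X (cohomology_class 1 X f) (cohomology_class 0 X g) =
    c \<odot>\<^bsub>singular_cohomology 1 X\<^esub> cohomology_class 1 X f"
proof -
  have same: "cohomology_class 1 X (cochain_cup 1 0 X f' g) = c \<odot>\<^bsub>singular_cohomology 1 X\<^esub> cohomology_class 1 X f"
    if f': "f' \<in> cohomology_class 1 X f" for f'
  proof -
    have "f' = (\<lambda>\<sigma>. (f' \<sigma> - f \<sigma>) + f \<sigma>)" by simp
    also have "\<dots> \<in> cocycles 1 X"
      using f' coboundaries_subset[of 1 X] f by (intro cocycles_add) (auto simp: cohomology_class_altdef)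
    finally have "f' \<in> carrier (cochain_module 1 X)" by (simp add: cocycles_def)
    then have "cochain_cup 1 0 X f' g = (\<lambda>\<sigma>. c * f' \<sigma>)" using g by (rule cochain_cup_1_0)
    then have "cohomology_class 1 X (cochain_cup 1 0 X f' g) =
        c \<odot>\<^bsub>singular_cohomology 1 X\<^esub> cohomology_class 1 X f'"
      by (simp only: smult_singular_cohomology)
    also have "cohomology_class 1 X f' = cohomology_class 1 X f"
      using f' unfolding cohomology_class_eq_iff cohomology_class_altdef .
    finally show ?thesis .
  qed
  have g0: "cohomology_class 0 X g = {g}"
    by (simp add: cohomology_class_def coboundaries_0)
  have "cup 1 0 X (cohomology_class 1 X f) (cohomology_class 0 X g) =
      (\<Union>f'\<in>cohomology_class 1 X f. cohomology_class 1 X (cochain_cup 1 0 X f' g))"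
    unfolding cup_def g0 add_0_right zero_singular_cohomology singular_cohomology_coset by simp
  also have "\<dots> = c \<odot>\<^bsub>singular_cohomology 1 X\<^esub> cohomology_class 1 X f"
    by (rule SUP_eq_const) (use cohomology_class_mem same in blast)+
  finally show ?thesis .
qed

lemma cup_H0_image:
  assumes X: "path_connected_space X" and v: "v \<in> carrier (singular_cohomology 1 X)"
  shows "cup 1 0 X v ` carrier (singular_cohomology 0 X) = range (\<lambda>c. c \<odot>\<^bsub>singular_cohomology 1 X\<^esub> v)"
proof -
  obtain f where f: "f \<in> cocycles 1 X" "v = cohomology_class 1 X f"
    using v by (auto simp: carrier_singular_cohomology)
  show ?thesis
  proof (intro subset_antisym subsetI)
    fix x assume "x \<in> cup 1 0 X v ` carrier (singular_cohomology 0 X)"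
    then obtain g where g: "g \<in> cocycles 0 X" "x = cup 1 0 X v (cohomology_class 0 X g)"
      by (auto simp: carrier_singular_cohomology)
    obtain c where "\<And>\<sigma>. singular_simplex 0 X \<sigma> \<Longrightarrow> g \<sigma> = c"
      using cocycle_0_constant[OF X g(1)] by blast
    from cup_class_1_0[OF f(1) this] show "x \<in> range (\<lambda>c. c \<odot>\<^bsub>singular_cohomology 1 X\<^esub> v)"
      unfolding g(2) f(2) by simp
  next
    fix x assume "x \<in> range (\<lambda>c. c \<odot>\<^bsub>singular_cohomology 1 X\<^esub> v)"
    then obtain c where x: "x = c \<odot>\<^bsub>singular_cohomology 1 X\<^esub> v" by blast
    let ?g = "\<lambda>\<sigma>. if singular_simplex 0 X \<sigma> then c else 0"
    have "x = cup 1 0 X v (cohomology_class 0 X ?g)"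
      unfolding x f(2) by (rule cup_class_1_0[OF f(1), symmetric]) simp
    then show "x \<in> cup 1 0 X v ` carrier (singular_cohomology 0 X)"
      using constant_cocycle_0[of X c] unfolding carrier_singular_cohomology by blast
  qed
qed

lemma cup_1_1_closed:
  assumes "v \<in> carrier (singular_cohomology 1 X)" "w \<in> carrier (singular_cohomology 1 X)"
  shows "cup 1 1 X v w \<in> carrier (singular_cohomology 2 X)"
  using assms cup_class_1_1 cochain_cup_cocycle by (fastforce simp: carrier_singular_cohomology simp del: One_nat_def)

lemma cup_1_1_bilinear:
  assumes "u \<in> carrier (singular_cohomology 1 X)" "v \<in> carrier (singular_cohomology 1 X)"
    "w \<in> carrier (singular_cohomology 1 X)"
  shows "cup 1 1 X (u \<oplus>\<^bsub>singular_cohomology 1 X\<^esub> v) w = cup 1 1 X u w \<oplus>\<^bsub>singular_cohomology 2 X\<^esub> cup 1 1 X v w"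
    and "cup 1 1 X w (u \<oplus>\<^bsub>singular_cohomology 1 X\<^esub> v) = cup 1 1 X w u \<oplus>\<^bsub>singular_cohomology 2 X\<^esub> cup 1 1 X w v"
    and "cup 1 1 X (c \<odot>\<^bsub>singular_cohomology 1 X\<^esub> v) w = c \<odot>\<^bsub>singular_cohomology 2 X\<^esub> cup 1 1 X v w"
    and "cup 1 1 X w (c \<odot>\<^bsub>singular_cohomology 1 X\<^esub> v) = c \<odot>\<^bsub>singular_cohomology 2 X\<^esub> cup 1 1 X w v"
proof -
  obtain f g h where fgh: "f \<in> cocycles 1 X" "g \<in> cocycles 1 X" "h \<in> cocycles 1 X"
    "u = cohomology_class 1 X f" "v = cohomology_class 1 X g" "w = cohomology_class 1 X h"
    using assms by (auto simp: carrier_singular_cohomology simp del: One_nat_def)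
  note simps = fgh add_singular_cohomology smult_singular_cohomology cup_class_1_1
    cocycles_add cocycles_smult cochain_cup_add_left cochain_cup_add_right
    cochain_cup_smult_left cochain_cup_smult_right
  show "cup 1 1 X (u \<oplus>\<^bsub>singular_cohomology 1 X\<^esub> v) w = cup 1 1 X u w \<oplus>\<^bsub>singular_cohomology 2 X\<^esub> cup 1 1 X v w"
    by (simp add: simps del: One_nat_def)
  show "cup 1 1 X w (u \<oplus>\<^bsub>singular_cohomology 1 X\<^esub> v) = cup 1 1 X w u \<oplus>\<^bsub>singular_cohomology 2 X\<^esub> cup 1 1 X w v"
    by (simp add: simps del: One_nat_def)
  show "cup 1 1 X (c \<odot>\<^bsub>singular_cohomology 1 X\<^esub> v) w = c \<odot>\<^bsub>singular_cohomology 2 X\<^esub> cup 1 1 X v w"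
    by (simp add: simps del: One_nat_def)
  show "cup 1 1 X w (c \<odot>\<^bsub>singular_cohomology 1 X\<^esub> v) = c \<odot>\<^bsub>singular_cohomology 2 X\<^esub> cup 1 1 X w v"
    by (simp add: simps del: One_nat_def)
qed

lemma cup_1_1_anticommute:
  assumes "v \<in> carrier (singular_cohomology 1 X)" "w \<in> carrier (singular_cohomology 1 X)"
  shows "cup 1 1 X v w = (- 1) \<odot>\<^bsub>singular_cohomology 2 X\<^esub> cup 1 1 X w v"
proof -
  obtain f g where fg: "f \<in> cocycles 1 X" "g \<in> cocycles 1 X"
    "v = cohomology_class 1 X f" "w = cohomology_class 1 X g"
    using assms by (auto simp: carrier_singular_cohomology simp del: One_nat_def)
  have "cohomology_class 2 X (cochain_cup 1 1 X f g) = cohomology_class 2 X (\<lambda>\<sigma>. - 1 * cochain_cup 1 1 X g f \<sigma>)"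
    unfolding cohomology_class_eq_iff using cochain_cup_anticommute[OF fg(1,2)] by simp
  then show ?thesis
    unfolding fg(3,4) cup_class_1_1[OF fg(1,2)] cup_class_1_1[OF fg(2,1)] smult_singular_cohomology .
qed

lemma image_neq_singleton_iff: "a \<in> A \<Longrightarrow> f ` A \<noteq> {c} \<longleftrightarrow> (\<exists>x\<in>A. f x \<noteq> c)"
  by auto

lemma resonance1_iff:
  assumes X: "path_connected_space X" and v: "v \<in> carrier (singular_cohomology 1 X)"
  shows "v \<in> resonance1 X \<longleftrightarrow> (\<exists>x\<in>carrier (singular_cohomology 1 X).
    cup 1 1 X v x = \<zero>\<^bsub>singular_cohomology 2 X\<^esub> \<and> (\<forall>c. x \<noteq> c \<odot>\<^bsub>singular_cohomology 1 X\<^esub> v))"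
proof -
  define V where "V = singular_cohomology 1 X"
  define W where "W = singular_cohomology 2 X"
  interpret V: vectorspace class_ring V unfolding V_def by (rule vectorspace_singular_cohomology)
  interpret W: vectorspace class_ring W unfolding W_def by (rule vectorspace_singular_cohomology)
  note v = v[folded V_def]
  have zv: "0 \<odot>\<^bsub>V\<^esub> v = \<zero>\<^bsub>V\<^esub>" using V.smult_l_null[OF v] by simp
  define N where "N = range (\<lambda>c. c \<odot>\<^bsub>V\<^esub> v)"
  define K where "K = {x \<in> carrier V. cup 1 1 X v x = \<zero>\<^bsub>W\<^esub>}"
  define H where "H = middle_cohomology (singular_cohomology 0 X) V W (cup 1 0 X v) (cup 1 1 X v)"
  have H: "carrier H = (\<lambda>x. (\<lambda>n. n \<oplus>\<^bsub>V\<^esub> x) ` N) ` K" "\<zero>\<^bsub>H\<^esub> = N"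
    by (auto simp: H_def middle_cohomology_def quotient_module_def A_RCOSETS_def' a_r_coset_def'
        cup_H0_image[OF X v[unfolded V_def], folded V_def] K_def N_def simp del: One_nat_def)
  have coset: "(\<lambda>n. n \<oplus>\<^bsub>V\<^esub> x) ` N = N \<longleftrightarrow> x \<in> N" if x: "x \<in> carrier V" for x
  proof
    have "\<zero>\<^bsub>V\<^esub> \<in> N" unfolding N_def by (intro range_eqI[of _ _ 0]) (rule zv[symmetric])
    then have "x \<in> (\<lambda>n. n \<oplus>\<^bsub>V\<^esub> x) ` N" using x by (intro image_eqI[of _ _ "\<zero>\<^bsub>V\<^esub>"]) simp_all
    then show "(\<lambda>n. n \<oplus>\<^bsub>V\<^esub> x) ` N = N \<Longrightarrow> x \<in> N" by simp
  next
    assume "x \<in> N"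
    then obtain d where d: "x = d \<odot>\<^bsub>V\<^esub> v" by (auto simp: N_def)
    have shift: "c \<odot>\<^bsub>V\<^esub> v \<oplus>\<^bsub>V\<^esub> x = (c + d) \<odot>\<^bsub>V\<^esub> v" for c
      unfolding d using V.smult_l_distr[of c d v] v by simp
    show "(\<lambda>n. n \<oplus>\<^bsub>V\<^esub> x) ` N = N"
    proof (intro subset_antisym subsetI)
      fix y assume "y \<in> (\<lambda>n. n \<oplus>\<^bsub>V\<^esub> x) ` N"
      then show "y \<in> N" using shift by (auto simp: N_def)
    next
      fix y assume "y \<in> N"
      then obtain c where c: "y = c \<odot>\<^bsub>V\<^esub> v" by (auto simp: N_def)
      show "y \<in> (\<lambda>n. n \<oplus>\<^bsub>V\<^esub> x) ` N"
        by (rule image_eqI[of _ _ "(c - d) \<odot>\<^bsub>V\<^esub> v"]) (simp_all add: shift c N_def)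
    qed
  qed
  \<comment> \<open>Zero lies in the kernel \<open>K\<close>, so the set of cosets is nonempty;
    differing from the zero module then means that some kernel element lies outside the line
    \<open>N\<close>.\<close>
  have "cup 1 1 X v (0 \<odot>\<^bsub>V\<^esub> v) = 0 \<odot>\<^bsub>W\<^esub> cup 1 1 X v v"
    using v unfolding V_def W_def by (intro cup_1_1_bilinear(4))
  moreover have "cup 1 1 X v v \<in> carrier W"
    unfolding W_def using v unfolding V_def by (intro cup_1_1_closed)
  ultimately have K: "\<zero>\<^bsub>V\<^esub> \<in> K"
    using zv W.smult_l_null[of "cup 1 1 X v v"] by (simp add: K_def del: One_nat_def)
  have "v \<in> resonance1 X \<longleftrightarrow> carrier H \<noteq> {\<zero>\<^bsub>H\<^esub>}"
    using v by (simp add: resonance1_def H_def V_def W_def Let_def)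
  also have "\<dots> \<longleftrightarrow> (\<exists>x\<in>K. (\<lambda>n. n \<oplus>\<^bsub>V\<^esub> x) ` N \<noteq> N)"
    unfolding H by (rule image_neq_singleton_iff[OF K])
  also have "\<dots> \<longleftrightarrow> (\<exists>x\<in>K. x \<notin> N)" 
  proof (rule bex_cong[OF refl])
    fix x assume "x \<in> K"
    then show "(\<lambda>n. n \<oplus>\<^bsub>V\<^esub> x) ` N \<noteq> N \<longleftrightarrow> x \<notin> N" using coset[of x] by (simp add: K_def)
  qed
  finally show ?thesis by (auto simp: K_def N_def V_def W_def simp del: One_nat_def)
qed

text \<open>The formal half of the theorem, for an arbitrary space: path connectedness makes the
  image of degree zero a line, and the bound on \<open>betti 1 X\<close> settles the origin.\<close>

lemma minors_and_resonance1:
  fixes X :: "'x topology"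
  assumes X: "path_connected_space X"
    and es: "ordered_basis (singular_cohomology 1 X) es"
    and fs: "ordered_basis (singular_cohomology 2 X) fs"
    and i: "i < betti 1 X" and b3: "3 \<le> betti 1 X"
  defines "M \<equiv> minors (betti 1 X - 1) (remove_col i (phi1 X es fs))"
    and "S \<equiv> poly_ring_in {..<betti 1 X}"
  shows "\<forall>p\<in>M. \<exists>q\<in>S. p = poly_var i * q"
    and "resonance1 X = {v \<in> carrier (singular_cohomology 1 X).
      \<forall>p\<in>M. \<forall>q\<in>S. p = poly_var i * q \<longrightarrow>
        poly_eval (coordinates (singular_cohomology 1 X) es v) q = 0}"
proof -
  define V where "V = singular_cohomology 1 X"
  define W where "W = singular_cohomology 2 X"
  define cp where "cp = cup 1 1 X"
  interpret V: based_space V es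
    unfolding V_def by (intro based_space.intro based_space_axioms.intro vectorspace_singular_cohomology es)
  interpret W: based_space W fs
    unfolding W_def by (intro based_space.intro based_space_axioms.intro vectorspace_singular_cohomology fs)
  define b where "b = length es"
  define m where "m = length fs"
  have betti: "betti 1 X = b"
    using V.dim_eq_length by (simp add: betti_def V_def b_def)
  have i: "i < b" and b3: "3 \<le> b" using i b3 unfolding betti by blast+
  note cup_facts = cup_1_1_bilinear[where X = X, folded V_def W_def cp_def]
    cup_1_1_closed[where X = X, folded V_def W_def cp_def]
  \<comment> \<open>The numbers \<open>C j (es ! k) (es ! l)\<close> are the structure constants of
    the cup product, which are the coefficients of the linear forms in the matrix.\<close>
  define C where "C j v w = W.coords (cp v w) j" for j v w
  have C_add: "C j (u \<oplus>\<^bsub>V\<^esub> v) w = C j u w + C j v w" "C j w (u \<oplus>\<^bsub>V\<^esub> v) = C j w u + C j w v"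
    and C_smult: "C j (c \<odot>\<^bsub>V\<^esub> v) w = c * C j v w" "C j w (c \<odot>\<^bsub>V\<^esub> v) = c * C j w v"
    if "u \<in> carrier V" "v \<in> carrier V" "w \<in> carrier V" for j c u v w
    using that by (simp_all add: C_def cup_facts W.coords_add W.coords_smult)
  have C_anti: "C j v w = - C j w v" if "v \<in> carrier V" "w \<in> carrier V" for j v w
    using that cup_1_1_anticommute[where X = X, folded V_def W_def cp_def, of v w]
    by (simp add: C_def cup_facts W.coords_smult)
  define A where "A j l = (\<Sum>k<b. poly_const (C j (es ! k) (es ! l)) * poly_var k)" for j l
  have phi: "phi1 X es fs = Matrix.mat m b (\<lambda>(j, l). A j l)"
    by (simp add: phi1_def A_def C_def m_def b_def cp_def W_def del: One_nat_def)
  have eval_A: "poly_eval a (A j l) = (\<Sum>k<b. a k * C j (es ! k) (es ! l))" for a j l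
    by (simp add: A_def poly_eval_sum poly_eval_mult poly_eval_const poly_eval_var mult.commute)
  interpret koszul_matrix A m b
  proof
    show "A j l \<in> poly_ring_in {..<b}" for j l
      unfolding A_def
      by (intro poly_ring_in_sum poly_ring_in_mult poly_ring_in_const poly_ring_in_var) simp
    show "poly_eval (\<lambda>k. t * a k) (A j l) = t * poly_eval a (A j l)" for j l a t
      by (simp add: eval_A sum_distrib_left mult.assoc)
    fix j
    let ?t = "\<lambda>l k. poly_const (C j (es ! k) (es ! l)) * (poly_var k * poly_var l)"
    have "(\<Sum>l<b. poly_var l * A j l) = (\<Sum>l<b. \<Sum>k<b. ?t l k)"
      by (simp add: A_def sum_distrib_left mult_ac)
    also have "\<dots> = (\<Sum>l<b. \<Sum>k<b. ?t k l)" by (rule sum.swap)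
    \<comment> \<open>Exchanging the indices changes the sign of the structure constants but not the
      product of the variables, so the sum is its own negative; it vanishes coefficientwise because
      2 is invertible.\<close>
    also have "\<dots> = (\<Sum>l<b. \<Sum>k<b. - ?t l k)"
    proof (intro sum.cong refl)
      fix l k assume "l \<in> {..<b}" "k \<in> {..<b}"
      then have "C j (es ! l) (es ! k) = - C j (es ! k) (es ! l)"
        by (intro C_anti V.nth_closed) (simp_all add: b_def)
      then show "?t k l = - ?t l k"
        by (simp add: poly_const_def single_uminus mult.commute)
    qed
    also have "\<dots> = - (\<Sum>l<b. \<Sum>k<b. ?t l k)" by (simp add: sum_negf)
    also have "\<dots> = - (\<Sum>l<b. poly_var l * A j l)"
      by (simp add: A_def sum_distrib_left mult_ac)
    finally have neg: "(\<Sum>l<b. poly_var l * A j l) = - (\<Sum>l<b. poly_var l * A j l)" .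
    show "(\<Sum>l<b. poly_var l * A j l) = 0"
    proof (rule poly_mapping_eqI)
      fix k
      show "Poly_Mapping.lookup (\<Sum>l<b. poly_var l * A j l) k = Poly_Mapping.lookup 0 k"
        using arg_cong[OF neg, of "\<lambda>p. Poly_Mapping.lookup p k"] by simp
    qed
  qed
  have M: "M = {cols_minor I (others i) | I. I \<subseteq> {..<m} \<and> card I = b - 1}"
    unfolding M_def betti phi minors_remove_col[OF i] cols_minor_def by simp
  have S: "S = poly_ring_in {..<b}" by (simp only: S_def betti)
  have "\<exists>q\<in>S. cols_minor I (others i) = poly_var i * q" if "I \<subseteq> {..<m}" "card I = b - 1" for I
  proof (rule poly_var_dvd_cols_minor[OF _ i that])
    show "2 \<le> b" using b3 by simp
    fix q assume "q \<in> poly_ring_in {..<b}" "cols_minor I (others i) = poly_var i * q"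
    then show ?thesis unfolding S by (rule rev_bexI)
  qed
  then show div: "\<forall>p\<in>M. \<exists>q\<in>S. p = poly_var i * q" unfolding M by auto
  have "\<forall>I. \<exists>q. I \<subseteq> {..<m} \<and> card I = b - 1 \<longrightarrow> q \<in> S \<and> cols_minor I (others i) = poly_var i * q"
    using div unfolding M by blast
  from choice[OF this] obtain q where "\<forall>I. I \<subseteq> {..<m} \<and> card I = b - 1 \<longrightarrow>
      q I \<in> S \<and> cols_minor I (others i) = poly_var i * q I" by (elim exE)
  then have q: "q I \<in> S" "cols_minor I (others i) = poly_var i * q I"
    if "I \<subseteq> {..<m}" "card I = b - 1" for I using that by simp_all
  \<comment> \<open>Cancelling \<open>poly_var i\<close> makes the quotient of each minor unique, so
    quantifying over all quotients amounts to using the chosen \<open>q I\<close>.\<close>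
  have zeros: "(\<forall>p\<in>M. \<forall>r\<in>S. p = poly_var i * r \<longrightarrow> poly_eval a r = 0) \<longleftrightarrow>
      (\<forall>I\<subseteq>{..<m}. card I = b - 1 \<longrightarrow> poly_eval a (q I) = 0)" for a
  proof
    assume L: "\<forall>p\<in>M. \<forall>r\<in>S. p = poly_var i * r \<longrightarrow> poly_eval a r = 0"
    show "\<forall>I\<subseteq>{..<m}. card I = b - 1 \<longrightarrow> poly_eval a (q I) = 0"
    proof (intro allI impI)
      fix I assume I: "I \<subseteq> {..<m}" "card I = b - 1"
      then have "cols_minor I (others i) \<in> M" unfolding M by blast
      then show "poly_eval a (q I) = 0" using L q[OF I] by simp
    qed
  next
    assume R: "\<forall>I\<subseteq>{..<m}. card I = b - 1 \<longrightarrow> poly_eval a (q I) = 0"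
    show "\<forall>p\<in>M. \<forall>r\<in>S. p = poly_var i * r \<longrightarrow> poly_eval a r = 0"
    proof (intro ballI impI)
      fix p r assume "p \<in> M" and r: "p = poly_var i * r"
      then obtain I where I: "I \<subseteq> {..<m}" "card I = b - 1" "p = cols_minor I (others i)"
        unfolding M by blast
      then have "poly_var i * r = poly_var i * q I" using q(2)[OF I(1,2)] r by simp
      then have "r = q I" using poly_var_neq_0[of i] by (simp add: mult_cancel_left)
      then show "poly_eval a r = 0" using R I by simp
    qed
  qed
  have "v \<in> resonance1 X \<longleftrightarrow> (\<forall>p\<in>M. \<forall>r\<in>S. p = poly_var i * r \<longrightarrow> poly_eval (V.coords v) r = 0)"
    if v: "v \<in> carrier V" for v
  proof -
    let ?a = "V.coords v"
    have res: "v \<in> resonance1 X \<longleftrightarrow>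
        (\<exists>x\<in>carrier V. cp v x = \<zero>\<^bsub>W\<^esub> \<and> (\<forall>c. x \<noteq> c \<odot>\<^bsub>V\<^esub> v))"
      using resonance1_iff[OF X, of v] v by (simp add: V_def W_def cp_def del: One_nat_def)
    have cup_coords: "C j v x = (\<Sum>l<b. poly_eval ?a (A j l) * V.coords x l)"
      if x: "x \<in> carrier V" for x j
    proof -
      have left: "C j v w = (\<Sum>k<b. ?a k * C j (es ! k) w)" if w: "w \<in> carrier V" for w
      proof -
        have "C j (V.comb ?a) w = (\<Sum>k<b. ?a k * C j (es ! k) w)"
          unfolding b_def by (rule V.linear_comb) (simp_all add: C_add[OF _ _ w] C_smult[OF w _ w])
        then show ?thesis by (simp add: V.coords_props v)
      qed
      have "C j v (V.comb (V.coords x)) = (\<Sum>l<b. V.coords x l * C j v (es ! l))"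
        unfolding b_def by (rule V.linear_comb) (simp_all add: C_add[OF _ _ v] C_smult[OF v _ v])
      then have "C j v x = (\<Sum>l<b. V.coords x l * C j v (es ! l))" by (simp add: V.coords_props x)
      also have "\<dots> = (\<Sum>l<b. poly_eval ?a (A j l) * V.coords x l)"
        by (intro sum.cong refl) (simp add: left V.nth_closed b_def eval_A mult.commute)
      finally show ?thesis .
    qed
    have kernel: "cp v x = \<zero>\<^bsub>W\<^esub> \<longleftrightarrow> (\<forall>p<m. (\<Sum>l<b. poly_eval ?a (A p l) * V.coords x l) = 0)"
      if x: "x \<in> carrier V" for x
      using W.coords_eq_iff[of "cp v x" "\<zero>\<^bsub>W\<^esub>"] cup_facts(5)[OF v x] cup_coords[OF x]
      by (simp add: W.coords_zero C_def m_def)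
    have multiple: "x = c \<odot>\<^bsub>V\<^esub> v \<longleftrightarrow> (\<forall>l<b. V.coords x l = c * ?a l)" if x: "x \<in> carrier V" for x c
      using V.coords_eq_iff[of x "c \<odot>\<^bsub>V\<^esub> v"] x v by (simp add: V.coords_smult b_def)
    show ?thesis
    proof (cases "\<exists>j<b. ?a j \<noteq> 0")
      case True
      then obtain j where j: "j < b" "?a j \<noteq> 0" by blast
      have "(\<exists>w. (\<forall>p<m. (\<Sum>l<b. poly_eval ?a (A p l) * w l) = 0) \<and> \<not> (\<exists>t. \<forall>l<b. w l = t * ?a l)) \<longleftrightarrow>
          (\<exists>x\<in>carrier V. cp v x = \<zero>\<^bsub>W\<^esub> \<and> (\<forall>c. x \<noteq> c \<odot>\<^bsub>V\<^esub> v))"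
      proof
        assume "\<exists>w. (\<forall>p<m. (\<Sum>l<b. poly_eval ?a (A p l) * w l) = 0) \<and> \<not> (\<exists>t. \<forall>l<b. w l = t * ?a l)"
        then obtain w where w: "\<forall>p<m. (\<Sum>l<b. poly_eval ?a (A p l) * w l) = 0"
          "\<not> (\<exists>t. \<forall>l<b. w l = t * ?a l)" by blast
        define x where "x = V.comb w"
        have x: "x \<in> carrier V" by (simp add: x_def V.comb_closed)
        have "x = V.comb (\<lambda>l. if l < b then w l else 0)"
          unfolding x_def by (rule V.comb_cong) (simp add: b_def)
        then have "V.coords x = (\<lambda>l. if l < b then w l else 0)"
          by (intro V.coords_eqI) (simp_all add: b_def)
        then have xw: "V.coords x l = w l" if "l < b" for l using that by simp
        show "\<exists>x\<in>carrier V. cp v x = \<zero>\<^bsub>W\<^esub> \<and> (\<forall>c. x \<noteq> c \<odot>\<^bsub>V\<^esub> v)"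
        proof (intro bexI[OF _ x] conjI allI)
          show "cp v x = \<zero>\<^bsub>W\<^esub>" unfolding kernel[OF x] using w(1) xw by simp
          show "x \<noteq> c \<odot>\<^bsub>V\<^esub> v" for c using w(2) xw multiple[OF x, of c] by simp
        qed
      next
        assume "\<exists>x\<in>carrier V. cp v x = \<zero>\<^bsub>W\<^esub> \<and> (\<forall>c. x \<noteq> c \<odot>\<^bsub>V\<^esub> v)"
        then obtain x where x: "x \<in> carrier V" "cp v x = \<zero>\<^bsub>W\<^esub>" "\<forall>c. x \<noteq> c \<odot>\<^bsub>V\<^esub> v" by blast
        then show "\<exists>w. (\<forall>p<m. (\<Sum>l<b. poly_eval ?a (A p l) * w l) = 0) \<and> \<not> (\<exists>t. \<forall>l<b. w l = t * ?a l)"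
          using kernel[OF x(1)] multiple[OF x(1)] by (intro exI[of _ "V.coords x"]) simp
      qed
      then show ?thesis
        unfolding res zeros
        using cofactors_vanish_iff[of i j ?a q] b3 i j q(2) by simp
    next
      case False
      then have "?a k = 0" for k
        using V.coords_props(1)[OF v, of k] by (cases "k < b") (auto simp: b_def)
      then have a: "?a = (\<lambda>_. 0)" by (rule ext)
      have "poly_eval ?a (q I) = 0" if "I \<subseteq> {..<m}" "card I = b - 1" for I
        unfolding a by (rule cofactor_origin[OF b3 i that q(2)[OF that]])
      moreover have "v \<in> resonance1 X"
        unfolding res
      proof (intro bexI conjI allI)
        \<comment> \<open>At the zero class both differentials vanish, so any nonzero class
          witnesses resonance; the first basis vector is taken.\<close>
        define e where "e k = (if k = 0 then 1 else 0 :: complex)" for k :: nat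
        have x: "V.comb e \<in> carrier V" by (rule V.comb_closed)
        then show "V.comb e \<in> carrier V" .
        show "cp v (V.comb e) = \<zero>\<^bsub>W\<^esub>"
          unfolding kernel[OF x] eval_A a by simp
        have "V.coords (V.comb e) = e"
          by (rule V.coords_eqI) (use b3 in \<open>auto simp: e_def b_def\<close>)
        then show "V.comb e \<noteq> c \<odot>\<^bsub>V\<^esub> v" for c
          unfolding multiple[OF x] a using b3 by (auto simp: e_def intro!: exI[of _ 0])
      qed
      ultimately show ?thesis unfolding zeros by blast
    qed
  qed
  moreover have "resonance1 X \<subseteq> carrier V" by (auto simp: resonance1_def V_def)
  ultimately show "resonance1 X = {v \<in> carrier (singular_cohomology 1 X).
      \<forall>p\<in>M. \<forall>q\<in>S. p = poly_var i * q \<longrightarrow>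
        poly_eval (coordinates (singular_cohomology 1 X) es v) q = 0}"
    unfolding V_def[symmetric] by blast
qed

section \<open>Logarithmic cocycles\<close>

text \<open>A substitute for the integral of dz/z along a path that is only continuous. The choice
  is harmless because any two continuous logarithms give the same change.\<close>

definition log_change :: "(real \<Rightarrow> complex) \<Rightarrow> complex" where
  "log_change p = (SOME d. \<exists>L. continuous_on {0..1} L \<and> (\<forall>t\<in>{0..1}. p t = exp (L t)) \<and> d = L 1 - L 0)"

text \<open>Two continuous logarithms of one path differ by a continuous function with values in the
  multiples of 2 pi i. Distinct values are at least 2 pi apart, so the difference is constant on the
  interval.\<close>

lemma log_change_eq:
  assumes L: "continuous_on {0..1} L" "\<And>t. t \<in> {0..1} \<Longrightarrow> p t = exp (L t)"
  shows "log_change p = L 1 - L 0"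
  unfolding log_change_def
proof (rule some_equality)
  show "\<exists>L'. continuous_on {0..1} L' \<and> (\<forall>t\<in>{0..1}. p t = exp (L' t)) \<and> L 1 - L 0 = L' 1 - L' 0"
    using L by blast
next
  fix d assume "\<exists>L'. continuous_on {0..1} L' \<and> (\<forall>t\<in>{0..1}. p t = exp (L' t)) \<and> d = L' 1 - L' 0"
  then obtain L' where L': "continuous_on {0..1} L'" "\<And>t. t \<in> {0..1} \<Longrightarrow> p t = exp (L' t)"
    and d: "d = L' 1 - L' 0" by blast
  let ?D = "\<lambda>t. L' t - L t"
  have "?D constant_on {0..1}"
  proof (rule continuous_discrete_range_constant)
    show "connected {0..1::real}" by simp
    show "continuous_on {0..1} ?D" by (intro continuous_intros L L')
    fix x :: real assume x: "x \<in> {0..1}"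
    have "2 * pi \<le> norm (?D y - ?D x)" if "y \<in> {0..1}" "?D y \<noteq> ?D x" for y
    proof -
      have "exp (?D z) = 1" if "z \<in> {0..1}" for z
        using L(2)[OF that] L'(2)[OF that] by (simp add: exp_diff)
      then have "\<not> \<bar>Im (?D y) - Im (?D x)\<bar> < 2 * pi"
        using exp_complex_eqI[of "?D y" "?D x"] that x by auto
      then show ?thesis using abs_Im_le_cmod[of "?D y - ?D x"] by simp
    qed
    then show "\<exists>e>0. \<forall>y. y \<in> {0..1} \<and> ?D y \<noteq> ?D x \<longrightarrow> e \<le> norm (?D y - ?D x)"
      by (intro exI[of _ "2 * pi"]) auto
  qed
  then have "?D 0 = ?D 1" unfolding constant_on_def by force
  then show "d = L 1 - L 0" unfolding d by (simp add: algebra_simps)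
qed

definition edge_point :: "real \<Rightarrow> nat \<Rightarrow> real" where
  "edge_point t = (\<lambda>i. if i = 0 then 1 - t else if i = 1 then t else 0)"

definition triangle_point :: "real \<times> real \<Rightarrow> nat \<Rightarrow> real" where
  "triangle_point u = (\<lambda>i. if i = 0 then 1 - fst u - snd u else if i = 1 then fst u
     else if i = 2 then snd u else 0)"

text \<open>Points of the standard 2-simplex are functions on the natural numbers; this planar set
  parametrizes them, so that continuous logarithms can be taken on a contractible subset of a
  Euclidean space.\<close>

definition unit_triangle :: "(real \<times> real) set" where
  "unit_triangle = {u. 0 \<le> fst u \<and> 0 \<le> snd u \<and> fst u + snd u \<le> 1}"

lemma edge_point_mem: "t \<in> {0..1} \<Longrightarrow> edge_point t \<in> standard_simplex 1"
  by (auto simp: edge_point_def standard_simplex_def)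

lemma triangle_point_mem: "u \<in> unit_triangle \<Longrightarrow> triangle_point u \<in> standard_simplex 2"
  by (auto simp: triangle_point_def unit_triangle_def standard_simplex_def numeral_2_eq_2)

lemma convex_unit_triangle: "convex unit_triangle"
proof (rule convexI)
  fix x y :: "real \<times> real" and u v :: real
  assume xy: "x \<in> unit_triangle" "y \<in> unit_triangle" and uv: "0 \<le> u" "0 \<le> v" "u + v = 1"
  have "u * (fst x + snd x) + v * (fst y + snd y) \<le> u * 1 + v * 1"
    using xy uv by (intro add_mono mult_left_mono) (auto simp: unit_triangle_def)
  then show "u *\<^sub>R x + v *\<^sub>R y \<in> unit_triangle"
    using xy uv by (auto simp: unit_triangle_def algebra_simps)
qed

text \<open>On cohomology, the pullback of \<open>dz / z\<close> along \<open>g\<close>.\<close>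

definition log_cochain :: "'x topology \<Rightarrow> ('x \<Rightarrow> complex) \<Rightarrow> 'x cochain" where
  "log_cochain X g = (\<lambda>\<sigma>. if singular_simplex 1 X \<sigma> then log_change (\<lambda>t. g (\<sigma> (edge_point t))) else 0)"

lemma continuous_map_triangle_point:
  "continuous_map (top_of_set unit_triangle) (subtopology (powertop_real UNIV) (standard_simplex 2)) triangle_point"
proof -
  have "continuous_map (top_of_set unit_triangle) euclideanreal (\<lambda>u. triangle_point u k)" for k
    unfolding triangle_point_def continuous_map_iff_continuous
    by (cases "k = 0"; cases "k = 1"; cases "k = 2") (auto intro!: continuous_intros)
  then show ?thesis
    by (auto simp: continuous_map_in_subtopology continuous_map_componentwise_UNIV triangle_point_mem)
qed

text \<open>The function pulled back to the contractible triangle has a single continuous logarithm.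
  Each edge contributes the difference of its values at the two ends, and these differences cancel
  around the triangle.\<close>

lemma log_cochain_cocycle:
  assumes g: "continuous_map X euclidean g" and nz: "\<And>x. x \<in> topspace X \<Longrightarrow> g x \<noteq> 0"
  shows "log_cochain X g \<in> cocycles 1 X"
proof -
  have "coboundary 2 X (log_cochain X g) \<sigma> = 0" for \<sigma>
  proof (cases "singular_simplex 2 X \<sigma>")
    case True
    then have \<sigma>: "continuous_map (subtopology (powertop_real UNIV) (standard_simplex 2)) X \<sigma>"
      by (simp add: singular_simplex_def)
    let ?h = "\<lambda>u. g (\<sigma> (triangle_point u))"
    have \<sigma>t: "continuous_map (top_of_set unit_triangle) X (\<sigma> \<circ> triangle_point)"
      by (rule continuous_map_compose[OF continuous_map_triangle_point \<sigma>])
    have cont: "continuous_on unit_triangle ?h"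
      using continuous_map_compose[OF \<sigma>t g] by (simp add: comp_def)
    have nonzero: "?h u \<noteq> 0" if "u \<in> unit_triangle" for u
    proof -
      have "\<sigma> (triangle_point u) \<in> topspace X"
        using continuous_map_funspace[OF \<sigma>t] that by (simp add: Pi_iff)
      then show ?thesis by (rule nz)
    qed
    obtain L where L: "continuous_on unit_triangle L" "\<And>u. u \<in> unit_triangle \<Longrightarrow> ?h u = exp (L u)"
      using continuous_logarithm_on_contractible[OF cont convex_imp_contractible[OF convex_unit_triangle] nonzero]
      by blast
    have face: "log_cochain X g (singular_face 2 k \<sigma>) = L (r 1) - L (r 0)"
      if k: "k \<le> 2" and r: "continuous_on {0..1} r" "\<And>t. t \<in> {0..1} \<Longrightarrow> r t \<in> unit_triangle"
        "\<And>t. simplical_face k (edge_point t) = triangle_point (r t)" for k r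
    proof -
      have "continuous_on {0..1} (\<lambda>t. L (r t))"
        using continuous_on_compose2[OF L(1) r(1)] r(2) by blast
      moreover have "g (singular_face 2 k \<sigma> (edge_point t)) = exp (L (r t))" if "t \<in> {0..1}" for t
        using L(2)[OF r(2)[OF that]] edge_point_mem[OF that] by (simp add: singular_face_def r(3))
      ultimately have "log_change (\<lambda>t. g (singular_face 2 k \<sigma> (edge_point t))) = L (r 1) - L (r 0)"
        by (rule log_change_eq)
      then show ?thesis
        using singular_simplex_face_2[OF True k] by (simp add: log_cochain_def)
    qed
    \<comment> \<open>The entries \<open>1 - 1\<close> and \<open>1 - 0\<close> come from the
      endpoints of \<open>r\<close>, left unsimplified so that they match
      \<open>face\<close>.\<close>
    have "log_cochain X g (singular_face 2 0 \<sigma>) = L (1 - 1, 1) - L (1 - 0, 0)"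
      by (rule face[where r = "\<lambda>t. (1 - t, t)"])
        (auto intro!: continuous_intros simp: unit_triangle_def simplical_face_def edge_point_def triangle_point_def fun_eq_iff)
    moreover have "log_cochain X g (singular_face 2 1 \<sigma>) = L (0, 1) - L (0, 0)"
      by (rule face[where r = "\<lambda>t. (0, t)"])
        (auto intro!: continuous_intros simp: unit_triangle_def simplical_face_def edge_point_def triangle_point_def fun_eq_iff)
    moreover have "log_cochain X g (singular_face 2 2 \<sigma>) = L (1, 0) - L (0, 0)"
      by (rule face[where r = "\<lambda>t. (t, 0)"])
        (auto intro!: continuous_intros simp: unit_triangle_def simplical_face_def edge_point_def triangle_point_def fun_eq_iff)
    ultimately show ?thesis by (simp add: coboundary_2[OF True])
  qed (simp add: coboundary_def)
  then show ?thesis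
    by (auto simp: cocycles_def carrier_cochain log_cochain_def numeral_2_eq_2)
qed

lemma coboundary_loop:
  assumes "n \<in> coboundaries 1 X" "singular_simplex 1 X \<sigma>" "\<sigma> (vertex 0) = \<sigma> (vertex 1)"
  shows "n \<sigma> = 0"
  using assms coboundary_1[OF assms(2)] by (auto simp: coboundaries_def)

text \<open>More classes than \<open>length es\<close> would be linearly dependent. Then a
  combination of the cocycles is a coboundary and vanishes on every loop, whereas its value on loop
  \<open>j\<close> is \<open>\<omega>\<close> times the \<open>j\<close>-th coefficient.\<close>

lemma card_le_of_dual_loops:
  assumes es: "ordered_basis (singular_cohomology 1 X) es"
    and J: "finite J" and f: "\<And>j. j \<in> J \<Longrightarrow> f j \<in> cocycles 1 X"
    and \<sigma>: "\<And>j. j \<in> J \<Longrightarrow> singular_simplex 1 X (\<sigma> j)" "\<And>j. j \<in> J \<Longrightarrow> \<sigma> j (vertex 0) = \<sigma> j (vertex 1)"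
    and period: "\<And>j k. j \<in> J \<Longrightarrow> k \<in> J \<Longrightarrow> f k (\<sigma> j) = (if k = j then \<omega> else 0)" and \<omega>: "\<omega> \<noteq> 0"
  shows "card J \<le> length es"
proof (rule ccontr)
  assume "\<not> card J \<le> length es"
  then have less: "card {..<length es} < card J" by simp
  define V where "V = singular_cohomology 1 X"
  interpret V: based_space V es
    unfolding V_def by (intro based_space.intro based_space_axioms.intro vectorspace_singular_cohomology es)
  obtain c where c: "\<exists>j\<in>J. c j \<noteq> 0"
    "\<And>k. k \<in> {..<length es} \<Longrightarrow> (\<Sum>j\<in>J. V.coords (cohomology_class 1 X (f j)) k * c j) = 0"
    using underdetermined_system[OF finite_lessThan J less,
        of "\<lambda>k j. V.coords (cohomology_class 1 X (f j)) k"] by blast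
  define s where "s K = (\<lambda>\<tau>. \<Sum>j\<in>K. c j * f j \<tau>)" for K
  have s: "s K \<in> cocycles 1 X \<and> (\<forall>k. V.coords (cohomology_class 1 X (s K)) k =
      (\<Sum>j\<in>K. V.coords (cohomology_class 1 X (f j)) k * c j))" if "finite K" "K \<subseteq> J" for K
    using that
  proof (induction K rule: finite_induct)
    case empty
    have "s {} = (\<lambda>_. 0)" by (simp add: s_def)
    then show ?case
      using V.coords_zero coboundaries_zero[of 1 X] coboundaries_subset[of 1 X]
      by (auto simp: V_def zero_singular_cohomology')
  next
    case (insert j K)
    have eq: "s (insert j K) = (\<lambda>\<tau>. c j * f j \<tau> + s K \<tau>)"
      using insert.hyps by (simp add: s_def)
    have fj: "f j \<in> cocycles 1 X" using insert.prems f by blast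
    have sK: "s K \<in> cocycles 1 X" using insert by blast
    have car: "cohomology_class 1 X h \<in> carrier V" if "h \<in> cocycles 1 X" for h
      using that unfolding V_def carrier_singular_cohomology by blast
    have "cohomology_class 1 X (s (insert j K)) =
        c j \<odot>\<^bsub>V\<^esub> cohomology_class 1 X (f j) \<oplus>\<^bsub>V\<^esub> cohomology_class 1 X (s K)"
      unfolding eq V_def by (simp only: add_singular_cohomology smult_singular_cohomology)
    then have "V.coords (cohomology_class 1 X (s (insert j K))) k =
        c j * V.coords (cohomology_class 1 X (f j)) k + V.coords (cohomology_class 1 X (s K)) k" for k
      using car[OF fj] car[OF sK] by (simp add: V.coords_add V.coords_smult del: One_nat_def)
    then show ?case
      using insert cocycles_add[OF cocycles_smult[OF fj] sK] by (simp add: eq mult.commute del: One_nat_def)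
  qed
  have sJ: "s J \<in> cocycles 1 X" using s[OF J] by blast
  have "cohomology_class 1 X (s J) \<in> carrier V"
    using sJ unfolding V_def carrier_singular_cohomology by blast
  then have "cohomology_class 1 X (s J) = \<zero>\<^bsub>V\<^esub>"
    using V.coords_eq_iff[of "cohomology_class 1 X (s J)" "\<zero>\<^bsub>V\<^esub>"] s[OF J] c(2)
    by (simp add: V.coords_zero del: One_nat_def)
  then have "s J \<in> coboundaries 1 X"
    unfolding V_def zero_singular_cohomology' cohomology_class_eq_iff by simp
  then have "s J (\<sigma> j) = 0" if "j \<in> J" for j
    using coboundary_loop[OF _ \<sigma>[OF that]] by blast
  moreover have "s J (\<sigma> j) = c j * \<omega>" if "j \<in> J" for j
  proof -
    have "s J (\<sigma> j) = (\<Sum>k\<in>J. if k = j then c j * \<omega> else 0)"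
      unfolding s_def by (rule sum.cong) (use period that in auto)
    then show ?thesis using J that by simp
  qed
  ultimately show False using c(1) \<omega> by force
qed

section \<open>The complement of an arrangement\<close>

definition form :: "complex ^ 'n \<Rightarrow> complex ^ 'n \<Rightarrow> complex" where
  "form a x = (\<Sum>k\<in>UNIV. a $ k * x $ k)"

lemma form_add: "form a (x + y) = form a x + form a y"
  by (simp add: form_def distrib_left sum.distrib)

lemma form_smult: "form a (c *s x) = c * form a x"
  by (simp add: form_def sum_distrib_left mult.left_commute)

lemma form_axis: "form a (axis k 1) = a $ k"
  by (simp add: form_def axis_def if_distrib cong: if_cong)

lemma form_nonzero: "a \<noteq> 0 \<Longrightarrow> \<exists>x. form a x \<noteq> 0"
  unfolding Finite_Cartesian_Product.vec_eq_iff by (metis form_axis zero_index)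

lemma continuous_on_form: "continuous_on S (form a)"
  unfolding form_def by (intro continuous_intros)

lemma span_singleton_eq_form:
  assumes "vec.span {v :: complex ^ 'n} = vec.span {w}" "w \<noteq> 0"
  obtains c where "c \<noteq> 0" "w = c *s v"
proof -
  have "w \<in> vec.span {v}" using assms(1) vec.span_base[of w "{w}"] by simp
  then obtain c where "w = c *s v" by (auto simp: vec.span_singleton)
  then show thesis using assms(2) that[of c] by auto
qed

locale form_arrangement =
  fixes D :: "(complex ^ 'n) set set" and \<alpha> :: "(complex ^ 'n) set \<Rightarrow> complex ^ 'n"
  assumes finite: "finite D"
    and form_nz: "\<And>H. H \<in> D \<Longrightarrow> \<alpha> H \<noteq> 0"
    and zeros: "\<And>H. H \<in> D \<Longrightarrow> H = affine_form_zeros (\<alpha> H) 0"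
begin

lemma mem_iff: "H \<in> D \<Longrightarrow> x \<in> H \<longleftrightarrow> form (\<alpha> H) x = 0"
  by (subst zeros) (auto simp: affine_form_zeros_def form_def)

definition E :: "(complex ^ 'n) set" where
  "E = {x. \<forall>H\<in>D. form (\<alpha> H) x \<noteq> 0}"

lemma open_E: "open E"
proof -
  have "E = (\<Inter>H\<in>D. form (\<alpha> H) -` (- {0}))" by (auto simp: E_def)
  then show ?thesis
    using finite by (auto intro!: open_INT open_vimage continuous_on_form)
qed

text \<open>The complex line through two points of the complement meets the arrangement in finitely many points.\<close>

lemma path_connected_E: "path_connected E"
  unfolding path_connected_component
proof (intro ballI)
  fix x y assume x: "x \<in> E" and y: "y \<in> E"
  \<comment> \<open>\<open>B\<close> holds the parameters at which the line meets a hyperplane. A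
    form that vanishes on \<open>y - x\<close> is constant along the line and nonzero at
    \<open>x\<close>, so it gives no such parameter.\<close>
  define B where "B = (\<lambda>H. - form (\<alpha> H) x / form (\<alpha> H) (y - x)) ` {H\<in>D. form (\<alpha> H) (y - x) \<noteq> 0}"
  let ?l = "\<lambda>t. x + t *s (y - x)"
  have form_l: "form (\<alpha> H) (?l t) = form (\<alpha> H) x + t * form (\<alpha> H) (y - x)" for H t
    by (simp only: form_add form_smult)
  \<comment> \<open>The parameter is complex: removing finitely many points from a real plane leaves
    it path connected.\<close>
  have "path_connected (- B)"
    using finite by (intro path_connected_complement_countable) (auto simp: B_def countable_finite)
  moreover have "continuous_on (- B) ?l"
    unfolding vector_scalar_mult_def by (intro continuous_intros)
  ultimately have pc: "path_connected (?l ` (- B))" by (rule path_connected_continuous_image[rotated])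
  have "?l t \<in> E" if t: "t \<notin> B" for t
    unfolding E_def
  proof (clarify)
    fix H assume H: "H \<in> D" and 0: "form (\<alpha> H) (?l t) = 0"
    have nz: "form (\<alpha> H) (y - x) \<noteq> 0" using x H 0 unfolding form_l E_def by auto
    then have "t = - form (\<alpha> H) x / form (\<alpha> H) (y - x)"
      using 0 unfolding form_l by (simp add: field_simps eq_neg_iff_add_eq_0)
    then have "t \<in> B" using H nz by (auto simp: B_def)
    then show False using t by blast
  qed
  then have sub: "?l ` (- B) \<subseteq> E" by blast
  have "0 \<notin> B" using x by (auto simp: B_def E_def)
  moreover have "1 \<notin> B"
  proof
    assume "1 \<in> B"
    then obtain H where H: "H \<in> D" "form (\<alpha> H) (y - x) \<noteq> 0" "1 = - form (\<alpha> H) x / form (\<alpha> H) (y - x)"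
      by (auto simp: B_def)
    then have "form (\<alpha> H) (?l 1) = 0" unfolding form_l by (simp add: field_simps)
    then show False using y H(1) by (auto simp: E_def)
  qed
  ultimately have "?l 0 \<in> ?l ` (- B)" "?l 1 \<in> ?l ` (- B)" by blast+
  then have "x \<in> ?l ` (- B)" "y \<in> ?l ` (- B)" by simp_all
  then have "path_component (?l ` (- B)) x y"
    using pc unfolding path_connected_component by blast
  then show "path_component E x y" by (rule path_component_of_subset[OF sub])
qed

text \<open>From a point avoiding the earlier hyperplanes one moves along a vector on which the new
  form is nonzero; only finitely many parameter values are bad, and the field is infinite.\<close>

lemma avoid_hyperplanes:
  assumes "finite K" "\<And>H. H \<in> K \<Longrightarrow> \<exists>x. form c x = 0 \<and> form (\<alpha> H) x \<noteq> 0"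
  shows "\<exists>x. form c x = 0 \<and> (\<forall>H\<in>K. form (\<alpha> H) x \<noteq> 0)"
  using assms
proof (induction K rule: finite_induct)
  case empty
  have "form c 0 = 0" by (simp add: form_def)
  then show ?case by blast
next
  case (insert G K)
  then obtain w where w: "form c w = 0" "\<forall>H\<in>K. form (\<alpha> H) w \<noteq> 0" by blast
  obtain u where u: "form c u = 0" "form (\<alpha> G) u \<noteq> 0" using insert.prems by blast
  \<comment> \<open>Where the denominator is zero the quotient is zero by convention, which merely
    excludes \<open>t = 0\<close> as well.\<close>
  have "finite ((\<lambda>H. - form (\<alpha> H) w / form (\<alpha> H) u) ` insert G K)" using insert.hyps by simp
  then obtain t where t: "t \<notin> (\<lambda>H. - form (\<alpha> H) w / form (\<alpha> H) u) ` insert G K"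
    using ex_new_if_finite[OF infinite_UNIV_char_0] by blast
  have "form (\<alpha> H) (w + t *s u) \<noteq> 0" if H: "H \<in> insert G K" for H
  proof (cases "form (\<alpha> H) u = 0")
    case True
    then have "H \<in> K" using H u by auto
    then show ?thesis using True w by (simp add: form_add form_smult)
  next
    case False
    have "t \<noteq> - form (\<alpha> H) w / form (\<alpha> H) u" using t H by blast
    then show ?thesis using False
      by (simp add: form_add form_smult field_simps eq_neg_iff_add_eq_0)
  qed
  moreover have "form c (w + t *s u) = 0" using w u by (simp add: form_add form_smult)
  ultimately show ?case by blast
qed

text \<open>If one form vanished wherever the other does, the two would be proportional and define
  the same hyperplane.\<close>

lemma distinct_hyperplanes:
  assumes "G \<in> D" "H \<in> D" "G \<noteq> H"
  shows "\<exists>x. form (\<alpha> G) x = 0 \<and> form (\<alpha> H) x \<noteq> 0"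
proof (rule ccontr)
  assume "\<nexists>x. form (\<alpha> G) x = 0 \<and> form (\<alpha> H) x \<noteq> 0"
  then have sub: "form (\<alpha> H) x = 0" if "form (\<alpha> G) x = 0" for x using that by blast
  obtain u where u: "form (\<alpha> G) u \<noteq> 0" using form_nonzero[OF form_nz[OF assms(1)]] by blast
  have ratio: "form (\<alpha> H) x = form (\<alpha> G) x / form (\<alpha> G) u * form (\<alpha> H) u" for x
  proof -
    have "form (\<alpha> G) (x + (- (form (\<alpha> G) x / form (\<alpha> G) u)) *s u) = 0"
      unfolding form_add form_smult using u by simp
    from sub[OF this] show ?thesis unfolding form_add form_smult by simp
  qed
  obtain y where y: "form (\<alpha> H) y \<noteq> 0" using form_nonzero[OF form_nz[OF assms(2)]] by blast
  then have "form (\<alpha> H) u \<noteq> 0" using ratio[of y] by auto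
  then have "form (\<alpha> H) x = 0 \<longleftrightarrow> form (\<alpha> G) x = 0" for x using u ratio[of x] by simp
  then have "x \<in> G \<longleftrightarrow> x \<in> H" for x using mem_iff assms(1,2) by simp
  then have "G = H" by blast
  then show False using assms(3) by blast
qed

lemma span_form_ratio:
  assumes "vec.span {v} = vec.span {w}" "v \<in> E" "w \<in> E" "G \<in> D"
  shows "form a v / form (\<alpha> G) v = form a w / form (\<alpha> G) w"
proof -
  have "w \<noteq> 0" using assms(3,4) by (auto simp: E_def form_def)
  then obtain c where "c \<noteq> 0" "w = c *s v" using span_singleton_eq_form[OF assms(1)] by blast
  then show ?thesis by (simp add: form_smult)
qed

end

text \<open>\<open>H0\<close> acts as the hyperplane at infinity: it is the common denominator of
  the logarithmic functions and keeps the origin out of \<open>E\<close>.\<close>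

locale nonempty_form_arrangement = form_arrangement D \<alpha>
  for D :: "(complex ^ 'n) set set" and \<alpha> + fixes H0 assumes H0: "H0 \<in> D"
begin

text \<open>A quotient map restricted to the preimage of an open set is again one. This transports
  path connectedness from \<open>E\<close> and lets continuous functions that are constant on lines
  descend.\<close>

lemma quotient_map_complement:
  "quotient_map (top_of_set E) (proj_complement D) (\<lambda>v. vec.span {v})"
proof -
  let ?q = "\<lambda>v::complex^'n. vec.span {v}" and ?P = "proj_space :: (complex^'n) set topology"
  have q: "quotient_map (top_of_set (- {0})) ?P ?q" by (rule quotient_map_proj_space)
  define W where "W = topspace ?P - proj_union D"
  have ts: "topspace ?P = ?q ` (- {0})" using q by (simp add: quotient_map_def)
  have mem: "?q v \<in> proj_union D \<longleftrightarrow> v \<notin> E" if v: "v \<noteq> 0" for v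
  proof
    assume "?q v \<in> proj_union D"
    then obtain w H where w: "w \<noteq> 0" "H \<in> D" "w \<in> H" "vec.span {v} = vec.span {w}"
      unfolding proj_union_def by auto
    obtain c where "c \<noteq> 0" "w = c *s v" using span_singleton_eq_form[OF w(4,1)] .
    then have "form (\<alpha> H) v = 0" using w mem_iff[OF w(2)] by (simp add: form_smult)
    then show "v \<notin> E" using w(2) by (auto simp: E_def)
  next
    assume "v \<notin> E"
    then obtain H where "H \<in> D" "v \<in> H" using mem_iff by (auto simp: E_def)
    then show "?q v \<in> proj_union D" using v unfolding proj_union_def by blast
  qed
  have "0 \<notin> E" using H0 by (auto simp: E_def form_def)
  have pre: "{v \<in> topspace (top_of_set (- {0})). ?q v \<in> W} = E"
  proof (rule Set.set_eqI)
    fix v show "v \<in> {v \<in> topspace (top_of_set (- {0})). ?q v \<in> W} \<longleftrightarrow> v \<in> E"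
      using mem[of v] ts \<open>0 \<notin> E\<close> by (cases "v = 0") (simp_all add: W_def)
  qed
  have "openin (top_of_set (- {0})) E"
    using open_E \<open>0 \<notin> E\<close> by (intro open_subset) auto
  then have "openin ?P W"
    using q[unfolded quotient_map_def, THEN conjunct2, rule_format, of W] unfolding pre
    by (simp add: W_def)
  then have "quotient_map (subtopology (top_of_set (- {0})) E) (subtopology ?P W) ?q"
    by (intro quotient_map_restriction[OF q pre] disjI1)
  moreover have "subtopology (top_of_set (- {0})) E = top_of_set E"
    using \<open>0 \<notin> E\<close> by (simp add: subtopology_subtopology Int_absorb1 subset_Compl_singleton)
  ultimately show ?thesis unfolding proj_complement_def W_def by simp
qed

lemma path_connected_complement: "path_connected_space (proj_complement D)"
  using path_connected_space_quotient_map_image[OF quotient_map_complement] path_connected_E by simp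

lemma topspace_complement: "topspace (proj_complement D) = (\<lambda>v. vec.span {v}) ` E"
  using quotient_map_complement by (simp add: quotient_map_def)

text \<open>A linear form is no function on lines, but the quotient of two forms is, having degree
  zero.\<close>

lemma ratio_function:
  assumes "H \<in> D"
  obtains g where "continuous_map (proj_complement D) euclidean g"
    "\<And>l. l \<in> topspace (proj_complement D) \<Longrightarrow> g l \<noteq> 0"
    "\<And>v. v \<in> E \<Longrightarrow> g (vec.span {v}) = form (\<alpha> H) v / form (\<alpha> H0) v"
proof -
  let ?h = "\<lambda>v. form (\<alpha> H) v / form (\<alpha> H0) v"
  have "continuous_on E ?h"
    using H0 by (intro continuous_on_divide continuous_on_form) (auto simp: E_def)
  then have h: "continuous_map (top_of_set E) euclidean ?h" by simp
  obtain g where g: "continuous_map (proj_complement D) euclidean g"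
    "\<And>v. v \<in> topspace (top_of_set E) \<Longrightarrow> g (vec.span {v}) = ?h v"
    by (rule quotient_map_lift_exists[OF quotient_map_complement h]) (auto intro: span_form_ratio H0)
  show thesis
  proof (rule that[OF g(1)])
    show "g (vec.span {v}) = ?h v" if "v \<in> E" for v using g(2) that by simp
    fix l assume "l \<in> topspace (proj_complement D)"
    then obtain v where "v \<in> E" "l = vec.span {v}" by (auto simp: topspace_complement)
    then show "g l \<noteq> 0" using g(2)[of v] assms H0 by (auto simp: E_def)
  qed
qed

text \<open>A small circle around a point of \<open>H\<close> that lies on no other hyperplane; the numbers \<open>\<Lambda> K t\<close> are
  logarithms of the defining forms along it.\<close>

lemma meridian:
  assumes H: "H \<in> D"
  obtains \<gamma> :: "real \<Rightarrow> complex ^ 'n" and \<Lambda> where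
    "continuous_on {0..1} \<gamma>" "\<gamma> 0 = \<gamma> 1" "\<And>t. \<gamma> t \<in> E"
    "\<And>K. K \<in> D \<Longrightarrow> continuous_on {0..1} (\<Lambda> K)"
    "\<And>K t. K \<in> D \<Longrightarrow> form (\<alpha> K) (\<gamma> t) = exp (\<Lambda> K t)"
    "\<And>K. K \<in> D \<Longrightarrow> \<Lambda> K 1 - \<Lambda> K 0 = (if K = H then 2 * pi * \<i> else 0)"
proof -
  obtain p where p: "form (\<alpha> H) p = 0" "\<And>K. K \<in> D - {H} \<Longrightarrow> form (\<alpha> K) p \<noteq> 0"
    using avoid_hyperplanes[of "D - {H}" "\<alpha> H"] finite distinct_hyperplanes[OF H] by fastforce
  obtain v where v: "form (\<alpha> H) v \<noteq> 0" using form_nonzero[OF form_nz[OF H]] by blast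
  \<comment> \<open>For \<open>K = H\<close> the denominator vanishes, so \<open>s H = 0\<close> by
    convention and the bounds below hold there too.\<close>
  define s where "s K = form (\<alpha> K) v / form (\<alpha> K) p" for K
  \<comment> \<open>With this radius each \<open>\<epsilon> * s K\<close> has modulus below 1, so
    \<open>1 + z t * s K\<close> stays in the right half plane, where the principal logarithm is
    continuous.\<close>
  define \<epsilon> where "\<epsilon> = 1 / (1 + (\<Sum>K\<in>D. cmod (s K)))"
  have sum0: "0 \<le> (\<Sum>K\<in>D. cmod (s K))" by (intro sum_nonneg) simp
  then have \<epsilon>: "\<epsilon> > 0" by (simp add: \<epsilon>_def)
  have small: "cmod (of_real \<epsilon> * s K) < 1" if "K \<in> D" for K
  proof -
    have "cmod (s K) \<le> (\<Sum>K\<in>D. cmod (s K))"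
      by (rule member_le_sum[OF that]) (simp_all add: finite)
    then have "cmod (s K) < 1 + (\<Sum>K\<in>D. cmod (s K))" by simp
    then have "\<epsilon> * cmod (s K) < 1" using sum0 by (simp add: \<epsilon>_def field_simps)
    then show ?thesis using \<epsilon> by (simp add: norm_mult)
  qed
  define z where "z t = of_real \<epsilon> * exp (2 * pi * \<i> * of_real t)" for t :: real
  have z_cont: "continuous_on {0..1} z" unfolding z_def by (intro continuous_intros)
  have z_norm: "cmod (z t) = \<epsilon>" for t
    using \<epsilon> by (simp add: z_def norm_mult norm_exp_eq_Re)
  have z01: "z 0 = z 1" by (simp add: z_def exp_two_pi_i)
  define \<gamma> where "\<gamma> t = p + z t *s v" for t
  \<comment> \<open>Only the form of \<open>H\<close> winds around zero, once, hence the summand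
    linear in \<open>t\<close>; the other logarithms return to their initial value because
    \<open>z 0 = z 1\<close>.\<close>
  define \<Lambda> where "\<Lambda> K t = (if K = H then Ln (of_real \<epsilon> * form (\<alpha> H) v) + 2 * pi * \<i> * of_real t
    else Ln (form (\<alpha> K) p) + Ln (1 + z t * s K))" for K t
  have zs: "cmod (z t * s K) < 1" if "K \<in> D" for K t
    using small[OF that] \<epsilon> by (simp add: norm_mult z_norm)
  have nonpos: "1 + z t * s K \<notin> \<real>\<^sub>\<le>\<^sub>0" if "K \<in> D" for K t
  proof -
    have "Re (z t * s K) > -1" using zs[OF that, of t] abs_Re_le_cmod[of "z t * s K"] by linarith
    then have "Re (1 + z t * s K) > 0" by simp
    then show ?thesis by (auto simp: complex_nonpos_Reals_iff)
  qed
  have exp_\<Lambda>: "form (\<alpha> K) (\<gamma> t) = exp (\<Lambda> K t)" if K: "K \<in> D" for K t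
  proof (cases "K = H")
    case True
    then show ?thesis using p(1) v \<epsilon>
      by (simp add: \<gamma>_def \<Lambda>_def form_add form_smult exp_add z_def)
  next
    case False
    then have nz: "form (\<alpha> K) p \<noteq> 0" using p(2) K by blast
    have nz2: "1 + z t * s K \<noteq> 0" using nonpos[OF K, of t] by auto
    have "form (\<alpha> K) (\<gamma> t) = form (\<alpha> K) p * (1 + z t * s K)"
      using nz by (simp add: \<gamma>_def s_def form_add form_smult field_simps)
    also have "\<dots> = exp (\<Lambda> K t)" using False nz nz2 by (simp add: \<Lambda>_def exp_add)
    finally show ?thesis .
  qed
  show thesis
  proof (rule that[of \<gamma> \<Lambda>])
    show "continuous_on {0..1} \<gamma>"
      unfolding \<gamma>_def vector_scalar_mult_def by (intro continuous_intros z_cont)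
    show "\<gamma> 0 = \<gamma> 1" by (simp add: \<gamma>_def z01)
    show "\<gamma> t \<in> E" for t using exp_\<Lambda> by (simp add: E_def)
    fix K assume K: "K \<in> D"
    show "continuous_on {0..1} (\<Lambda> K)"
      unfolding \<Lambda>_def using nonpos[OF K]
      by (cases "K = H") (auto intro!: continuous_intros z_cont)
    show "form (\<alpha> K) (\<gamma> t) = exp (\<Lambda> K t)" for t by (rule exp_\<Lambda>[OF K])
    show "\<Lambda> K 1 - \<Lambda> K 0 = (if K = H then 2 * pi * \<i> else 0)"
      by (simp add: \<Lambda>_def z01)
  qed
qed

text \<open>Along a loop around \<open>H\<close> different from \<open>H0\<close> the denominator
  does not wind, so the logarithmic cocycles of the ratios and these loops are dual families; one
  hyperplane is spent as the denominator.\<close>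

lemma card_le_betti:
  assumes es: "ordered_basis (singular_cohomology 1 (proj_complement D)) es"
  shows "card D - 1 \<le> length es"
proof -
  let ?X = "proj_complement D" and ?J = "D - {H0}"
  have "\<forall>H\<in>D. \<exists>g. continuous_map ?X euclidean g \<and> (\<forall>l\<in>topspace ?X. g l \<noteq> 0) \<and>
      (\<forall>v\<in>E. g (vec.span {v}) = form (\<alpha> H) v / form (\<alpha> H0) v)"
  proof
    fix H assume "H \<in> D"
    from ratio_function[OF this] show "\<exists>g. continuous_map ?X euclidean g \<and> (\<forall>l\<in>topspace ?X. g l \<noteq> 0) \<and>
      (\<forall>v\<in>E. g (vec.span {v}) = form (\<alpha> H) v / form (\<alpha> H0) v)" by metis
  qed
  from bchoice[OF this] obtain g where g: "\<forall>H\<in>D. continuous_map ?X euclidean (g H) \<and>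
      (\<forall>l\<in>topspace ?X. g H l \<noteq> 0) \<and> (\<forall>v\<in>E. g H (vec.span {v}) = form (\<alpha> H) v / form (\<alpha> H0) v)"
    by (elim exE)
  have loops: "\<exists>\<sigma>. singular_simplex 1 ?X \<sigma> \<and> \<sigma> (vertex 0) = \<sigma> (vertex 1) \<and>
      (\<forall>K\<in>?J. log_cochain ?X (g K) \<sigma> = (if K = H then 2 * pi * \<i> else 0))" if H: "H \<in> ?J" for H
  proof (rule meridian)
    show "H \<in> D" using H by blast
    fix \<gamma> :: "real \<Rightarrow> complex ^ 'n" and \<Lambda>
    assume \<gamma>: "continuous_on {0..1} \<gamma>" "\<gamma> 0 = \<gamma> 1" "\<And>t. \<gamma> t \<in> E"
      and \<Lambda>: "\<And>K. K \<in> D \<Longrightarrow> continuous_on {0..1} (\<Lambda> K)"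
        "\<And>K t. K \<in> D \<Longrightarrow> form (\<alpha> K) (\<gamma> t) = exp (\<Lambda> K t)"
        "\<And>K. K \<in> D \<Longrightarrow> \<Lambda> K 1 - \<Lambda> K 0 = (if K = H then 2 * pi * \<i> else 0)"
    define \<sigma> where "\<sigma> = restrict (\<lambda>x. vec.span {\<gamma> (x 1)}) (standard_simplex 1)"
    have "continuous_map (top_of_set {0..1}) (top_of_set E) \<gamma>"
      using \<gamma>(1,3) by (auto simp: continuous_map_in_subtopology)
    then have "continuous_map (top_of_set {0..1}) ?X ((\<lambda>v. vec.span {v}) \<circ> \<gamma>)"
      using quotient_imp_continuous_map[OF quotient_map_complement] continuous_map_compose by blast
    from singular_simplex_of_path[OF this] have \<sigma>: "singular_simplex 1 ?X \<sigma>"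
      by (simp add: \<sigma>_def comp_def)
    have "vertex 0 1 = 0" "vertex 1 1 = 1" by (simp_all add: vertex_def)
    then have loop: "\<sigma> (vertex 0) = \<sigma> (vertex 1)"
      using \<gamma>(2) by (simp add: \<sigma>_def vertex_mem del: One_nat_def)
    have "log_cochain ?X (g K) \<sigma> = (if K = H then 2 * pi * \<i> else 0)" if K: "K \<in> ?J" for K
    proof -
      have "log_change (\<lambda>t. g K (\<sigma> (edge_point t))) = (\<Lambda> K 1 - \<Lambda> H0 1) - (\<Lambda> K 0 - \<Lambda> H0 0)"
      proof (rule log_change_eq)
        show "continuous_on {0..1} (\<lambda>t. \<Lambda> K t - \<Lambda> H0 t)"
          using K H0 by (intro continuous_intros \<Lambda>(1)) auto
        fix t :: real assume t: "t \<in> {0..1}"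
        have "\<sigma> (edge_point t) = vec.span {\<gamma> t}"
          using edge_point_mem[OF t] by (simp add: \<sigma>_def edge_point_def)
        then show "g K (\<sigma> (edge_point t)) = exp (\<Lambda> K t - \<Lambda> H0 t)"
          using g K \<gamma>(3)[of t] \<Lambda>(2)[of K t] \<Lambda>(2)[OF H0, of t] by (simp add: exp_diff)
      qed
      also have "\<dots> = (if K = H then 2 * pi * \<i> else 0)"
        using \<Lambda>(3)[of K] \<Lambda>(3)[OF H0] K H by (auto simp: algebra_simps)
      finally show ?thesis using \<sigma> by (simp add: log_cochain_def)
    qed
    then show ?thesis using \<sigma> loop by blast
  qed
  have "\<forall>H\<in>?J. \<exists>\<sigma>. singular_simplex 1 ?X \<sigma> \<and> \<sigma> (vertex 0) = \<sigma> (vertex 1) \<and>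
      (\<forall>K\<in>?J. log_cochain ?X (g K) \<sigma> = (if K = H then 2 * pi * \<i> else 0))"
    by (rule ballI) (rule loops)
  from bchoice[OF this] obtain \<sigma> where \<sigma>: "\<forall>H\<in>?J. singular_simplex 1 ?X (\<sigma> H) \<and>
      \<sigma> H (vertex 0) = \<sigma> H (vertex 1) \<and>
      (\<forall>K\<in>?J. log_cochain ?X (g K) (\<sigma> H) = (if K = H then 2 * pi * \<i> else 0))"
    by (elim exE)
  have "card ?J \<le> length es"
  proof (rule card_le_of_dual_loops[OF es, where f = "\<lambda>K. log_cochain ?X (g K)" and \<sigma> = \<sigma> and \<omega> = "2 * pi * \<i>"])
    show "log_cochain ?X (g K) \<in> cocycles 1 ?X" if "K \<in> ?J" for K
      using g that by (intro log_cochain_cocycle) auto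
  qed (use \<sigma> finite in auto)
  then show ?thesis using finite H0 by simp
qed

end

section \<open>Products of coordinates and the number of hyperplanes\<close>

lemma prod_poly_var:
  assumes "finite K"
  shows "(\<Prod>k\<in>K. poly_var k) = Poly_Mapping.single (\<Sum>k\<in>K. Poly_Mapping.single k 1) 1"
  using assms by (induction K rule: finite_induct) (simp_all add: poly_var_def mult_single)

lemma keys_sum_single_1:
  assumes "finite K"
  shows "Poly_Mapping.keys (\<Sum>k\<in>K. Poly_Mapping.single k (1::nat)) = K"
proof -
  have "j \<in> Poly_Mapping.keys (\<Sum>k\<in>K. Poly_Mapping.single k (1::nat)) \<longleftrightarrow> j \<in> K" for j
    unfolding in_keys_iff lookup_sum lookup_single when_def using assms by simp
  then show ?thesis by blast
qed

lemma poly_vars_prod_poly_var: "finite K \<Longrightarrow> poly_vars (\<Prod>k\<in>K. poly_var k) = K"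
  by (simp add: prod_poly_var poly_vars_def keys_sum_single_1 del: One_nat_def)

lemma poly_vars_of_const: "p \<in> range poly_const \<Longrightarrow> poly_vars p = {}"
  by (auto simp: poly_vars_def poly_const_def split: if_splits)

lemma linear_form_axis: "linear_form (axis k 1) = poly_var k"
proof -
  have "linear_form (axis k 1) = (\<Sum>j\<in>UNIV. if j = k then poly_var j else 0)"
    unfolding linear_form_def
    by (intro sum.cong refl) (auto simp: axis_def poly_const_def)
  then show ?thesis by simp
qed

context form_arrangement
begin

text \<open>With at most \<open>n\<close> hyperplanes the defining forms are coordinates, and a product of two or more
  coordinates is decomposable.\<close>

lemma dim_less_card:
  assumes "\<Inter>D = {0}" "\<not> decomposable_arrangement D" "2 \<le> CARD('n)"
  shows "CARD('n) < card D"
proof (rule ccontr)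
  assume "\<not> CARD('n) < card D"
  then obtain h :: "(complex ^ 'n) set \<Rightarrow> 'n" where h: "inj_on h D"
    using card_le_inj[OF finite, of "UNIV :: 'n set"] by auto
  define A :: "complex ^ 'n ^ 'n" where
    "A = (\<chi> k. if k \<in> h ` D then \<alpha> (the_inv_into D h k) else 0)"
  have row: "A $ h H = \<alpha> H" if "H \<in> D" for H
    using that h by (simp add: A_def the_inv_into_f_f)
  have "x = 0" if x: "A *v x = 0" for x
  proof -
    have "form (\<alpha> H) x = 0" if "H \<in> D" for H
    proof -
      have "form (\<alpha> H) x = (A *v x) $ h H"
        by (simp add: matrix_vector_mult_def form_def row[OF that])
      then show ?thesis by (simp add: x)
    qed
    then have "x \<in> \<Inter>D" using mem_iff by blast
    then show ?thesis using assms(1) by blast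
  qed
  then obtain B where BA: "B ** A = Finite_Cartesian_Product.mat 1" using matrix_left_invertible_ker[of A] by blast
  then have AB: "A ** B = Finite_Cartesian_Product.mat 1" by (simp add: matrix_left_right_inverse)
  have rows: "A $ k v* B = axis k 1" for k
  proof -
    have "(A $ k v* B) $ j = (A ** B) $ k $ j" for j
      by (simp add: vector_matrix_mult_def matrix_matrix_mult_def mult.commute)
    then show ?thesis by (simp add: Finite_Cartesian_Product.vec_eq_iff AB Finite_Cartesian_Product.mat_def axis_def eq_commute)
  qed
  \<comment> \<open>An invertible matrix has no zero row, so there are exactly as many hyperplanes
    as coordinates.\<close>
  have "k \<in> h ` D" for k
  proof (rule ccontr)
    assume "k \<notin> h ` D"
    then have "A $ k = 0" by (simp add: A_def)
    then have "axis k (1::complex) = 0" using rows[of k] by simp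
    then show False by (simp add: axis_eq_0_iff)
  qed
  then have bij: "bij_betw h D UNIV" using h by (auto simp: bij_betw_def)
  \<comment> \<open>One variable is split off from the others; with at least two coordinates neither
    factor is constant.\<close>
  obtain k0 where "k0 \<in> (UNIV :: 'n set)" by blast
  let ?P = "poly_var k0" and ?Q = "\<Prod>k\<in>UNIV - {k0}. poly_var k"
  have "(\<Prod>H\<in>D. linear_form (\<alpha> H v* B)) = (\<Prod>H\<in>D. poly_var (h H))"
    by (rule prod.cong[OF refl]) (use rows row linear_form_axis in metis)
  also have "\<dots> = (\<Prod>k\<in>UNIV. poly_var k)" by (rule prod.reindex_bij_betw[OF bij])
  also have "\<dots> = ?P * ?Q" by (rule prod.remove) simp_all
  finally have prod: "(\<Prod>H\<in>D. linear_form (\<alpha> H v* B)) = ?P * ?Q" .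
  have vars: "poly_vars ?P = {k0}" "poly_vars ?Q = UNIV - {k0}"
    using poly_vars_prod_poly_var[of "{k0}"] poly_vars_prod_poly_var[of "UNIV - {k0}"] by simp_all
  have "UNIV - {k0} \<noteq> {}"
  proof
    assume "UNIV - {k0} = {}"
    then have "CARD('n) \<le> card {k0}" by (intro card_mono) auto
    then show False using assms(3) by simp
  qed
  then have nonconst: "?P \<notin> range poly_const" "?Q \<notin> range poly_const"
    using vars poly_vars_of_const[of ?P] poly_vars_of_const[of ?Q] by auto
  have inv: "invertible B" unfolding invertible_def by (intro exI[of _ A] conjI BA AB)
  have disj: "poly_vars ?P \<inter> poly_vars ?Q = {}" unfolding vars by simp
  have forms: "\<forall>H\<in>D. \<alpha> H \<noteq> 0 \<and> H = affine_form_zeros (\<alpha> H) 0"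
    by (intro ballI conjI form_nz zeros)
  have "decomposable_arrangement D"
    unfolding decomposable_arrangement_def
    by (rule exI[of _ \<alpha>], rule exI[of _ B], rule exI[of _ ?P], rule exI[of _ ?Q])
      (intro conjI forms inv prod nonconst disj)
  then show False using assms(2) by blast
qed

end

lemma central_arrangement_forms:
  assumes "hyperplane_arrangement D" "central_arrangement D"
  obtains \<alpha> where "form_arrangement D \<alpha>"
proof -
  have "\<forall>H\<in>D. \<exists>a. a \<noteq> 0 \<and> H = affine_form_zeros a 0"
  proof
    fix H assume H: "H \<in> D"
    then obtain a b where ab: "a \<noteq> 0" "H = affine_form_zeros a b"
      using assms(1) unfolding hyperplane_arrangement_def by blast
    moreover have "b = 0"
      using assms(2) H unfolding central_arrangement_def ab(2) by (auto simp: affine_form_zeros_def)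
    ultimately show "\<exists>a. a \<noteq> 0 \<and> H = affine_form_zeros a 0" by blast
  qed
  from bchoice[OF this] obtain \<alpha> where "\<forall>H\<in>D. \<alpha> H \<noteq> 0 \<and> H = affine_form_zeros (\<alpha> H) 0" by blast
  then have "form_arrangement D \<alpha>"
    using assms(1) unfolding form_arrangement_def hyperplane_arrangement_def by blast
  then show thesis by (rule that)
qed

theorem proposition5p2:
  fixes D :: "(complex ^ 'n) set set"
    and es fs :: "(complex ^ 'n) set cochain set list"
    and i :: nat
  assumes "CARD('n) \<ge> 3"
    and "hyperplane_arrangement D"
    and "central_arrangement D"
    and "essential_arrangement D"
    and "indecomposable_arrangement D"
    and "ordered_basis (singular_cohomology 1 (proj_complement D)) es"
    and "ordered_basis (singular_cohomology 2 (proj_complement D)) fs"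
    and "i < betti 1 (proj_complement D)"
  shows "let U = proj_complement D;
             b1 = betti 1 U;
             S = poly_ring_in {..<b1};
             M = minors (b1 - 1) (remove_col i (phi1 U es fs))
         in (\<forall>m\<in>M. \<exists>q\<in>S. m = poly_var i * q) \<and>
            resonance1 U = {v \<in> carrier (singular_cohomology 1 U).
              \<forall>m\<in>M. \<forall>q\<in>S. m = poly_var i * q \<longrightarrow>
                poly_eval (coordinates (singular_cohomology 1 U) es v) q = 0}"
proof -
  obtain \<alpha> where \<alpha>: "form_arrangement D \<alpha>"
    using central_arrangement_forms[OF assms(2,3)] .
  have "CARD('n) < card D"
    using form_arrangement.dim_less_card[OF \<alpha>] assms(1,4,5)
    by (simp add: essential_arrangement_def indecomposable_arrangement_def)
  \<comment> \<open>Four hyperplanes leave three after one serves as the denominator, which is the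
    bound on the first Betti number required at the origin.\<close>
  then have card: "4 \<le> card D" using assms(1) by simp
  then have "D \<noteq> {}" by auto
  then obtain H0 where "H0 \<in> D" by blast
  then interpret nonempty_form_arrangement D \<alpha> H0
    by (intro nonempty_form_arrangement.intro nonempty_form_arrangement_axioms.intro \<alpha>)
  interpret V: based_space "singular_cohomology 1 (proj_complement D)" es
    by (intro based_space.intro based_space_axioms.intro vectorspace_singular_cohomology assms(6))
  have "betti 1 (proj_complement D) = length es"
    unfolding betti_def by (rule V.dim_eq_length)
  then have "3 \<le> betti 1 (proj_complement D)"
    using card_le_betti[OF assms(6)] card by linarith
  note result = minors_and_resonance1[OF path_connected_complement assms(6,7,8) this]
  show ?thesis unfolding Let_def by (intro conjI result)
qed

end
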